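(* The $\mathbb Z[q,q^{-1}]$-linearization of the monoidal category $\mathcal{SC}_{\mathrm{Webs}}$ and the category $\mathrm{Webs}^\infty$, each equipped with the filtration by web degree, have isomorphic associated graded categories.
   Context: Objects of both categories are finite sequences of non-negative integers, with concatenation as tensor product; the object $0$ is treated as the monoidal identity, and edges labelled $0$ are erased freely. Morphisms in both categories are monoidally generated by merges $m_{a,b}:(a,b)\to(a+b)$ and splits $s_{a,b}:(a+b)\to(a,b)$, $a,b\ge1$. A web is a diagram built from merges, splits and identities by composition (bottom to top) and tensor product. $\mathcal{SC}_{\mathrm{Webs}}$ is the (non-linear) monoidal category with these generators and relations (all valid labels): Bigon: $m_{a,b}s_{a,b}=\mathrm{id}_{a+b}$. Associativity: $m_{a+b,c}(m_{a,b}\otimes\mathrm{id}_c)=m_{a,b+c}(\mathrm{id}_a\otimes m_{b,c})$. Coassociativity: $(s_{a,b}\otimes\mathrm{id}_c)s_{a+b,c}=(\mathrm{id}_a\otimes s_{b,c})s_{a,b+c}$. Square, for $1\le a,b\le N-1$, $a+b<N$: $(\mathrm{id}_b\otimes m_{a,N-a-b})(s_{b,a}\otimes\mathrm{id})(m_{a,b}\otimes\mathrm{id})(\mathrm{id}_a\otimes s_{b,N-a-b})=s_{b,N-b}m_{a,N-a}$. Square, for $1\le a,b\le N-1$, $a+b>N$: $(m_{a+b-N,N-a}\otimes\mathrm{id}_{N-b})(\mathrm{id}\otimes s_{N-a,N-b})(\mathrm{id}\otimes m_{N-b,N-a})(s_{a+b-N,N-b}\otimes\mathrm{id}_{N-a})=s_{b,N-b}m_{a,N-a}$.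 $\mathrm{Webs}^\infty$ is the $\mathbb Z[q,q^{-1}]$-linear monoidal category of Cautis--Kamnitzer--Morrison type $A$ webs in the limit $n\to\infty$ of $\mathrm{Webs}(\mathfrak{gl}_n)$: same generators, with the associativity and coassociativity relations above, the bigon relation $m_{a,b}s_{a,b}=\binom{a+b}{a}_q\mathrm{id}_{a+b}$, and the square flop relations. To state the latter, for two adjacent strands $(a,x)$ let $E^{(f)}=(m_{a,f}\otimes\mathrm{id}_{x-f})(\mathrm{id}_a\otimes s_{f,x-f}):(a,x)\to(a+f,x-f)$ and $F^{(g)}=(\mathrm{id}_{a-g}\otimes m_{g,x})(s_{a-g,g}\otimes\mathrm{id}_x):(a,x)\to(a-g,x+g)$ (zero if a label is negative). Then on $(a,x)$: $F^{(g)}E^{(f)}=\sum_{t\ge0}\binom{x-a+g-f}{t}_qE^{(f-t)}F^{(g-t)}$ and $E^{(f)}F^{(g)}=\sum_{t\ge0}\binom{a-x+f-g}{t}_qF^{(g-t)}E^{(f-t)}$. Here $[k]=\frac{q^k-q^{-k}}{q-q^{-1}}$ and $\binom{k}{t}_q=\prod_{i=1}^t\frac{[k-i+1]}{[i]}$ for $k\in\mathbb Z$, $t\ge0$. Degree and filtration: $\deg m_{a,b}=\deg s_{a,b}=ab$, and the degree of a web is the sum of the degrees of its vertices. A morphism lies in filtration degree $\le k$ if it is a linear combination of webs of degree at most $k$. This filtration is compatible with composition and tensor product, and the associated graded category has the same objects and morphism spaces $\bigoplus_kF_{\le k}/F_{\le k-1}$. *)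

theory Defs
  imports "HOL-Algebra.Module" "HOL-Algebra.AbelCoset" "HOL-Library.Poly_Mapping"
begin

section \<open>Laurent polynomials and quantum binomials\<close>

text \<open>\<open>\<int>[q, q\<^sup>-\<^sup>1]\<close> is the group ring of the additive group of integers.\<close>

type_synonym laurent = "int \<Rightarrow>\<^sub>0 int"

definition qpow :: "int \<Rightarrow> laurent"
  where "qpow k = Poly_Mapping.single k 1"

text \<open>The quotients below are exact divisions in the integral domain \<open>\<int>[q, q\<^sup>-\<^sup>1]\<close>;
  existence and uniqueness are \<open>qint_mult\<close>, \<open>qint_unique\<close>, \<open>qbinom_mult\<close> and
  \<open>qbinom_unique\<close>.\<close>

definition qint :: "int \<Rightarrow> laurent"
  where "qint k = (THE p. p * (qpow 1 - qpow (-1)) = qpow k - qpow (-k))"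

definition qbinom :: "int \<Rightarrow> nat \<Rightarrow> laurent"
  where "qbinom k t =
    (THE p. p * (\<Prod>i=1..t. qint (int i)) = (\<Prod>i=1..t. qint (k - int i + 1)))"

lemma qpow_add: "qpow a * qpow b = qpow (a + b)"
  by (simp add: qpow_def mult_single)

lemma qpow_0: "qpow 0 = 1"
  by (simp add: qpow_def)

lemma qpow_eq_iff: "qpow a = qpow b \<longleftrightarrow> a = b"
  by (metis qpow_def lookup_single_eq lookup_single_not_eq zero_neq_one)

lemma qint_ex_nat:
  "\<exists>p. p * (qpow 1 - qpow (-1)) = qpow (int n) - qpow (- int n)"
proof (induction n)
  case 0
  show ?case by (intro exI[of _ 0]) simp
next
  case (Suc n)
  then obtain p where p: "p * (qpow 1 - qpow (-1)) = qpow (int n) - qpow (- int n)" by blast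
  have "(qpow (-1) * p + qpow (int n)) * (qpow 1 - qpow (-1))
      = qpow (-1) * (p * (qpow 1 - qpow (-1))) + qpow (int n) * (qpow 1 - qpow (-1))"
    by (simp add: algebra_simps)
  also have "\<dots> = qpow (int (Suc n)) - qpow (- int (Suc n))"
    unfolding p by (simp add: right_diff_distrib qpow_add add.commute)
  finally show ?case by blast
qed

lemma qint_ex: "\<exists>p. p * (qpow 1 - qpow (-1)) = qpow k - qpow (-k)"
proof (cases "k \<ge> 0")
  case True
  then show ?thesis using qint_ex_nat[of "nat k"] by simp
next
  case False
  then obtain p where "p * (qpow 1 - qpow (-1)) = qpow (-k) - qpow k"
    using qint_ex_nat[of "nat (-k)"] by auto
  then have "(-p) * (qpow 1 - qpow (-1)) = qpow k - qpow (-k)" by simp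
  then show ?thesis by blast
qed

lemma q_diff_nonzero: "qpow 1 - qpow (-1) \<noteq> 0"
  by (simp add: qpow_eq_iff)

lemma qint_unique:
  assumes "p * (qpow 1 - qpow (-1)) = qpow k - qpow (-k)"
  shows "qint k = p"
  unfolding qint_def
proof (rule the_equality)
  fix r assume "r * (qpow 1 - qpow (-1)) = qpow k - qpow (-k)"
  then have "r * (qpow 1 - qpow (-1)) = p * (qpow 1 - qpow (-1))" using assms by (simp only:)
  then show "r = p" using q_diff_nonzero by (simp only: mult_cancel_right) blast
qed (rule assms)

lemma qint_mult: "qint k * (qpow 1 - qpow (-1)) = qpow k - qpow (-k)"
proof -
  obtain p where p: "p * (qpow 1 - qpow (-1)) = qpow k - qpow (-k)" using qint_ex by blast
  show ?thesis using p unfolding qint_unique[OF p] .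
qed

lemma qint_nonzero: "k \<noteq> 0 \<Longrightarrow> qint k \<noteq> 0"
  using qint_mult[of k] by (auto simp: qpow_eq_iff)

lemma qfact_nonzero: "(\<Prod>i=1..t. qint (int i)) \<noteq> 0"
  by (auto simp: qint_nonzero)

lemma qint_split: "qint (a + b) = qpow a * qint b + qpow (- b) * qint a"
proof (rule qint_unique)
  have "(qpow a * qint b + qpow (- b) * qint a) * (qpow 1 - qpow (-1))
      = qpow a * (qint b * (qpow 1 - qpow (-1))) + qpow (- b) * (qint a * (qpow 1 - qpow (-1)))"
    by (simp add: algebra_simps)
  also have "\<dots> = qpow (a + b) - qpow (- (a + b))"
    unfolding qint_mult by (simp add: right_diff_distrib qpow_add add.commute)
  finally show "(qpow a * qint b + qpow (- b) * qint a) * (qpow 1 - qpow (-1))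
      = qpow (a + b) - qpow (- (a + b))" .
qed

lemma qbinom_ex:
  "\<exists>p. p * (\<Prod>i=1..t. qint (int i)) = (\<Prod>i=1..t. qint (k - int i + 1))"
proof (induction t arbitrary: k)
  case 0
  show ?case by simp
next
  case (Suc t)
  let ?d = "\<Prod>i=1..Suc t. qint (int i)"
  let ?n = "\<lambda>k. \<Prod>i=1..Suc t. qint (k - int i + 1)"
  let ?m = "\<lambda>k. \<Prod>i=1..t. qint (k - int i + 1)"
  have low: "\<exists>p. p * ?d = ?m k * qint (1 + int t)" for k
  proof -
    obtain p where "p * (\<Prod>i=1..t. qint (int i)) = ?m k" using Suc by blast
    then have "p * ?d = ?m k * qint (1 + int t)" by (simp add: mult.assoc[symmetric])
    then show ?thesis by blast
  qed
  have up: "?n (k + 1) = qint (k + 1) * ?m k" for k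
  proof -
    have "?n (k + 1) = qint (k + 1 - int 1 + 1) * (\<Prod>i=Suc 1..Suc t. qint (k + 1 - int i + 1))"
      by (rule prod.atLeast_Suc_atMost) simp
    also have "(\<Prod>i=Suc 1..Suc t. qint (k + 1 - int i + 1)) = ?m k"
      by (simp only: prod.shift_bounds_cl_Suc_ivl) simp
    finally show ?thesis by simp
  qed
  have down: "?n k = qint (k - int t) * ?m k" for k
    by (simp add: mult.commute)
  have rec: "?n (k + 1) = qpow (1 + int t) * ?n k + qpow (- (k - int t)) * (?m k * qint (1 + int t))"
    for k
  proof -
    have "qint (k + 1) = qpow (1 + int t) * qint (k - int t) + qpow (- (k - int t)) * qint (1 + int t)"
      using qint_split[of "1 + int t" "k - int t"] by (simp add: add.commute)
    then show ?thesis
      unfolding up down by (simp only: distrib_right distrib_left mult.assoc mult.left_commute mult.commute)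
  qed
  show ?case
  proof (induction k rule: int_induct[where k = 0])
    case base
    have "?n 0 = 0"
      by (rule prod_zero) (auto intro!: bexI[of _ 1] simp: qint_unique[of 0 0])
    then show ?case by (intro exI[of _ 0]) simp
  next
    case (step1 k)
    then obtain p r where "p * ?d = ?n k" "r * ?d = ?m k * qint (1 + int t)" using low by blast
    then have "(qpow (1 + int t) * p + qpow (- (k - int t)) * r) * ?d = ?n (k + 1)"
      unfolding rec by (simp only: distrib_right mult.assoc)
    then show ?case by blast
  next
    case (step2 k)
    then obtain p r where p: "p * ?d = ?n k" and r: "r * ?d = ?m (k - 1) * qint (1 + int t)"
      using low by blast
    have "?n k = qpow (1 + int t) * ?n (k - 1) + qpow (- (k - 1 - int t)) * (r * ?d)"
      using rec[of "k - 1"] unfolding r by (simp only: diff_add_cancel)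
    then have "p * ?d - qpow (- (k - 1 - int t)) * (r * ?d) = qpow (1 + int t) * ?n (k - 1)"
      unfolding p by simp
    then have "qpow (- (1 + int t)) * (p * ?d - qpow (- (k - 1 - int t)) * (r * ?d))
        = qpow (- (1 + int t)) * (qpow (1 + int t) * ?n (k - 1))"
      by (rule arg_cong)
    then have "(qpow (- (1 + int t)) * (p - qpow (- (k - 1 - int t)) * r)) * ?d = ?n (k - 1)"
      by (simp only: mult.assoc[symmetric] qpow_add qpow_0 mult_1_left left_diff_distrib
          right_diff_distrib left_minus)
    then show ?case by blast
  qed
qed

lemma qbinom_unique:
  assumes "p * (\<Prod>i=1..t. qint (int i)) = (\<Prod>i=1..t. qint (k - int i + 1))"
  shows "qbinom k t = p"
  unfolding qbinom_def
proof (rule the_equality)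
  fix r assume "r * (\<Prod>i=1..t. qint (int i)) = (\<Prod>i=1..t. qint (k - int i + 1))"
  then have "r * (\<Prod>i=1..t. qint (int i)) = p * (\<Prod>i=1..t. qint (int i))"
    using assms by (simp only:)
  then show "r = p" using qfact_nonzero[of t] by (simp only: mult_cancel_right) blast
qed (rule assms)

lemma qbinom_mult:
  "qbinom k t * (\<Prod>i=1..t. qint (int i)) = (\<Prod>i=1..t. qint (k - int i + 1))"
proof -
  obtain p where p: "p * (\<Prod>i=1..t. qint (int i)) = (\<Prod>i=1..t. qint (k - int i + 1))"
    using qbinom_ex by blast
  show ?thesis using p unfolding qbinom_unique[OF p] .
qed


section \<open>Webs\<close>

text \<open>Web terms. \<open>Comp g f\<close> is the diagram with \<open>g\<close> on top of \<open>f\<close>; \<open>Tens f g\<close> has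
  \<open>f\<close> to the left of \<open>g\<close>. Since the object \<open>0\<close> is the monoidal identity, every sequence of
  non-negative integers is equal, as an object, to the sequence with its zeros erased; the
  zero-free sequence is used as the representative.\<close>

datatype web = Id "nat list" | Merge nat nat | Split nat nat | Comp web web | Tens web web

definition erase :: "nat list \<Rightarrow> nat list"
  where "erase x = filter (\<lambda>a. a \<noteq> 0) x"

definition objects :: "nat list set"
  where "objects = {x. erase x = x}"

primrec src :: "web \<Rightarrow> nat list" where
  "src (Id x) = x"
| "src (Merge a b) = [a, b]"
| "src (Split a b) = [a + b]"
| "src (Comp g f) = src f"
| "src (Tens f g) = src f @ src g"

primrec tgt :: "web \<Rightarrow> nat list" where
  "tgt (Id x) = x"
| "tgt (Merge a b) = [a + b]"
| "tgt (Split a b) = [a, b]"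
| "tgt (Comp g f) = tgt g"
| "tgt (Tens f g) = tgt f @ tgt g"

primrec well_formed :: "web \<Rightarrow> bool" where
  "well_formed (Id x) \<longleftrightarrow> x \<in> objects"
| "well_formed (Merge a b) \<longleftrightarrow> a \<ge> 1 \<and> b \<ge> 1"
| "well_formed (Split a b) \<longleftrightarrow> a \<ge> 1 \<and> b \<ge> 1"
| "well_formed (Comp g f) \<longleftrightarrow> well_formed g \<and> well_formed f \<and> src g = tgt f"
| "well_formed (Tens f g) \<longleftrightarrow> well_formed f \<and> well_formed g"

definition webs :: "nat list \<Rightarrow> nat list \<Rightarrow> web set"
  where "webs x y = {w. well_formed w \<and> src w = x \<and> tgt w = y}"

primrec deg :: "web \<Rightarrow> nat" where
  "deg (Id x) = 0"
| "deg (Merge a b) = a * b"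
| "deg (Split a b) = a * b"
| "deg (Comp g f) = deg g + deg f"
| "deg (Tens f g) = deg f + deg g"

text \<open>Identities, merges and splits with edges labelled \<open>0\<close> erased.\<close>

definition idw :: "nat \<Rightarrow> web"
  where "idw a = Id (erase [a])"

definition merge :: "nat \<Rightarrow> nat \<Rightarrow> web"
  where "merge a b = (if a = 0 \<or> b = 0 then idw (a + b) else Merge a b)"

definition split :: "nat \<Rightarrow> nat \<Rightarrow> web"
  where "split a b = (if a = 0 \<or> b = 0 then idw (a + b) else Split a b)"

text \<open>The axioms of a strict monoidal category; both sides are well-formed and parallel.\<close>

inductive structural :: "web \<Rightarrow> web \<Rightarrow> bool" where
  comp_assoc: "well_formed (Comp (Comp h g) f) \<Longrightarrow>
    structural (Comp (Comp h g) f) (Comp h (Comp g f))"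
| comp_id_left: "well_formed f \<Longrightarrow> structural (Comp (Id (tgt f)) f) f"
| comp_id_right: "well_formed f \<Longrightarrow> structural (Comp f (Id (src f))) f"
| tens_assoc: "well_formed (Tens (Tens f g) h) \<Longrightarrow>
    structural (Tens (Tens f g) h) (Tens f (Tens g h))"
| tens_unit_left: "well_formed f \<Longrightarrow> structural (Tens (Id []) f) f"
| tens_unit_right: "well_formed f \<Longrightarrow> structural (Tens f (Id [])) f"
| tens_id: "well_formed (Tens (Id x) (Id y)) \<Longrightarrow>
    structural (Tens (Id x) (Id y)) (Id (x @ y))"
| interchange: "well_formed (Tens (Comp g f) (Comp g' f')) \<Longrightarrow>
    structural (Tens (Comp g f) (Comp g' f')) (Comp (Tens g g') (Tens f f'))"

inductive assoc_relation :: "web \<Rightarrow> web \<Rightarrow> bool" where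
  assoc: "a \<ge> 1 \<Longrightarrow> b \<ge> 1 \<Longrightarrow> c \<ge> 1 \<Longrightarrow> assoc_relation
    (Comp (Merge (a + b) c) (Tens (Merge a b) (Id [c])))
    (Comp (Merge a (b + c)) (Tens (Id [a]) (Merge b c)))"
| coassoc: "a \<ge> 1 \<Longrightarrow> b \<ge> 1 \<Longrightarrow> c \<ge> 1 \<Longrightarrow> assoc_relation
    (Comp (Tens (Split a b) (Id [c])) (Split (a + b) c))
    (Comp (Tens (Id [a]) (Split b c)) (Split a (b + c)))"


section \<open>Categorical structures\<close>

text \<open>A strict monoidal category. The type \<open>'h\<close> of hom-objects is \<open>'m set\<close> for an ordinary
  category and \<open>(laurent, 'm) module\<close> for a linear one (the library's \<open>module\<close> extends
  \<open>ring\<close>, so its multiplicative components are present but not used). Composition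
  \<open>comp C x y z g f\<close> is \<open>g \<circ> f\<close> for \<open>f : x \<rightarrow> y\<close>, \<open>g : y \<rightarrow> z\<close>, and
  \<open>tens C x y x' y' f f'\<close> is \<open>f \<otimes> f'\<close> for \<open>f : x \<rightarrow> y\<close>, \<open>f' : x' \<rightarrow> y'\<close>.\<close>

record ('o, 'm, 'h) moncat =
  Obj :: "'o set"
  unit_obj :: 'o
  tens_obj :: "'o \<Rightarrow> 'o \<Rightarrow> 'o"
  Hom :: "'o \<Rightarrow> 'o \<Rightarrow> 'h"
  ident :: "'o \<Rightarrow> 'm"
  comp :: "'o \<Rightarrow> 'o \<Rightarrow> 'o \<Rightarrow> 'm \<Rightarrow> 'm \<Rightarrow> 'm"
  tens :: "'o \<Rightarrow> 'o \<Rightarrow> 'o \<Rightarrow> 'o \<Rightarrow> 'm \<Rightarrow> 'm \<Rightarrow> 'm"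

type_synonym ('o, 'm) set_moncat = "('o, 'm, 'm set) moncat"
type_synonym ('o, 'm) lin_moncat = "('o, 'm, (laurent, 'm) module) moncat"

record ('o, 'm, 'h) graded_moncat = "('o, 'm, 'h) moncat" +
  grade :: "nat \<Rightarrow> 'o \<Rightarrow> 'o \<Rightarrow> 'm set"

type_synonym ('o, 'm) graded_lin_moncat = "('o, 'm, (laurent, 'm) module) graded_moncat"

text \<open>An isomorphism of graded linear strict monoidal categories: a functor, bijective on
  objects and on morphisms, respecting all of the structure.\<close>

definition graded_isomorphic ::
  "('o, 'm) graded_lin_moncat \<Rightarrow> ('p, 'n) graded_lin_moncat \<Rightarrow> bool"
  where "graded_isomorphic C D \<longleftrightarrow> (\<exists>\<Phi> \<phi>.
    bij_betw \<Phi> (Obj C) (Obj D) \<and>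
    \<Phi> (unit_obj C) = unit_obj D \<and>
    (\<forall>x\<in>Obj C. \<forall>y\<in>Obj C. \<Phi> (tens_obj C x y) = tens_obj D (\<Phi> x) (\<Phi> y)) \<and>
    (\<forall>x\<in>Obj C. \<forall>y\<in>Obj C.
      bij_betw (\<phi> x y) (carrier (Hom C x y)) (carrier (Hom D (\<Phi> x) (\<Phi> y))) \<and>
      (\<forall>f\<in>carrier (Hom C x y). \<forall>g\<in>carrier (Hom C x y).
        \<phi> x y (f \<oplus>\<^bsub>Hom C x y\<^esub> g) = \<phi> x y f \<oplus>\<^bsub>Hom D (\<Phi> x) (\<Phi> y)\<^esub> \<phi> x y g) \<and>
      (\<forall>c. \<forall>f\<in>carrier (Hom C x y).
        \<phi> x y (c \<odot>\<^bsub>Hom C x y\<^esub> f) = c \<odot>\<^bsub>Hom D (\<Phi> x) (\<Phi> y)\<^esub> \<phi> x y f) \<and>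
      (\<forall>k. \<phi> x y ` grade C k x y = grade D k (\<Phi> x) (\<Phi> y))) \<and>
    (\<forall>x\<in>Obj C. \<phi> x x (ident C x) = ident D (\<Phi> x)) \<and>
    (\<forall>x\<in>Obj C. \<forall>y\<in>Obj C. \<forall>z\<in>Obj C.
      \<forall>f\<in>carrier (Hom C x y). \<forall>g\<in>carrier (Hom C y z).
        \<phi> x z (comp C x y z g f) = comp D (\<Phi> x) (\<Phi> y) (\<Phi> z) (\<phi> y z g) (\<phi> x y f)) \<and>
    (\<forall>x\<in>Obj C. \<forall>y\<in>Obj C. \<forall>x'\<in>Obj C. \<forall>y'\<in>Obj C.
      \<forall>f\<in>carrier (Hom C x y). \<forall>f'\<in>carrier (Hom C x' y').
        \<phi> (tens_obj C x x') (tens_obj C y y') (tens C x y x' y' f f') =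
        tens D (\<Phi> x) (\<Phi> y) (\<Phi> x') (\<Phi> y') (\<phi> x y f) (\<phi> x' y' f')))"

subsection \<open>Linearization\<close>

definition free_module :: "'b set \<Rightarrow> (laurent, 'b \<Rightarrow>\<^sub>0 laurent) module"
  where "free_module S =
    \<lparr>carrier = {p. Poly_Mapping.keys p \<subseteq> S}, mult = undefined, one = undefined,
     zero = 0, add = (+), smult = (\<lambda>c. Poly_Mapping.map (\<lambda>d. c * d))\<rparr>"

definition bilinear_ext ::
  "('a \<Rightarrow> 'b \<Rightarrow> 'c) \<Rightarrow> ('a \<Rightarrow>\<^sub>0 laurent) \<Rightarrow> ('b \<Rightarrow>\<^sub>0 laurent) \<Rightarrow> ('c \<Rightarrow>\<^sub>0 laurent)"
  where "bilinear_ext h p r =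
    (\<Sum>a\<in>Poly_Mapping.keys p. \<Sum>b\<in>Poly_Mapping.keys r.
      Poly_Mapping.single (h a b) (Poly_Mapping.lookup p a * Poly_Mapping.lookup r b))"

definition linearization :: "('o, 'm) set_moncat \<Rightarrow> ('o, 'm \<Rightarrow>\<^sub>0 laurent) lin_moncat"
  where "linearization C =
    \<lparr>Obj = Obj C, unit_obj = unit_obj C, tens_obj = tens_obj C,
     Hom = (\<lambda>x y. free_module (Hom C x y)),
     ident = (\<lambda>x. Poly_Mapping.single (ident C x) 1),
     comp = (\<lambda>x y z. bilinear_ext (comp C x y z)),
     tens = (\<lambda>x y x' y'. bilinear_ext (tens C x y x' y'))\<rparr>"

subsection \<open>Quotients and the associated graded category\<close>

text \<open>The quotient of a module by a submodule \<open>H\<close>. The sum in \<open>smult\<close> is the coset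
  \<open>c x + H\<close>.\<close>

definition quotient_module :: "(laurent, 'm) module \<Rightarrow> 'm set \<Rightarrow> (laurent, 'm set) module"
  where "quotient_module M H =
    \<lparr>carrier = a_rcosets\<^bsub>M\<^esub> H, mult = undefined, one = undefined,
     zero = H, add = set_add M, smult = (\<lambda>c X. \<Union>v\<in>X. H +>\<^bsub>M\<^esub> (c \<odot>\<^bsub>M\<^esub> v))\<rparr>"

type_synonym ('o, 'm) filtration = "nat \<Rightarrow> 'o \<Rightarrow> 'o \<Rightarrow> 'm set"

text \<open>\<open>F\<close> in degree \<open>\<le> k - 1\<close>, with the convention that it is zero for \<open>k = 0\<close>.\<close>

definition filt_below ::
  "('o, 'm) lin_moncat \<Rightarrow> ('o, 'm) filtration \<Rightarrow> nat \<Rightarrow> 'o \<Rightarrow> 'o \<Rightarrow> 'm set"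
  where "filt_below C F k x y = (if k = 0 then {\<zero>\<^bsub>Hom C x y\<^esub>} else F (k - 1) x y)"

definition gr_piece ::
  "('o, 'm) lin_moncat \<Rightarrow> ('o, 'm) filtration \<Rightarrow> nat \<Rightarrow> 'o \<Rightarrow> 'o \<Rightarrow> (laurent, 'm set) module"
  where "gr_piece C F k x y =
    quotient_module ((Hom C x y)\<lparr>carrier := F k x y\<rparr>) (filt_below C F k x y)"

definition direct_sum :: "('i \<Rightarrow> (laurent, 'm) module) \<Rightarrow> (laurent, 'i \<Rightarrow> 'm) module"
  where "direct_sum M =
    \<lparr>carrier = {\<phi>. (\<forall>i. \<phi> i \<in> carrier (M i)) \<and> finite {i. \<phi> i \<noteq> \<zero>\<^bsub>M i\<^esub>}},
     mult = undefined, one = undefined,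
     zero = (\<lambda>i. \<zero>\<^bsub>M i\<^esub>),
     add = (\<lambda>\<phi> \<psi> i. \<phi> i \<oplus>\<^bsub>M i\<^esub> \<psi> i),
     smult = (\<lambda>c \<phi> i. c \<odot>\<^bsub>M i\<^esub> \<phi> i)\<rparr>"

text \<open>The degree-\<open>n\<close> component of a product is the sum over \<open>k + l = n\<close> of the products
  \<open>F\<^sub>k/F\<^sub>k\<^sub>-\<^sub>1 \<times> F\<^sub>l/F\<^sub>l\<^sub>-\<^sub>1 \<rightarrow> F\<^sub>n/F\<^sub>n\<^sub>-\<^sub>1\<close> induced on cosets.\<close>

definition assoc_graded ::
  "('o, 'm) lin_moncat \<Rightarrow> ('o, 'm) filtration \<Rightarrow> ('o, nat \<Rightarrow> 'm set) graded_lin_moncat"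
  where "assoc_graded C F =
    \<lparr>Obj = Obj C, unit_obj = unit_obj C, tens_obj = tens_obj C,
     Hom = (\<lambda>x y. direct_sum (\<lambda>k. gr_piece C F k x y)),
     ident = (\<lambda>x k. if k = 0 then filt_below C F 0 x x +>\<^bsub>Hom C x x\<^esub> ident C x
                   else \<zero>\<^bsub>gr_piece C F k x x\<^esub>),
     comp = (\<lambda>x y z \<psi> \<phi> n. \<Oplus>\<^bsub>gr_piece C F n x z\<^esub>k\<in>{..n}.
       \<Union>g\<in>\<psi> k. \<Union>f\<in>\<phi> (n - k). filt_below C F n x z +>\<^bsub>Hom C x z\<^esub> comp C x y z g f),
     tens = (\<lambda>x y x' y' \<phi> \<phi>' n.
       \<Oplus>\<^bsub>gr_piece C F n (tens_obj C x x') (tens_obj C y y')\<^esub>k\<in>{..n}.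
       \<Union>f\<in>\<phi> k. \<Union>f'\<in>\<phi>' (n - k).
         filt_below C F n (tens_obj C x x') (tens_obj C y y')
           +>\<^bsub>Hom C (tens_obj C x x') (tens_obj C y y')\<^esub> tens C x y x' y' f f'),
     grade = (\<lambda>n x y. {\<phi> \<in> carrier (direct_sum (\<lambda>k. gr_piece C F k x y)).
       \<forall>k. k \<noteq> n \<longrightarrow> \<phi> k = \<zero>\<^bsub>gr_piece C F k x y\<^esub>})\<rparr>"

text \<open>The filtration by web degree of a linear category whose morphisms from \<open>x\<close> to \<open>y\<close>
  are represented by webs through \<open>r x y\<close>.\<close>

definition web_filtration ::
  "(nat list, 'm) lin_moncat \<Rightarrow> (nat list \<Rightarrow> nat list \<Rightarrow> web \<Rightarrow> 'm) \<Rightarrow> (nat list, 'm) filtration"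
  where "web_filtration C r k x y =
    {(\<Oplus>\<^bsub>Hom C x y\<^esub>w\<in>A. c w \<odot>\<^bsub>Hom C x y\<^esub> r x y w) | A c.
      finite A \<and> A \<subseteq> {w \<in> webs x y. deg w \<le> k}}"


section \<open>The category \<open>SC_Webs\<close>\<close>

inductive sc_relation :: "web \<Rightarrow> web \<Rightarrow> bool" where
  bigon: "a \<ge> 1 \<Longrightarrow> b \<ge> 1 \<Longrightarrow> sc_relation (Comp (Merge a b) (Split a b)) (Id [a + b])"
| assoc: "assoc_relation u v \<Longrightarrow> sc_relation u v"
| square_less: "1 \<le> a \<Longrightarrow> a \<le> N - 1 \<Longrightarrow> 1 \<le> b \<Longrightarrow> b \<le> N - 1 \<Longrightarrow> a + b < N \<Longrightarrow> sc_relation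
    (Comp (Tens (Id [b]) (Merge a (N - a - b)))
      (Comp (Tens (Split b a) (Id [N - a - b]))
        (Comp (Tens (Merge a b) (Id [N - a - b]))
          (Tens (Id [a]) (Split b (N - a - b))))))
    (Comp (Split b (N - b)) (Merge a (N - a)))"
| square_greater: "1 \<le> a \<Longrightarrow> a \<le> N - 1 \<Longrightarrow> 1 \<le> b \<Longrightarrow> b \<le> N - 1 \<Longrightarrow> a + b > N \<Longrightarrow> sc_relation
    (Comp (Tens (Merge (a + b - N) (N - a)) (Id [N - b]))
      (Comp (Tens (Id [a + b - N]) (Split (N - a) (N - b)))
        (Comp (Tens (Id [a + b - N]) (Merge (N - b) (N - a)))
          (Tens (Split (a + b - N) (N - b)) (Id [N - a])))))
    (Comp (Split b (N - b)) (Merge a (N - a)))"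

inductive sc_eq :: "web \<Rightarrow> web \<Rightarrow> bool" where
  struct: "structural u v \<Longrightarrow> sc_eq u v"
| rel: "sc_relation u v \<Longrightarrow> sc_eq u v"
| refl: "well_formed u \<Longrightarrow> sc_eq u u"
| sym: "sc_eq u v \<Longrightarrow> sc_eq v u"
| trans: "sc_eq u v \<Longrightarrow> sc_eq v w \<Longrightarrow> sc_eq u w"
| comp: "sc_eq u u' \<Longrightarrow> sc_eq v v' \<Longrightarrow> src u = tgt v \<Longrightarrow> sc_eq (Comp u v) (Comp u' v')"
| tens: "sc_eq u u' \<Longrightarrow> sc_eq v v' \<Longrightarrow> sc_eq (Tens u v) (Tens u' v')"

lemma erase_append [simp]: "erase (x @ y) = erase x @ erase y"
  by (simp add: erase_def)

lemma objects_iff: "x \<in> objects \<longleftrightarrow> 0 \<notin> set x"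
  by (auto simp: objects_def erase_def filter_id_conv intro!: gr0I)

lemma src_tgt_objects: "well_formed w \<Longrightarrow> src w \<in> objects \<and> tgt w \<in> objects"
  by (induction w) (auto simp: objects_iff)

lemma structural_parallel:
  "structural u v \<Longrightarrow> well_formed u \<and> well_formed v \<and> src u = src v \<and> tgt u = tgt v"
  by (induction rule: structural.induct) (use src_tgt_objects in \<open>auto simp: objects_iff\<close>)

lemma assoc_relation_parallel:
  "assoc_relation u v \<Longrightarrow> well_formed u \<and> well_formed v \<and> src u = src v \<and> tgt u = tgt v"
  by (induction rule: assoc_relation.induct) (auto simp: objects_iff)

lemma sc_relation_parallel:
  "sc_relation u v \<Longrightarrow> well_formed u \<and> well_formed v \<and> src u = src v \<and> tgt u = tgt v"
proof (induction rule: sc_relation.induct)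
  case (assoc u v)
  then show ?case by (rule assoc_relation_parallel)
qed (auto simp: objects_iff)

lemma sc_eq_parallel:
  "sc_eq u v \<Longrightarrow> well_formed u \<and> well_formed v \<and> src u = src v \<and> tgt u = tgt v"
  by (induction rule: sc_eq.induct) (auto dest: structural_parallel sc_relation_parallel)

definition sc_class :: "web \<Rightarrow> web set"
  where "sc_class w = {v. sc_eq w v}"

definition SC_Webs :: "(nat list, web set) set_moncat"
  where "SC_Webs =
    \<lparr>Obj = objects, unit_obj = [], tens_obj = (@),
     Hom = (\<lambda>x y. sc_class ` webs x y),
     ident = (\<lambda>x. sc_class (Id x)),
     comp = (\<lambda>x y z X Y. \<Union>g\<in>X. \<Union>f\<in>Y. sc_class (Comp g f)),
     tens = (\<lambda>x y x' y' X X'. \<Union>f\<in>X. \<Union>f'\<in>X'. sc_class (Tens f f'))\<rparr>"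

definition Lin_SC_Webs :: "(nat list, web set \<Rightarrow>\<^sub>0 laurent) lin_moncat"
  where "Lin_SC_Webs = linearization SC_Webs"

definition Lin_SC_filtration :: "(nat list, web set \<Rightarrow>\<^sub>0 laurent) filtration"
  where "Lin_SC_filtration =
    web_filtration Lin_SC_Webs (\<lambda>x y w. Poly_Mapping.single (sc_class w) 1)"


section \<open>The category \<open>Webs\<^sup>\<infinity>\<close>\<close>

type_synonym lin_web = "web \<Rightarrow>\<^sub>0 laurent"

definition of_web :: "web \<Rightarrow> lin_web"
  where "of_web w = Poly_Mapping.single w 1"

definition scale :: "laurent \<Rightarrow> lin_web \<Rightarrow> lin_web"
  where "scale c = Poly_Mapping.map (\<lambda>d. c * d)"

abbreviation lin_comp :: "lin_web \<Rightarrow> lin_web \<Rightarrow> lin_web"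
  where "lin_comp \<equiv> bilinear_ext Comp"

abbreviation lin_tens :: "lin_web \<Rightarrow> lin_web \<Rightarrow> lin_web"
  where "lin_tens \<equiv> bilinear_ext Tens"

text \<open>\<open>E f a x\<close> is \<open>E\<^sup>(\<^sup>f\<^sup>)\<close> on two adjacent strands \<open>(a, x)\<close>, and similarly for \<open>F\<close>. The
  guards express that a ladder with a negative label is zero.\<close>

definition E :: "nat \<Rightarrow> nat \<Rightarrow> nat \<Rightarrow> lin_web"
  where "E f a x = (if f \<le> x
    then of_web (Comp (Tens (merge a f) (idw (x - f))) (Tens (idw a) (split f (x - f))))
    else 0)"

definition F :: "nat \<Rightarrow> nat \<Rightarrow> nat \<Rightarrow> lin_web"
  where "F g a x = (if g \<le> a
    then of_web (Comp (Tens (idw (a - g)) (merge g x)) (Tens (split (a - g) g) (idw x)))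
    else 0)"

text \<open>\<open>inf_relation x y p\<close>: the relation \<open>p = 0\<close> is imposed on morphisms \<open>x \<rightarrow> y\<close>. In the
  square flops the terms with \<open>t > min f g\<close> contain a negative thickness and vanish; whenever the
  final labels \<open>a + f - g\<close>, \<open>x + g - f\<close> are not both non-negative, all terms vanish. A truncated
  subtraction occurs in an argument of \<open>E\<close> or \<open>F\<close> only if the other factor is zero.\<close>

inductive inf_relation :: "nat list \<Rightarrow> nat list \<Rightarrow> lin_web \<Rightarrow> bool" where
  struct: "structural u v \<Longrightarrow> inf_relation (src u) (tgt u) (of_web u - of_web v)"
| assoc: "assoc_relation u v \<Longrightarrow> inf_relation (src u) (tgt u) (of_web u - of_web v)"
| bigon: "a \<ge> 1 \<Longrightarrow> b \<ge> 1 \<Longrightarrow> inf_relation [a + b] [a + b]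
    (of_web (Comp (Merge a b) (Split a b))
      - scale (qbinom (int (a + b)) a) (of_web (Id [a + b])))"
| flop_FE: "g \<le> a + f \<Longrightarrow> f \<le> x + g \<Longrightarrow>
    inf_relation (erase [a, x]) (erase [a + f - g, x + g - f])
    (lin_comp (F g (a + f) (x - f)) (E f a x)
      - (\<Sum>t\<le>min f g. scale (qbinom (int x - int a + int g - int f) t)
          (lin_comp (E (f - t) (a - (g - t)) (x + (g - t))) (F (g - t) a x))))"
| flop_EF: "g \<le> a + f \<Longrightarrow> f \<le> x + g \<Longrightarrow>
    inf_relation (erase [a, x]) (erase [a + f - g, x + g - f])
    (lin_comp (E f (a - g) (x + g)) (F g a x)
      - (\<Sum>t\<le>min f g. scale (qbinom (int a - int x + int f - int g) t)
          (lin_comp (F (g - t) (a + (f - t)) (x - (f - t))) (E (f - t) a x))))"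

text \<open>The linear tensor ideal generated by the relations.\<close>

inductive inf_ideal :: "nat list \<Rightarrow> nat list \<Rightarrow> lin_web \<Rightarrow> bool" where
  rel: "inf_relation x y p \<Longrightarrow> inf_ideal x y p"
| zero: "inf_ideal x y 0"
| add: "inf_ideal x y p \<Longrightarrow> inf_ideal x y r \<Longrightarrow> inf_ideal x y (p + r)"
| scale: "inf_ideal x y p \<Longrightarrow> inf_ideal x y (scale c p)"
| comp_left: "inf_ideal x y p \<Longrightarrow> w \<in> webs y z \<Longrightarrow> inf_ideal x z (lin_comp (of_web w) p)"
| comp_right: "inf_ideal y z p \<Longrightarrow> w \<in> webs x y \<Longrightarrow> inf_ideal x z (lin_comp p (of_web w))"
| tens_left: "inf_ideal x y p \<Longrightarrow> w \<in> webs x' y' \<Longrightarrow>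
    inf_ideal (x' @ x) (y' @ y) (lin_tens (of_web w) p)"
| tens_right: "inf_ideal x y p \<Longrightarrow> w \<in> webs x' y' \<Longrightarrow>
    inf_ideal (x @ x') (y @ y') (lin_tens p (of_web w))"

definition inf_class :: "nat list \<Rightarrow> nat list \<Rightarrow> lin_web \<Rightarrow> lin_web set"
  where "inf_class x y p = Collect (inf_ideal x y) +>\<^bsub>free_module (webs x y)\<^esub> p"

definition Webs_inf :: "(nat list, lin_web set) lin_moncat"
  where "Webs_inf =
    \<lparr>Obj = objects, unit_obj = [], tens_obj = (@),
     Hom = (\<lambda>x y. quotient_module (free_module (webs x y)) (Collect (inf_ideal x y))),
     ident = (\<lambda>x. inf_class x x (of_web (Id x))),
     comp = (\<lambda>x y z X Y. \<Union>g\<in>X. \<Union>f\<in>Y. inf_class x z (lin_comp g f)),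
     tens = (\<lambda>x y x' y' X X'. \<Union>f\<in>X. \<Union>f'\<in>X'. inf_class (x @ x') (y @ y') (lin_tens f f'))\<rparr>"

definition Webs_inf_filtration :: "(nat list, lin_web set) filtration"
  where "Webs_inf_filtration = web_filtration Webs_inf (\<lambda>x y w. inf_class x y (of_web w))"

end

theory Submission
  imports Defs "HOL-Library.Multiset" "HOL-Library.Nat_Bijection"
begin

text \<open>Both categories are quotients of the free linear category on webs. In either of them the graded
  piece of degree \<open>k\<close> is the free module on the webs of degree \<open>k\<close>,
  modulo those combinations that are equal in the category to a combination of webs of smaller
  degree. The theorem therefore says that the two categories have the same relations between
  leading terms; the isomorphism is then the identity on webs
  (\<open>graded_isomorphic_presentations\<close>).

Every leading relation of \<open>SC_Webs\<close> holds in \<open>Webs_inf\<close>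
  (\<open>sc_kernel_low\<close>). All relations of \<open>SC_Webs\<close> except the bigon
  preserve the degree, and they hold in \<open>Webs_inf\<close> up to lower terms, because the
  square relations are the leading parts of square flops (\<open>heq_gr_eq\<close>); a web that
  contains a bigon is of lower order in both categories. It remains to see that this accounts
  for all of \<open>SC_Webs\<close>: a web whose degree is not minimal in its class can be
  transformed, without changing the degree, until it contains a bigon, and two webs of minimal
  degree in the same class differ by relations that preserve the degree. This is an analogue of
  Matsumoto's theorem. Follow each unit of thickness of a source strand through the web. Two
  units have one of three relative positions: left of each other in one order, on the same
  strand, or in the other order. A merge or split of type \<open>a, b\<close> changes the
  relative position of \<open>a * b\<close> pairs by one step, so the degree of a web is at
  least the total distance, over all pairs, between the initial and the final relative
  positions. Webs for which equality holds are called reduced. The final positions form a matrix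
  of non-negative integers, and a reduced web is determined by this matrix up to relations that
  preserve the degree (\<open>reduced_unique\<close>); a web that is not reduced is degenerate
  (\<open>path_degenerate_or_reduced\<close>). The set of all matrices that a web can lead to is
  an invariant of its class in \<open>SC_Webs\<close> (\<open>sc_eq_reach\<close>).

Every leading relation of \<open>Webs_inf\<close> holds in \<open>SC_Webs\<close>
  (\<open>inf_kernel_low\<close>), because \<open>Webs_inf\<close> has a representation in which
  the reduced webs of a given degree have linearly independent leading parts. A basis vector is
  a list of disjoint finite sets of integers; merging forms the union, and splitting is a sum
  over subsets weighted by powers of \<open>q\<close>. The square flops amount to the single
  identity \<open>flop_identity\<close> for quantum binomials. When a relation whose webs have
  degree at most \<open>k\<close> is tested on the final positions at distance \<open>k\<close>,
  only reduced webs with exactly these positions contribute, all with the same non-zero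
  coefficient (\<open>leading_coefficient_zero\<close>).\<close>

section \<open>Relations that preserve the degree\<close>

text \<open>The bigon is the only relation of \<open>SC_Webs\<close> whose two sides differ in
  degree, so this is the congruence generated by the other relations.\<close>

inductive heq :: "web \<Rightarrow> web \<Rightarrow> bool" where
  struct: "structural u v \<Longrightarrow> heq u v"
| rel: "sc_relation u v \<Longrightarrow> deg u = deg v \<Longrightarrow> heq u v"
| refl: "well_formed u \<Longrightarrow> heq u u"
| sym: "heq u v \<Longrightarrow> heq v u"
| trans: "heq u v \<Longrightarrow> heq v w \<Longrightarrow> heq u w"
| comp: "heq u u' \<Longrightarrow> heq v v' \<Longrightarrow> src u = tgt v \<Longrightarrow> heq (Comp u v) (Comp u' v')"
| tens: "heq u u' \<Longrightarrow> heq v v' \<Longrightarrow> heq (Tens u v) (Tens u' v')"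

lemma heq_sc_eq: "heq u v \<Longrightarrow> sc_eq u v"
  by (induction rule: heq.induct) (auto intro: sc_eq.intros)

lemma structural_deg: "structural u v \<Longrightarrow> deg u = deg v"
  by (induction rule: structural.induct) auto

lemma heq_deg: "heq u v \<Longrightarrow> deg u = deg v"
  by (induction rule: heq.induct) (auto dest: structural_deg)

lemma heq_parallel:
  "heq u v \<Longrightarrow> well_formed u \<and> well_formed v \<and> src u = src v \<and> tgt u = tgt v"
  using heq_sc_eq sc_eq_parallel by blast

lemma assoc_relation_deg: "assoc_relation u v \<Longrightarrow> deg u = deg v"
  by (induction rule: assoc_relation.induct) (auto simp: algebra_simps)

lemma heq_assoc: "assoc_relation u v \<Longrightarrow> heq u v"
  by (intro heq.rel sc_relation.assoc assoc_relation_deg)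

lemmas heq_trans [trans] = heq.trans

text \<open>A web that contains a bigon, possibly after relations that preserve the degree. Such
  webs vanish in the associated graded categories.\<close>

inductive degenerate :: "web \<Rightarrow> bool" where
  bigon: "a \<ge> 1 \<Longrightarrow> b \<ge> 1 \<Longrightarrow> degenerate (Comp (Merge a b) (Split a b))"
| heq: "heq u v \<Longrightarrow> degenerate v \<Longrightarrow> degenerate u"
| comp_left: "degenerate u \<Longrightarrow> well_formed g \<Longrightarrow> src g = tgt u \<Longrightarrow> degenerate (Comp g u)"
| comp_right: "degenerate u \<Longrightarrow> well_formed g \<Longrightarrow> src u = tgt g \<Longrightarrow> degenerate (Comp u g)"
| tens_left: "degenerate u \<Longrightarrow> well_formed g \<Longrightarrow> degenerate (Tens g u)"
| tens_right: "degenerate u \<Longrightarrow> well_formed g \<Longrightarrow> degenerate (Tens u g)"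

lemma degenerate_sc_eq_lower: "degenerate u \<Longrightarrow> \<exists>v. sc_eq u v \<and> deg v < deg u"
proof (induction rule: degenerate.induct)
  case (bigon a b)
  then show ?case
    by (intro exI[of _ "Id [a + b]"]) (auto intro!: sc_eq.rel sc_relation.bigon)
next
  case (heq u v)
  then show ?case using heq_deg heq_sc_eq sc_eq.trans by metis
next
  case (comp_left u g)
  then obtain v where "sc_eq u v" "deg v < deg u" by blast
  with comp_left show ?case
    by (intro exI[of _ "Comp g v"]) (auto intro!: sc_eq.comp sc_eq.refl)
next
  case (comp_right u g)
  then obtain v where "sc_eq u v" "deg v < deg u" by blast
  with comp_right show ?case
    by (intro exI[of _ "Comp v g"]) (auto intro!: sc_eq.comp sc_eq.refl)
next
  case (tens_left u g)
  then obtain v where "sc_eq u v" "deg v < deg u" by blast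
  with tens_left show ?case
    by (intro exI[of _ "Tens g v"]) (auto intro!: sc_eq.tens sc_eq.refl)
next
  case (tens_right u g)
  then obtain v where "sc_eq u v" "deg v < deg u" by blast
  with tens_right show ?case
    by (intro exI[of _ "Tens v g"]) (auto intro!: sc_eq.tens sc_eq.refl)
qed

section \<open>Whiskering\<close>

definition whisker :: "nat list \<Rightarrow> web \<Rightarrow> nat list \<Rightarrow> web"
  where "whisker p g r = Tens (Id p) (Tens g (Id r))"

lemma whisker_simps [simp]:
  "well_formed (whisker p g r) \<longleftrightarrow> p \<in> objects \<and> well_formed g \<and> r \<in> objects"
  "src (whisker p g r) = p @ src g @ r" "tgt (whisker p g r) = p @ tgt g @ r" "deg (whisker p g r) = deg g"
  by (auto simp: whisker_def)

lemma objects_append [simp]: "x @ y \<in> objects \<longleftrightarrow> x \<in> objects \<and> y \<in> objects"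
  by (auto simp: objects_iff)

lemma objects_Nil [simp]: "[] \<in> objects" by (simp add: objects_iff)

lemma objects_Cons [simp]: "a # x \<in> objects \<longleftrightarrow> a \<noteq> 0 \<and> x \<in> objects"
  by (auto simp: objects_iff)

lemma src_tgt_in_objects [simp]:
  "well_formed w \<Longrightarrow> src w \<in> objects" "well_formed w \<Longrightarrow> tgt w \<in> objects"
  using src_tgt_objects by auto

lemma heq_wf_src_tgt:
  assumes "heq u v"
  shows "well_formed u" "well_formed v" "src u = src v" "tgt u = tgt v"
  using heq_parallel[OF assms] by auto

lemma heq_comp_left: "heq u u' \<Longrightarrow> well_formed v \<Longrightarrow> src u = tgt v \<Longrightarrow> heq (Comp u v) (Comp u' v)"
  by (intro heq.comp heq.refl)

lemma heq_comp_right: "heq v v' \<Longrightarrow> well_formed u \<Longrightarrow> src u = tgt v \<Longrightarrow> heq (Comp u v) (Comp u v')"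
  by (intro heq.comp heq.refl)

lemma heq_comp_assoc:
  "well_formed h \<Longrightarrow> well_formed g \<Longrightarrow> well_formed f \<Longrightarrow> src h = tgt g \<Longrightarrow> src g = tgt f \<Longrightarrow>
    heq (Comp (Comp h g) f) (Comp h (Comp g f))"
  by (intro heq.struct structural.comp_assoc) simp

lemma heq_whisker: "heq g g' \<Longrightarrow> p \<in> objects \<Longrightarrow> r \<in> objects \<Longrightarrow> heq (whisker p g r) (whisker p g' r)"
  unfolding whisker_def by (intro heq.tens heq.refl) auto

lemma heq_tens_interchange:
  "well_formed g \<Longrightarrow> well_formed f \<Longrightarrow> well_formed g' \<Longrightarrow> well_formed f' \<Longrightarrow>
    src g = tgt f \<Longrightarrow> src g' = tgt f' \<Longrightarrow>
    heq (Comp (Tens g g') (Tens f f')) (Tens (Comp g f) (Comp g' f'))"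
  by (intro heq.sym[OF heq.struct] structural.interchange) simp

lemma heq_id_left: "well_formed f \<Longrightarrow> x = tgt f \<Longrightarrow> heq (Comp (Id x) f) f"
  by (auto intro: heq.struct structural.comp_id_left)

lemma heq_id_right: "well_formed f \<Longrightarrow> x = src f \<Longrightarrow> heq (Comp f (Id x)) f"
  by (auto intro: heq.struct structural.comp_id_right)

lemma heq_tens_right_first:
  assumes "well_formed g" "well_formed k" "y = tgt k" "x = src g"
  shows "heq (Comp (Tens g (Id y)) (Tens (Id x) k)) (Tens g k)"
proof -
  have "heq (Comp (Tens g (Id y)) (Tens (Id x) k)) (Tens (Comp g (Id x)) (Comp (Id y) k))"
    using assms by (intro heq_tens_interchange) auto
  also have "heq \<dots> (Tens g k)"
    using assms by (intro heq.tens heq_id_left heq_id_right) auto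
  finally show ?thesis .
qed

lemma heq_tens_left_first:
  assumes "well_formed g" "well_formed k" "y = tgt g" "x = src k"
  shows "heq (Comp (Tens (Id y) k) (Tens g (Id x))) (Tens g k)"
proof -
  have "heq (Comp (Tens (Id y) k) (Tens g (Id x))) (Tens (Comp (Id y) g) (Comp k (Id x)))"
    using assms by (intro heq_tens_interchange) auto
  also have "heq \<dots> (Tens g k)"
    using assms by (intro heq.tens heq_id_left heq_id_right) auto
  finally show ?thesis .
qed

lemma heq_whisker_comp:
  assumes "well_formed g" "well_formed f" "src g = tgt f" "p \<in> objects" "r \<in> objects"
  shows "heq (whisker p (Comp g f) r) (Comp (whisker p g r) (whisker p f r))"
proof -
  have "heq (Comp (whisker p g r) (whisker p f r)) (Tens (Comp (Id p) (Id p)) (Comp (Tens g (Id r)) (Tens f (Id r))))"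
    unfolding whisker_def using assms by (intro heq_tens_interchange) auto
  also have "heq \<dots> (Tens (Id p) (Tens (Comp g f) (Comp (Id r) (Id r))))"
    using assms by (intro heq.tens heq_id_left heq_tens_interchange) auto
  also have "heq \<dots> (whisker p (Comp g f) r)"
    unfolding whisker_def using assms by (intro heq.tens heq_id_left heq.refl) auto
  finally show ?thesis by (rule heq.sym)
qed

lemma heq_whisker_comp_comp:
  assumes "well_formed g" "well_formed f" "well_formed u" "src g = tgt f" "tgt u = p @ src f @ r"
  shows "heq (Comp (whisker p g r) (Comp (whisker p f r) u)) (Comp (whisker p (Comp g f) r) u)"
proof -
  have "p @ src f @ r \<in> objects" using src_tgt_in_objects(2)[OF assms(3)] unfolding assms(5) .
  then have o: "p \<in> objects" "r \<in> objects" by auto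
  have "heq (Comp (whisker p g r) (Comp (whisker p f r) u)) (Comp (Comp (whisker p g r) (whisker p f r)) u)"
    using assms o by (intro heq.sym[OF heq_comp_assoc]) auto
  also have "heq \<dots> (Comp (whisker p (Comp g f) r) u)"
    using assms o by (intro heq_comp_left heq.sym[OF heq_whisker_comp]) auto
  finally show ?thesis .
qed

lemma heq_tens_assoc:
  "well_formed f \<Longrightarrow> well_formed g \<Longrightarrow> well_formed h \<Longrightarrow>
    heq (Tens (Tens f g) h) (Tens f (Tens g h))"
  by (intro heq.struct structural.tens_assoc) simp

lemma heq_tens_id: "x \<in> objects \<Longrightarrow> y \<in> objects \<Longrightarrow> heq (Tens (Id x) (Id y)) (Id (x @ y))"
  by (intro heq.struct structural.tens_id) simp

lemma heq_whisker_whisker: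
  assumes "well_formed g" "p \<in> objects" "r \<in> objects" "p' \<in> objects" "r' \<in> objects"
  shows "heq (whisker p (whisker p' g r') r) (whisker (p @ p') g (r' @ r))"
proof -
  have "heq (whisker p (whisker p' g r') r) (Tens (Id p) (Tens (Id p') (Tens (Tens g (Id r')) (Id r))))"
    unfolding whisker_def using assms by (intro heq.tens[OF heq.refl] heq_tens_assoc) auto
  also have "heq \<dots> (Tens (Tens (Id p) (Id p')) (Tens (Tens g (Id r')) (Id r)))"
    using assms by (intro heq.sym[OF heq_tens_assoc]) auto
  also have "heq \<dots> (Tens (Id (p @ p')) (Tens g (Tens (Id r') (Id r))))"
    using assms by (intro heq.tens heq_tens_id heq_tens_assoc) auto
  also have "heq \<dots> (whisker (p @ p') g (r' @ r))"
    unfolding whisker_def using assms by (intro heq.tens heq.refl heq_tens_id) auto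
  finally show ?thesis .
qed

lemma heq_whisker_Id:
  assumes "p \<in> objects" "r \<in> objects" "y \<in> objects"
  shows "heq (whisker p (Id y) r) (Id (p @ y @ r))"
proof -
  have "heq (whisker p (Id y) r) (Tens (Id p) (Id (y @ r)))"
    unfolding whisker_def using assms by (intro heq.tens heq_tens_id heq.refl) auto
  also have "heq \<dots> (Id (p @ y @ r))"
    using assms by (intro heq_tens_id) auto
  finally show ?thesis .
qed

lemma heq_whisker_Nil: "well_formed g \<Longrightarrow> heq (whisker [] g []) g"
  unfolding whisker_def
  by (rule heq.trans[OF heq.struct[OF structural.tens_unit_left] heq.struct[OF structural.tens_unit_right]])
    auto

lemma heq_whisker_tens_Id_right:
  assumes "well_formed g" "p \<in> objects" "r \<in> objects" "z \<in> objects"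
  shows "heq (whisker p (Tens g (Id z)) r) (whisker p g (z @ r))"
proof -
  have "heq (whisker p (Tens g (Id z)) r) (Tens (Id p) (Tens g (Tens (Id z) (Id r))))"
    unfolding whisker_def using assms by (intro heq.tens heq_tens_assoc heq.refl) auto
  also have "heq \<dots> (whisker p g (z @ r))"
    unfolding whisker_def using assms by (intro heq.tens heq_tens_id heq.refl) auto
  finally show ?thesis .
qed

lemma heq_whisker_tens_Id_left:
  assumes "well_formed g" "p \<in> objects" "r \<in> objects" "z \<in> objects"
  shows "heq (whisker p (Tens (Id z) g) r) (whisker (p @ z) g r)"
proof -
  have "heq (whisker p (Tens (Id z) g) r) (Tens (Id p) (Tens (Id z) (Tens g (Id r))))"
    unfolding whisker_def using assms by (intro heq.tens heq_tens_assoc heq.refl) auto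
  also have "heq \<dots> (Tens (Tens (Id p) (Id z)) (Tens g (Id r)))"
    using assms by (intro heq.sym[OF heq_tens_assoc]) auto
  also have "heq \<dots> (whisker (p @ z) g r)"
    unfolding whisker_def using assms by (intro heq.tens heq_tens_id heq.refl) auto
  finally show ?thesis .
qed

lemma heq_whisker_tens_right_first:
  assumes "well_formed g" "well_formed h" "p \<in> objects" "r \<in> objects"
  shows "heq (whisker p (Tens g h) r) (Comp (whisker p g (tgt h @ r)) (whisker (p @ src g) h r))"
proof -
  have "heq (whisker p (Tens g h) r) (whisker p (Comp (Tens g (Id (tgt h))) (Tens (Id (src g)) h)) r)"
    using assms by (intro heq_whisker heq.sym[OF heq_tens_right_first]) auto
  also have "heq \<dots> (Comp (whisker p (Tens g (Id (tgt h))) r) (whisker p (Tens (Id (src g)) h) r))"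
    using assms by (intro heq_whisker_comp) auto
  also have "heq \<dots> (Comp (whisker p g (tgt h @ r)) (whisker (p @ src g) h r))"
    using assms by (intro heq.comp heq_whisker_tens_Id_right heq_whisker_tens_Id_left) auto
  finally show ?thesis .
qed

lemma heq_whisker_tens_left_first:
  assumes "well_formed g" "well_formed h" "p \<in> objects" "r \<in> objects"
  shows "heq (whisker p (Tens g h) r) (Comp (whisker (p @ tgt g) h r) (whisker p g (src h @ r)))"
proof -
  have "heq (whisker p (Tens g h) r) (whisker p (Comp (Tens (Id (tgt g)) h) (Tens g (Id (src h)))) r)"
    using assms by (intro heq_whisker heq.sym[OF heq_tens_left_first]) auto
  also have "heq \<dots> (Comp (whisker p (Tens (Id (tgt g)) h) r) (whisker p (Tens g (Id (src h))) r))"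
    using assms by (intro heq_whisker_comp) auto
  also have "heq \<dots> (Comp (whisker (p @ tgt g) h r) (whisker p g (src h @ r)))"
    using assms by (intro heq.comp heq_whisker_tens_Id_right heq_whisker_tens_Id_left) auto
  finally show ?thesis .
qed

text \<open>Both sides are the tensor product of \<open>g\<close> and \<open>h\<close>, padded
  with identities.\<close>

lemma heq_whisker_commute:
  assumes "well_formed g" "well_formed h" "p \<in> objects" "m \<in> objects" "r \<in> objects"
  shows "heq (Comp (whisker p g (m @ tgt h @ r)) (whisker (p @ src g @ m) h r))
             (Comp (whisker (p @ tgt g @ m) h r) (whisker p g (m @ src h @ r)))"
proof -
  let ?k = "whisker m h []"
  have k: "heq (whisker q ?k r) (whisker (q @ m) h r)" if "q \<in> objects" for q
    using heq_whisker_whisker[of h q r m "[]"] assms that by simp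
  have "heq (Comp (whisker p g (m @ tgt h @ r)) (whisker (p @ src g @ m) h r))
     (Comp (whisker p g (tgt ?k @ r)) (whisker (p @ src g) ?k r))"
    using assms k[of "p @ src g"] by (simp add: heq_comp_right heq.sym)
  also have "heq \<dots> (whisker p (Tens g ?k) r)"
    using assms by (intro heq.sym[OF heq_whisker_tens_right_first]) auto
  also have "heq \<dots> (Comp (whisker (p @ tgt g) ?k r) (whisker p g (src ?k @ r)))"
    using assms by (intro heq_whisker_tens_left_first) auto
  also have "heq \<dots> (Comp (whisker (p @ tgt g @ m) h r) (whisker p g (m @ src h @ r)))"
    using assms k[of "p @ tgt g"] by (simp add: heq.comp heq.refl)
  finally show ?thesis .
qed

section \<open>Layers\<close>

inductive generator :: "web \<Rightarrow> bool" where
  "a \<ge> 1 \<Longrightarrow> b \<ge> 1 \<Longrightarrow> generator (Merge a b)"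
| "a \<ge> 1 \<Longrightarrow> b \<ge> 1 \<Longrightarrow> generator (Split a b)"

inductive path :: "nat list \<Rightarrow> web \<Rightarrow> bool" for x where
  Id: "path x (Id x)"
| layer: "path x u \<Longrightarrow> generator g \<Longrightarrow> tgt u = p @ src g @ r \<Longrightarrow> path x (Comp (whisker p g r) u)"

lemma generator_well_formed: "generator g \<Longrightarrow> well_formed g"
  by (auto elim: generator.cases)

lemma path_well_formed: "path x u \<Longrightarrow> x \<in> objects \<Longrightarrow> well_formed u \<and> src u = x"
proof (induction rule: path.induct)
  case (layer u g p r)
  then have wf: "well_formed u" "src u = x" by auto
  then have "tgt u \<in> objects" by simp
  then have "p @ src g @ r \<in> objects" unfolding layer.hyps(3) .
  then have "p \<in> objects" "src g \<in> objects" "r \<in> objects" by simp_all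
  with wf layer.hyps show ?case by (simp add: generator_well_formed)
qed auto

text \<open>The position at which \<open>w\<close> is attached is arbitrary; this is what makes
  the induction go through for tensor products, whose factors are attached one after the
  other.\<close>

lemma path_extend:
  assumes "well_formed w" "path x u" "x \<in> objects" "tgt u = p @ src w @ r"
  shows "\<exists>v. path x v \<and> heq (Comp (whisker p w r) u) v"
  using assms
proof (induction w arbitrary: u p r)
  case (Id y)
  have wf: "well_formed u" using Id path_well_formed by blast
  then have o: "tgt u \<in> objects" by simp
  have "heq (Comp (whisker p (Id y) r) u) (Comp (Id (p @ y @ r)) u)"
    using Id wf o by (intro heq_comp_left heq_whisker_Id) auto
  also have "heq \<dots> u" using Id wf by (intro heq_id_left) auto
  finally show ?case using Id by blast
next
  case (Merge a b)
  then have g: "generator (Merge a b)" by (auto intro: generator.intros)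
  from path.layer[OF Merge(2) g, of p r] Merge(4)
  have "path x (Comp (whisker p (Merge a b) r) u)" by simp
  then show ?case using heq.refl path_well_formed Merge(3) by blast
next
  case (Split a b)
  then have g: "generator (Split a b)" by (auto intro: generator.intros)
  from path.layer[OF Split(2) g, of p r] Split(4)
  have "path x (Comp (whisker p (Split a b) r) u)" by simp
  then show ?case using heq.refl path_well_formed Split(3) by blast
next
  case (Comp g f)
  have wf: "well_formed u" using Comp.prems path_well_formed by blast
  then have o: "tgt u \<in> objects" by simp
  from Comp.prems Comp.IH(2)[of u p r] obtain v where v: "path x v" "heq (Comp (whisker p f r) u) v" by auto
  have "tgt v = p @ tgt f @ r" using heq_wf_src_tgt(4)[OF v(2)] by simp
  with Comp.prems Comp.IH(1)[of v p r] v obtain v' where v': "path x v'" "heq (Comp (whisker p g r) v) v'" by auto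
  have "heq (Comp (whisker p (Comp g f) r) u) (Comp (whisker p g r) (Comp (whisker p f r) u))"
    using Comp.prems wf by (intro heq.sym[OF heq_whisker_comp_comp]) auto
  also have "heq \<dots> (Comp (whisker p g r) v)"
    using Comp.prems wf o v by (intro heq_comp_right) auto
  also note v'(2)
  finally show ?case using v' by blast
next
  case (Tens f g)
  have wf: "well_formed u" using Tens.prems path_well_formed by blast
  then have o: "tgt u \<in> objects" by simp
  from Tens.prems Tens.IH(2)[of u "p @ src f" r]
  obtain v where v: "path x v" "heq (Comp (whisker (p @ src f) g r) u) v" by auto
  have "tgt v = p @ src f @ tgt g @ r" using heq_wf_src_tgt(4)[OF v(2)] by simp
  with Tens.prems v Tens.IH(1)[of v p "tgt g @ r"]
  obtain v' where v': "path x v'" "heq (Comp (whisker p f (tgt g @ r)) v) v'" by auto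
  have "heq (Comp (whisker p (Tens f g) r) u) (Comp (Comp (whisker p f (tgt g @ r)) (whisker (p @ src f) g r)) u)"
    using Tens.prems wf o by (intro heq_comp_left heq_whisker_tens_right_first) auto
  also have "heq \<dots> (Comp (whisker p f (tgt g @ r)) (Comp (whisker (p @ src f) g r) u))"
    using Tens.prems wf o by (intro heq_comp_assoc) auto
  also have "heq \<dots> (Comp (whisker p f (tgt g @ r)) v)"
    using Tens.prems wf o v by (intro heq_comp_right) auto
  also note v'(2)
  finally show ?case using v' by blast
qed

lemma heq_path:
  assumes "well_formed w"
  shows "\<exists>v. path (src w) v \<and> heq w v"
proof -
  obtain v where v: "path (src w) v" "heq (Comp (whisker [] w []) (Id (src w))) v"
    using path_extend[OF assms path.Id, of "src w" "[]" "[]"] assms by auto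
  have "heq (Comp (whisker [] w []) (Id (src w))) (whisker [] w [])"
    using assms by (intro heq_id_right) auto
  also have "heq \<dots> w" by (rule heq_whisker_Nil[OF assms])
  finally show ?thesis using v heq.sym heq.trans by blast
qed

section \<open>States and their cost\<close>

definition pairs :: "(nat \<Rightarrow> nat \<Rightarrow> nat) \<Rightarrow> nat multiset \<Rightarrow> nat multiset \<Rightarrow> nat"
  where "pairs f A B = (\<Sum>a\<in>#A. \<Sum>b\<in>#B. f a b)"

lemma pairs_simps [simp]:
  "pairs f {#} B = 0" "pairs f A {#} = 0"
  "pairs f (A + A') B = pairs f A B + pairs f A' B"
  "pairs f A (B + B') = pairs f A B + pairs f A B'"
  by (auto simp: pairs_def sum_mset.distrib)

lemma sum_mset_mono_strict:
  fixes f g :: "'a \<Rightarrow> nat"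
  assumes "\<And>a. a \<in># A \<Longrightarrow> f a \<le> g a"
  shows "sum_mset (image_mset f A) \<le> sum_mset (image_mset g A)"
    and "sum_mset (image_mset f A) = sum_mset (image_mset g A) \<Longrightarrow> \<forall>a\<in>#A. f a = g a"
proof -
  have *: "sum_mset (image_mset f A) \<le> sum_mset (image_mset g A) \<and>
    (sum_mset (image_mset f A) = sum_mset (image_mset g A) \<longrightarrow> (\<forall>a\<in>#A. f a = g a))"
    using assms
  proof (induction A)
    case (add a A)
    then have "f a \<le> g a" "sum_mset (image_mset f A) \<le> sum_mset (image_mset g A)"
      "sum_mset (image_mset f A) = sum_mset (image_mset g A) \<Longrightarrow> \<forall>a\<in>#A. f a = g a" by auto
    then show ?case
      by (cases "sum_mset (image_mset f A) = sum_mset (image_mset g A)") auto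
  qed auto
  show "sum_mset (image_mset f A) \<le> sum_mset (image_mset g A)"
    and "sum_mset (image_mset f A) = sum_mset (image_mset g A) \<Longrightarrow> \<forall>a\<in>#A. f a = g a"
    using * by blast+
qed

lemma pairs_mono:
  assumes "\<And>a b. f a b \<le> g a b"
  shows "pairs f A B \<le> pairs g A B"
  unfolding pairs_def by (intro sum_mset_mono_strict(1) assms)

lemma pairs_eq:
  assumes "\<And>a b. f a b \<le> g a b" "pairs f A B = pairs g A B" "a \<in># A" "b \<in># B"
  shows "f a b = g a b"
proof -
  have "\<forall>a\<in>#A. (\<Sum>b\<in>#B. f a b) = (\<Sum>b\<in>#B. g a b)"
    by (rule sum_mset_mono_strict(2)) (use assms in \<open>auto simp: pairs_def intro!: sum_mset_mono_strict(1)\<close>)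
  then have "(\<Sum>b\<in>#B. f a b) = (\<Sum>b\<in>#B. g a b)" using assms by blast
  then have "\<forall>b\<in>#B. f a b = g a b"
    by (intro sum_mset_mono_strict(2) assms)
  then show ?thesis using assms by blast
qed

lemma pairs_cong:
  assumes "\<And>a b. a \<in># A \<Longrightarrow> b \<in># B \<Longrightarrow> f a b = g a b"
  shows "pairs f A B = pairs g A B"
  unfolding pairs_def using assms by (intro arg_cong[where f = sum_mset] image_mset_cong) auto

lemma pairs_eq_iff:
  assumes "\<And>a b. f a b \<le> g a b"
  shows "pairs f A B = pairs g A B \<longleftrightarrow> (\<forall>a\<in>#A. \<forall>b\<in>#B. f a b = g a b)"
proof
  assume "pairs f A B = pairs g A B"
  then show "\<forall>a\<in>#A. \<forall>b\<in>#B. f a b = g a b"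
    using pairs_eq[of f g A B] assms by blast
next
  assume "\<forall>a\<in>#A. \<forall>b\<in>#B. f a b = g a b"
  then show "pairs f A B = pairs g A B" by (intro pairs_cong) blast
qed

lemma pairs_Suc: "pairs (\<lambda>a b. Suc (f a b)) A B = pairs f A B + size A * size B"
proof -
  have "(\<Sum>b\<in>#B. Suc (f a b)) = (\<Sum>b\<in>#B. f a b) + size B" for a
    by (induction B) auto
  then show ?thesis unfolding pairs_def by (induction A) auto
qed

lemma pairs_commute: "(\<And>a b. f a b = f b a) \<Longrightarrow> pairs f A B = pairs f B A"
  unfolding pairs_def by (subst sum_mset.swap) simp

text \<open>Units of thickness are labelled by the number of the source strand from which they
  come. Two units with labels \<open>a\<close> and \<open>b\<close> thus start in relative
  position \<open>sgn (a - b)\<close>. The two functions below give the distance from this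
  position to position 0 (same strand) and to position -1 (the unit labelled \<open>a\<close> is
  on the left).\<close>

definition distinctness :: "nat \<Rightarrow> nat \<Rightarrow> nat"
  where "distinctness a b = (if a = b then 0 else 1)"

definition crossing :: "nat \<Rightarrow> nat \<Rightarrow> nat"
  where "crossing a b = (if a < b then 0 else if a = b then 1 else 2)"

text \<open>A state lists the target strands from left to right, each as the multiset of the
  labels of its units. Up to notation this is a matrix of non-negative integers with prescribed
  row and column sums, or a double coset of Young subgroups.\<close>

type_synonym state = "nat multiset list"

text \<open>Twice the total distance of all pairs of units from their initial relative position.
  Pairs within a row occur twice in \<open>pairs distinctness A A\<close>, hence the factor 2
  for pairs in different rows.\<close>

primrec cost :: "state \<Rightarrow> nat" where
  "cost [] = 0"
| "cost (A # s) = pairs distinctness A A + 2 * pairs crossing A (sum_list s) + cost s"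

lemma cost_append: "cost (s @ t) = cost s + cost t + 2 * pairs crossing (sum_list s) (sum_list t)"
  by (induction s) (auto simp: algebra_simps)

lemma cost_replace:
  "sum_list \<sigma> = sum_list \<tau> \<Longrightarrow> cost (s @ \<tau> @ t) + cost \<sigma> = cost (s @ \<sigma> @ t) + cost \<tau>"
  by (auto simp: cost_append)

definition before :: "nat multiset \<Rightarrow> nat multiset \<Rightarrow> bool"
  where "before A B \<longleftrightarrow> (\<forall>a\<in>#A. \<forall>b\<in>#B. a < b)"

definition not_after :: "nat multiset \<Rightarrow> nat multiset \<Rightarrow> bool"
  where "not_after A B \<longleftrightarrow> (\<forall>a\<in>#A. \<forall>b\<in>#B. a \<le> b)"

lemma cost_pair: "cost [A + B] = pairs distinctness A A + pairs distinctness B B + 2 * pairs distinctness A B"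
  using pairs_commute[of distinctness B A] by (simp add: distinctness_def)

text \<open>The units of \<open>A\<close> and \<open>B\<close> move by one step towards each
  other. Each pair thereby moves away from its initial position, by one step, precisely when it
  had kept its initial order.\<close>

lemma cost_merge_le: "cost [A + B] \<le> cost [A, B] + 2 * (size A * size B)"
  and cost_merge_eq: "cost [A + B] = cost [A, B] + 2 * (size A * size B) \<longleftrightarrow> before A B"
proof -
  have le: "distinctness a b \<le> Suc (crossing a b)" for a b
    by (simp add: distinctness_def crossing_def)
  show "cost [A + B] \<le> cost [A, B] + 2 * (size A * size B)"
    using pairs_mono[where A = A and B = B, of distinctness "\<lambda>a b. Suc (crossing a b)", OF le] unfolding cost_pair by (simp add: pairs_Suc)
  have "cost [A + B] = cost [A, B] + 2 * (size A * size B) \<longleftrightarrow>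
      pairs distinctness A B = pairs (\<lambda>a b. Suc (crossing a b)) A B"
    unfolding cost_pair by (simp add: pairs_Suc) linarith
  also have "\<dots> \<longleftrightarrow> (\<forall>a\<in>#A. \<forall>b\<in>#B. distinctness a b = Suc (crossing a b))"
    by (rule pairs_eq_iff[OF le])
  also have "\<dots> \<longleftrightarrow> before A B"
  proof -
    have "distinctness a b = Suc (crossing a b) \<longleftrightarrow> a < b" for a b
      by (auto simp: distinctness_def crossing_def)
    then show ?thesis unfolding before_def by blast
  qed
  finally show "cost [A + B] = cost [A, B] + 2 * (size A * size B) \<longleftrightarrow> before A B" .
qed

text \<open>Two units that are separated move away from their initial relative position if their
  labels are equal, or if the one with the larger label goes to the left.\<close>

lemma cost_split_le: "cost [A, B] \<le> cost [A + B] + 2 * (size A * size B)"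
  and cost_split_eq: "cost [A, B] = cost [A + B] + 2 * (size A * size B) \<longleftrightarrow> not_after B A"
proof -
  have le: "crossing a b \<le> Suc (distinctness a b)" for a b
    by (simp add: distinctness_def crossing_def)
  show "cost [A, B] \<le> cost [A + B] + 2 * (size A * size B)"
    using pairs_mono[where A = A and B = B, of crossing "\<lambda>a b. Suc (distinctness a b)", OF le] unfolding cost_pair by (simp add: pairs_Suc)
  have "cost [A, B] = cost [A + B] + 2 * (size A * size B) \<longleftrightarrow>
      pairs crossing A B = pairs (\<lambda>a b. Suc (distinctness a b)) A B"
    unfolding cost_pair by (simp add: pairs_Suc) linarith
  also have "\<dots> \<longleftrightarrow> (\<forall>a\<in>#A. \<forall>b\<in>#B. crossing a b = Suc (distinctness a b))"
    by (rule pairs_eq_iff[OF le])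
  also have "\<dots> \<longleftrightarrow> not_after B A"
  proof -
    have "crossing a b = Suc (distinctness a b) \<longleftrightarrow> b \<le> a" for a b
      by (auto simp: distinctness_def crossing_def)
    then show ?thesis unfolding not_after_def by blast
  qed
  finally show "cost [A, B] = cost [A + B] + 2 * (size A * size B) \<longleftrightarrow> not_after B A" .
qed

text \<open>\<open>A\<close> and \<open>A'\<close> are initial segments of the same sorted list,
  hence comparable.\<close>

lemma before_cut:
  assumes "before A B" "before A' B'" "A + B = A' + B'" "size A \<le> size A'"
  shows "\<exists>C. A' = A + C \<and> B = C + B'"
proof -
  have "A \<subseteq># A'"
  proof (rule ccontr)
    assume "\<not> A \<subseteq># A'"
    then obtain e where e: "count A' e < count A e" by (auto simp: subseteq_mset_def not_le)
    have "count A e \<le> count (A' + B') e" unfolding assms(3)[symmetric] by simp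
    with e have eB': "e \<in># B'" by (intro count_inI) auto
    have eA: "e \<in># A" using e by (intro count_inI) auto
    have "A' \<subseteq># A"
    proof (rule mset_subset_eqI)
      fix f
      show "count A' f \<le> count A f"
      proof (cases "f \<in># A'")
        case True
        then have "f < e" using assms(2) eB' by (auto simp: before_def)
        then have "f \<notin># B" using assms(1) eA unfolding before_def by (meson less_asym)
        then have "count A f = count (A + B) f" by (simp add: count_eq_zero_iff)
        then show ?thesis unfolding assms(3) by simp
      qed (simp add: not_in_iff)
    qed
    with e have "A' \<subset># A" by (auto simp: subset_mset_def)
    then show False using mset_subset_size assms(4) by fastforce
  qed
  then obtain C where C: "A' = A + C" by (auto simp: mset_subset_eq_exists_conv)
  with assms(3) have "B = C + B'" by (simp add: add.assoc)
  with C show ?thesis by blast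
qed

section \<open>Reduced webs\<close>

abbreviation sizes :: "state \<Rightarrow> nat list"
  where "sizes \<equiv> map size"

abbreviation within :: "state \<Rightarrow> web \<Rightarrow> state \<Rightarrow> web"
  where "within s g t \<equiv> whisker (sizes s) g (sizes t)"

abbreviation mrg :: "nat multiset \<Rightarrow> nat multiset \<Rightarrow> web"
  where "mrg A B \<equiv> Merge (size A) (size B)"

abbreviation spl :: "nat multiset \<Rightarrow> nat multiset \<Rightarrow> web"
  where "spl A B \<equiv> Split (size A) (size B)"

text \<open>The vertices along which the cost grows by as much as the degree allows.\<close>

inductive move :: "web \<Rightarrow> state \<Rightarrow> state \<Rightarrow> bool" where
  merge: "A \<noteq> {#} \<Longrightarrow> B \<noteq> {#} \<Longrightarrow> before A B \<Longrightarrow> move (mrg A B) [A, B] [A + B]"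
| split: "A \<noteq> {#} \<Longrightarrow> B \<noteq> {#} \<Longrightarrow> not_after B A \<Longrightarrow> move (spl A B) [A + B] [A, B]"

definition init :: "nat list \<Rightarrow> state"
  where "init x = map (\<lambda>i. replicate_mset (x ! i) i) [0..<length x]"

text \<open>Composites of layers in which every vertex is a move.\<close>

inductive reduced :: "nat list \<Rightarrow> web \<Rightarrow> state \<Rightarrow> bool" for x where
  Id: "reduced x (Id x) (init x)"
| layer: "reduced x u (s @ \<sigma> @ t) \<Longrightarrow> move g \<sigma> \<tau> \<Longrightarrow>
    reduced x (Comp (within s g t) u) (s @ \<tau> @ t)"

lemma move_props:
  assumes "move g \<sigma> \<tau>"
  shows "well_formed g" "generator g" "src g = sizes \<sigma>" "tgt g = sizes \<tau>" "sum_list \<sigma> = sum_list \<tau>"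
    "{#} \<notin> set \<sigma>" "{#} \<notin> set \<tau>" "deg g > 0" "cost \<tau> = cost \<sigma> + 2 * deg g"
proof -
  have "well_formed g \<and> generator g \<and> src g = sizes \<sigma> \<and> tgt g = sizes \<tau> \<and> sum_list \<sigma> = sum_list \<tau> \<and>
    {#} \<notin> set \<sigma> \<and> {#} \<notin> set \<tau> \<and> deg g > 0 \<and> cost \<tau> = cost \<sigma> + 2 * deg g"
    using assms
  proof cases
    case (merge A B)
    then have "size A \<ge> 1" "size B \<ge> 1" by (auto simp: Suc_le_eq nonempty_has_size)
    with merge show ?thesis using cost_merge_eq[of A B] by (auto simp: generator.simps)
  next
    case (split A B)
    then have "size A \<ge> 1" "size B \<ge> 1" by (auto simp: Suc_le_eq nonempty_has_size)
    with split show ?thesis using cost_split_eq[of A B] by (auto simp: generator.simps)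
  qed
  then show "well_formed g" "generator g" "src g = sizes \<sigma>" "tgt g = sizes \<tau>" "sum_list \<sigma> = sum_list \<tau>"
    "{#} \<notin> set \<sigma>" "{#} \<notin> set \<tau>" "deg g > 0" "cost \<tau> = cost \<sigma> + 2 * deg g" by auto
qed

definition valid :: "nat list \<Rightarrow> state \<Rightarrow> bool"
  where "valid x s \<longleftrightarrow> {#} \<notin> set s \<and> sum_list s = sum_list (init x)"

lemma sizes_init [simp]: "sizes (init x) = x"
  unfolding init_def by (rule nth_equalityI) auto

text \<open>The induction runs from the right, hence the general lower bound \<open>m\<close>;
  the second conjunct says that the rows that follow contain larger labels only.\<close>

lemma cost_init [simp]: "cost (init x) = 0"
proof -
  have aux: "cost (map (\<lambda>i. replicate_mset (f i) i) [m..<n]) = 0 \<and>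
      (\<forall>a\<in>#sum_list (map (\<lambda>i. replicate_mset (f i) i) [m..<n]). m \<le> a)" for f :: "nat \<Rightarrow> nat" and m n
  proof (induction "n - m" arbitrary: m)
    case (Suc d)
    let ?r = "\<lambda>k. map (\<lambda>i. replicate_mset (f i) i) [k..<n]"
    have m: "m < n" using Suc by simp
    have "[m..<n] = m # [Suc m..<n]" using m by (rule upt_conv_Cons)
    then have r: "?r m = replicate_mset (f m) m # ?r (Suc m)" by simp
    have IH: "cost (?r (Suc m)) = 0" "\<forall>a\<in>#sum_list (?r (Suc m)). Suc m \<le> a"
      using Suc(1)[of "Suc m"] Suc(2) by auto
    have 1: "pairs distinctness (replicate_mset (f m) m) (replicate_mset (f m) m) = pairs (\<lambda>_ _. 0) (replicate_mset (f m) m) (replicate_mset (f m) m)"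
      by (rule pairs_cong) (auto simp: distinctness_def split: if_splits)
    have lt: "a < b" if "a \<in># replicate_mset (f m) m" "b \<in># sum_list (?r (Suc m))" for a b
    proof -
      have "a = m" using that(1) by (simp split: if_splits)
      moreover have "Suc m \<le> b" using that(2) IH(2) by blast
      ultimately show ?thesis by simp
    qed
    have 2: "pairs crossing (replicate_mset (f m) m) (sum_list (?r (Suc m))) = pairs (\<lambda>_ _. 0) (replicate_mset (f m) m) (sum_list (?r (Suc m)))"
      by (rule pairs_cong) (unfold crossing_def, metis lt)
    have "m \<le> a" if "a \<in># replicate_mset (f m) m + sum_list (?r (Suc m))" for a
    proof (cases "a \<in># sum_list (?r (Suc m))")
      case True
      then have "Suc m \<le> a" using IH(2) by blast
      then show ?thesis by simp
    qed (use that in \<open>auto split: if_splits\<close>)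
    then show ?case unfolding r cost.simps 1 2 using IH(1) by (simp add: pairs_def)
  qed auto
  show ?thesis unfolding init_def using aux by blast
qed

lemma objects_sizes_iff: "sizes s \<in> objects \<longleftrightarrow> {#} \<notin> set s"
  by (auto simp: objects_iff)

lemma valid_init: "x \<in> objects \<Longrightarrow> valid x (init x)"
  using objects_sizes_iff[of "init x"] by (simp add: valid_def)

lemma reduced_props:
  assumes "reduced x u s" "x \<in> objects"
  shows "well_formed u" "src u = x" "tgt u = sizes s" "valid x s" "cost s = 2 * deg u"
proof -
  have "well_formed u \<and> src u = x \<and> tgt u = sizes s \<and> valid x s \<and> cost s = 2 * deg u"
    using assms
  proof (induction rule: reduced.induct)
    case Id
    then show ?case using valid_init by simp
  next
    case (layer u s \<sigma> t g \<tau>)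
    note l = move_props[OF layer.hyps(2)]
    have "valid x (s @ \<tau> @ t)" using layer.IH layer.prems l by (auto simp: valid_def)
    moreover have "{#} \<notin> set s" "{#} \<notin> set t" using layer.IH layer.prems by (auto simp: valid_def)
    moreover have "cost (s @ \<tau> @ t) = cost (s @ \<sigma> @ t) + 2 * deg g"
      using cost_replace[OF l(5), of s t] l(9) by simp
    ultimately show ?case using layer.IH layer.prems l by (simp add: objects_sizes_iff)
  qed
  then show "well_formed u" "src u = x" "tgt u = sizes s" "valid x s" "cost s = 2 * deg u" by auto
qed

section \<open>Existence of reduced webs\<close>

lemma set_mset_sum_list: "set_mset (sum_list s) = (\<Union>A\<in>set s. set_mset A)"
  by (induction s) auto

text \<open>The first row consists of all occurrences of the smallest label.\<close>

lemma sorted_constant_rows_unique: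
  assumes "sorted_wrt before s" "sorted_wrt before t"
    "\<forall>A\<in>set s. A \<noteq> {#} \<and> (\<forall>a\<in>#A. \<forall>b\<in>#A. a = b)" "\<forall>A\<in>set t. A \<noteq> {#} \<and> (\<forall>a\<in>#A. \<forall>b\<in>#A. a = b)"
    "sum_list s = sum_list t"
  shows "s = t"
  using assms
proof (induction s arbitrary: t)
  case Nil
  then show ?case by (cases t) auto
next
  case (Cons A s)
  then obtain B t' where t: "t = B # t'" by (cases t) auto
  have row: "A = filter_mset (\<lambda>e. \<forall>f\<in>#sum_list (A # s). e \<le> f) (sum_list (A # s))"
    if *: "sorted_wrt before (A # s)" "\<forall>A\<in>set (A # s). A \<noteq> {#} \<and> (\<forall>a\<in>#A. \<forall>b\<in>#A. a = b)" for A s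
  proof -
    obtain a where a: "a \<in># A" using * by auto
    have gt: "b \<in># sum_list s \<Longrightarrow> a < b" for b
      using *(1) a by (auto simp: before_def set_mset_sum_list)
    have eq: "b \<in># A \<Longrightarrow> b = a" for b using * a by auto
    have "filter_mset (\<lambda>e. \<forall>f\<in>#sum_list (A # s). e \<le> f) A = A"
    proof -
      have "b \<le> f" if "b \<in># A" "f \<in># sum_list (A # s)" for b f
        using eq[OF that(1)] eq[of f] gt[of f] that(2) by (auto intro: less_imp_le)
      then show ?thesis by (simp add: filter_mset_eq_conv)
    qed
    moreover have "filter_mset (\<lambda>e. \<forall>f\<in>#sum_list (A # s). e \<le> f) (sum_list s) = {#}"
      using gt a by (auto simp: filter_mset_eq_mempty_iff not_le)
    ultimately show ?thesis by simp
  qed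
  have "A = filter_mset (\<lambda>e. \<forall>f\<in>#sum_list (A # s). e \<le> f) (sum_list (A # s))"
    using Cons.prems by (intro row) auto
  also have "\<dots> = filter_mset (\<lambda>e. \<forall>f\<in>#sum_list (B # t'). e \<le> f) (sum_list (B # t'))"
    using Cons.prems t by simp
  also have "\<dots> = B"
    using Cons.prems t by (intro row[symmetric]) auto
  finally have "A = B" .
  moreover have "s = t'"
    using Cons.prems t \<open>A = B\<close> by (intro Cons.IH) auto
  ultimately show ?case using t by simp
qed

lemma init_sorted: "sorted_wrt before (init x)"
  unfolding init_def by (auto simp: sorted_wrt_map before_def sorted_wrt_iff_nth_less)

lemma init_constant: "A \<in> set (init x) \<Longrightarrow> a \<in># A \<Longrightarrow> b \<in># A \<Longrightarrow> a = b"
  unfolding init_def by (auto split: if_splits)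

lemma before_trans: "before A B \<Longrightarrow> before B C \<Longrightarrow> B \<noteq> {#} \<Longrightarrow> before A C"
  unfolding before_def by (meson less_trans multiset_nonemptyE)

lemma sorted_before_or_descent:
  assumes "{#} \<notin> set s"
  shows "sorted_wrt before s \<or> (\<exists>s' A B t. s = s' @ [A, B] @ t \<and> \<not> before A B)"
  using assms
proof (induction s)
  case (Cons A s)
  show ?case
  proof (cases s)
    case (Cons B t)
    show ?thesis
    proof (cases "before A B")
      case False
      then have "A # s = [] @ [A, B] @ t \<and> \<not> before A B" using Cons by simp
      then show ?thesis by blast
    next
      case True
      from Cons.IH Cons.prems consider "sorted_wrt before s"
        | s' A' B' t' where "s = s' @ [A', B'] @ t'" "\<not> before A' B'" by auto
      then show ?thesis
      proof cases
        case 1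
        then have "sorted_wrt before (A # s)"
          using True Cons Cons.prems before_trans[OF True] by auto
        then show ?thesis by blast
      next
        case 2
        then have "A # s = (A # s') @ [A', B'] @ t' \<and> \<not> before A' B'" by simp
        then show ?thesis by blast
      qed
    qed
  qed simp
qed simp

lemma filter_before:
  assumes "a \<in># A" "b \<in># A" "a < b"
  obtains A1 A2 where "A = A1 + A2" "before A1 A2" "a \<in># A1" "b \<in># A2"
proof
  show "A = filter_mset (\<lambda>e. e < b) A + filter_mset (\<lambda>e. \<not> e < b) A" by (simp add: multiset_partition)
qed (use assms in \<open>auto simp: before_def\<close>)

text \<open>A row that contains two different labels is the result of a merge, and two adjacent
  constant rows in the wrong order are the result of a split. Undoing such a move lowers the
  cost. If neither is possible, then the rows are constant and increasing, and the state is the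
  initial one.\<close>

lemma reduced_exists:
  assumes "valid x s" "x \<in> objects"
  shows "\<exists>u. reduced x u s"
  using assms
proof (induction "cost s" arbitrary: s rule: less_induct)
  case less
  have step: ?case if "s = s' @ \<tau> @ t" "move g \<sigma> \<tau>" for s' \<tau> t g \<sigma>
  proof -
    note l = move_props[OF that(2)]
    have "cost (s' @ \<sigma> @ t) < cost s"
      using cost_replace[OF l(5), of s' t] l(8,9) that(1) by simp
    moreover have "valid x (s' @ \<sigma> @ t)" using less.prems that(1) l by (auto simp: valid_def)
    ultimately obtain u where "reduced x u (s' @ \<sigma> @ t)" using less.hyps less.prems by blast
    then show ?case using reduced.layer that by blast
  qed
  have ne: "{#} \<notin> set s" using less.prems by (simp add: valid_def)
  show ?case
  proof (cases "\<forall>A\<in>set s. \<forall>a\<in>#A. \<forall>b\<in>#A. a = b")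
    case False
    then obtain A a b where A: "A \<in> set s" "a \<in># A" "b \<in># A" "a < b" by (metis linorder_neqE_nat)
    then obtain s' t where s: "s = s' @ [A] @ t" by (metis append_Cons append_Nil split_list)
    obtain A1 A2 where "A = A1 + A2" "before A1 A2" "a \<in># A1" "b \<in># A2"
      using filter_before A by blast
    then show ?thesis
      using step[of s' "[A]" t "mrg A1 A2" "[A1, A2]"] s move.merge[of A1 A2] by (cases "A1 = {#} \<or> A2 = {#}") auto
  next
    case const: True
    show ?thesis
    proof (cases "sorted_wrt before s")
      case True
      have "s = init x"
        using const ne True less.prems valid_init[of x]
        by (intro sorted_constant_rows_unique init_sorted) (auto simp: valid_def dest: init_constant)
      then show ?thesis using reduced.Id by blast
    next
      case False
      then obtain s' A B t where s: "s = s' @ [A, B] @ t" "\<not> before A B"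
        using sorted_before_or_descent[OF ne] by auto
      then obtain a b where ab: "a \<in># A" "b \<in># B" "b \<le> a" by (auto simp: before_def not_less)
      have AB: "A \<in> set s" "B \<in> set s" unfolding s(1) by auto
      have "a' = a" if "a' \<in># A" for a' using const AB(1) ab(1) that by blast
      moreover have "b' = b" if "b' \<in># B" for b' using const AB(2) ab(2) that by blast
      ultimately have "not_after B A" using ab(3) unfolding not_after_def by metis
      moreover have "A \<noteq> {#}" "B \<noteq> {#}" using ab by auto
      ultimately show ?thesis using step[OF s(1) move.split[of A B]] by blast
    qed
  qed
qed

section \<open>Matsumoto's theorem for webs\<close>

text \<open>Short composites of moves on a few adjacent strands, in exactly the shapes in which
  they occur in the relations.\<close>

inductive moves :: "web \<Rightarrow> state \<Rightarrow> state \<Rightarrow> bool" where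
  plain: "move g \<sigma> \<tau> \<Longrightarrow> moves g \<sigma> \<tau>"
| left: "move g \<sigma> \<tau> \<Longrightarrow> {#} \<notin> set t \<Longrightarrow> moves (Tens g (Id (sizes t))) (\<sigma> @ t) (\<tau> @ t)"
| right: "move g \<sigma> \<tau> \<Longrightarrow> {#} \<notin> set s \<Longrightarrow> moves (Tens (Id (sizes s)) g) (s @ \<sigma>) (s @ \<tau>)"
| comp: "moves h \<sigma> \<tau> \<Longrightarrow> moves k \<tau> \<upsilon> \<Longrightarrow> moves (Comp k h) \<sigma> \<upsilon>"

lemma moves_props:
  assumes "moves h \<sigma> \<tau>"
  shows "well_formed h" "src h = sizes \<sigma>" "tgt h = sizes \<tau>" "sum_list \<sigma> = sum_list \<tau>" "{#} \<notin> set \<sigma>"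
proof -
  have "well_formed h \<and> src h = sizes \<sigma> \<and> tgt h = sizes \<tau> \<and> sum_list \<sigma> = sum_list \<tau> \<and> {#} \<notin> set \<sigma>"
    using assms
    by (induction rule: moves.induct) (auto simp: objects_sizes_iff move_props)
  then show "well_formed h" "src h = sizes \<sigma>" "tgt h = sizes \<tau>" "sum_list \<sigma> = sum_list \<tau>" "{#} \<notin> set \<sigma>"
    by auto
qed

text \<open>Attaching moves to a reduced web gives a reduced web, after the interchange law has
  turned it into a composite of layers.\<close>

lemma reduced_moves:
  assumes "moves h \<sigma> \<tau>" "reduced x z (s @ \<sigma> @ t)" "x \<in> objects"
  shows "\<exists>z'. reduced x z' (s @ \<tau> @ t) \<and> heq (Comp (within s h t) z) z'"
  using assms
proof (induction arbitrary: z rule: moves.induct)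
  case (plain g \<sigma> \<tau>)
  then have "reduced x (Comp (within s g t) z) (s @ \<tau> @ t)" by (intro reduced.layer)
  then show ?case using reduced_props(1) heq.refl plain.prems by blast
next
  case (left g \<sigma> \<tau> r)
  note z = reduced_props[OF left.prems]
  have r: "reduced x (Comp (within s g (r @ t)) z) (s @ \<tau> @ r @ t)"
    using left by (intro reduced.layer) auto
  have "heq (Comp (within s (Tens g (Id (sizes r))) t) z) (Comp (within s g (r @ t)) z)"
    using z move_props[OF left.hyps(1)] left.hyps
    by (intro heq_comp_left) (auto intro!: heq_whisker_tens_Id_right simp: objects_sizes_iff valid_def)
  with r show ?case by auto
next
  case (right g \<sigma> \<tau> r)
  note z = reduced_props[OF right.prems]
  have r: "reduced x (Comp (within (s @ r) g t) z) ((s @ r) @ \<tau> @ t)"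
    using right by (intro reduced.layer) auto
  have "heq (Comp (within s (Tens (Id (sizes r)) g) t) z) (Comp (within (s @ r) g t) z)"
    using z move_props[OF right.hyps(1)] right.hyps
    by (intro heq_comp_left) (auto intro!: heq_whisker_tens_Id_left simp: objects_sizes_iff valid_def)
  with r show ?case by auto
next
  case (comp h \<sigma> \<tau> k \<upsilon>)
  note z = reduced_props[OF comp.prems]
  note l = moves_props[OF comp.hyps(1)] moves_props[OF comp.hyps(2)]
  obtain z' where z': "reduced x z' (s @ \<tau> @ t)" "heq (Comp (within s h t) z) z'"
    using comp.IH(1) comp.prems by blast
  obtain z'' where z'': "reduced x z'' (s @ \<upsilon> @ t)" "heq (Comp (within s k t) z') z''"
    using comp.IH(2) z' comp.prems by blast
  have st: "sizes s \<in> objects" "sizes t \<in> objects" using z by (auto simp: valid_def objects_sizes_iff)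
  have "heq (Comp (within s (Comp k h) t) z) (Comp (within s k t) (Comp (within s h t) z))"
    using z l by (intro heq.sym[OF heq_whisker_comp_comp]) auto
  also have "heq \<dots> (Comp (within s k t) z')"
    using z l st z' by (intro heq_comp_right) auto
  also note z''(2)
  finally show ?case using z'' by blast
qed

text \<open>The induction hypothesis in the proof of \<open>reduced_unique\<close>.\<close>

definition unique_below :: "nat \<Rightarrow> nat list \<Rightarrow> bool"
  where "unique_below n x \<longleftrightarrow> (\<forall>u v s. deg u < n \<longrightarrow> reduced x u s \<longrightarrow> reduced x v s \<longrightarrow> heq u v)"

lemma unique_belowD: "unique_below n x \<Longrightarrow> deg u < n \<Longrightarrow> reduced x u s \<Longrightarrow> reduced x v s \<Longrightarrow> heq u v"
  unfolding unique_below_def by blast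

text \<open>The key step of the induction. Two reduced webs for the same state end in
  \<open>G1\<close> and \<open>G2\<close>. If both vertices can be extended downwards by moves
  that start from a common state \<open>\<rho>\<close> and that form the two sides of a
  relation, then the induction hypothesis replaces the lower parts of the webs by these moves on
  top of one reduced web for \<open>\<rho>\<close>.\<close>

lemma join:
  assumes IH: "unique_below n x"
    and x: "x \<in> objects"
    and u: "reduced x u1 (s @ \<sigma>1 @ t)" "reduced x u2 (s @ \<sigma>2 @ t)" "deg u1 < n" "deg u2 < n"
    and h: "moves h1 \<rho> \<sigma>1" "moves h2 \<rho> \<sigma>2"
    and G: "heq (Comp G1 h1) (Comp G2 h2)"
  shows "heq (Comp (within s G1 t) u1) (Comp (within s G2 t) u2)"
proof -
  note l = moves_props[OF h(1)] moves_props[OF h(2)]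
  note u1 = reduced_props[OF u(1) x] and u2 = reduced_props[OF u(2) x]
  have "valid x (s @ \<rho> @ t)" using u1(4) l by (auto simp: valid_def)
  then obtain z where z: "reduced x z (s @ \<rho> @ t)" using reduced_exists x by blast
  note zp = reduced_props[OF z x]
  have st: "sizes s \<in> objects" "sizes t \<in> objects" using zp by (auto simp: valid_def objects_sizes_iff)
  note wf = heq_wf_src_tgt[OF G]
  have key: "heq (Comp (within s G t) u) (Comp (within s (Comp G h) t) z)"
    if r: "reduced x u (s @ \<sigma> @ t)" "deg u < n" "moves h \<rho> \<sigma>" "well_formed (Comp G h)" for u \<sigma> h G
  proof -
    obtain z' where z': "reduced x z' (s @ \<sigma> @ t)" "heq (Comp (within s h t) z) z'"
      using reduced_moves[OF r(3) z x] by blast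
    note up = reduced_props[OF r(1) x] and lp = moves_props[OF r(3)]
    have "heq u (Comp (within s h t) z)"
      using unique_belowD[OF IH r(2,1) z'(1)] z'(2) heq.sym heq.trans by blast
    then have "heq (Comp (within s G t) u)
       (Comp (within s G t) (Comp (within s h t) z))"
      using up lp r(4) st by (intro heq_comp_right) auto
    also have "heq \<dots> (Comp (within s (Comp G h) t) z)"
      using zp lp r(4) by (intro heq_whisker_comp_comp) auto
    finally show ?thesis .
  qed
  have "heq (Comp (within s G1 t) u1) (Comp (within s (Comp G1 h1) t) z)"
    by (rule key[OF u(1,3) h(1) wf(1)])
  also have "heq \<dots> (Comp (within s (Comp G2 h2) t) z)"
    using G st zp l wf by (intro heq_comp_left heq_whisker) auto
  also have "heq \<dots> (Comp (within s G2 t) u2)"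
    by (rule heq.sym[OF key[OF u(2,4) h(2) wf(2)]])
  finally show ?thesis .
qed

lemma size_pos: "A \<noteq> {#} \<Longrightarrow> Suc 0 \<le> size A"
  by (simp add: Suc_le_eq nonempty_has_size)

text \<open>The common state is obtained by undoing both moves, which do not share a
  strand.\<close>

lemma join_apart:
  assumes IH: "unique_below n x"
    and x: "x \<in> objects"
    and u: "reduced x u1 (s @ \<sigma>1 @ m @ \<tau>2 @ t)" "reduced x u2 (s @ \<tau>1 @ m @ \<sigma>2 @ t)" "deg u1 < n" "deg u2 < n"
    and g: "move g1 \<sigma>1 \<tau>1" "move g2 \<sigma>2 \<tau>2"
  shows "heq (Comp (within s g1 (m @ \<tau>2 @ t)) u1) (Comp (within (s @ \<tau>1 @ m) g2 t) u2)"
proof -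
  note l1 = move_props[OF g(1)] and l2 = move_props[OF g(2)]
  have "valid x (s @ \<sigma>1 @ m @ \<sigma>2 @ t)"
    using reduced_props(4)[OF u(1) x] l2 by (auto simp: valid_def)
  then obtain z where z: "reduced x z (s @ \<sigma>1 @ m @ \<sigma>2 @ t)" using reduced_exists x by blast
  note zp = reduced_props[OF z x]
  have o: "sizes s \<in> objects" "sizes t \<in> objects" "sizes m \<in> objects"
    "sizes \<tau>1 \<in> objects" "sizes \<tau>2 \<in> objects" "sizes \<sigma>1 \<in> objects" "sizes \<sigma>2 \<in> objects"
    using zp l1 l2 by (auto simp: valid_def objects_sizes_iff)
  have "reduced x (Comp (within (s @ \<sigma>1 @ m) g2 t) z) ((s @ \<sigma>1 @ m) @ \<tau>2 @ t)"
    using reduced.layer[of x z "s @ \<sigma>1 @ m" \<sigma>2 t g2 \<tau>2] z g by simp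
  then have e1: "heq u1 (Comp (within (s @ \<sigma>1 @ m) g2 t) z)"
    using unique_belowD[OF IH] u by simp
  have "reduced x (Comp (within s g1 (m @ \<sigma>2 @ t)) z) (s @ \<tau>1 @ (m @ \<sigma>2 @ t))"
    using reduced.layer[of x z s \<sigma>1 "m @ \<sigma>2 @ t" g1 \<tau>1] z g by simp
  then have e2: "heq (Comp (within s g1 (m @ \<sigma>2 @ t)) z) u2"
    using unique_belowD[OF IH] u heq.sym by simp
  have "heq (Comp (within s g1 (m @ \<tau>2 @ t)) u1)
    (Comp (within s g1 (m @ \<tau>2 @ t)) (Comp (within (s @ \<sigma>1 @ m) g2 t) z))"
    using e1 o l1 l2 reduced_props[OF u(1) x] by (intro heq_comp_right) auto
  also have "heq \<dots> (Comp (Comp (within s g1 (m @ \<tau>2 @ t)) (within (s @ \<sigma>1 @ m) g2 t)) z)"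
    using o l1 l2 zp by (intro heq.sym[OF heq_comp_assoc]) auto
  also have "heq \<dots> (Comp (Comp (within (s @ \<tau>1 @ m) g2 t) (within s g1 (m @ \<sigma>2 @ t))) z)"
    using o l1 l2 zp heq_whisker_commute[of g1 g2 "sizes s" "sizes m" "sizes t"]
    by (intro heq_comp_left) auto
  also have "heq \<dots> (Comp (within (s @ \<tau>1 @ m) g2 t) (Comp (within s g1 (m @ \<sigma>2 @ t)) z))"
    using o l1 l2 zp by (intro heq_comp_assoc) auto
  also have "heq \<dots> (Comp (within (s @ \<tau>1 @ m) g2 t) u2)"
    using e2 o l1 l2 zp by (intro heq_comp_right) auto
  finally show ?thesis .
qed

lemma heq_layer_left:
  assumes "well_formed g" "reduced x u (s @ \<sigma> @ r @ t)" "src g = sizes \<sigma>" "x \<in> objects"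
  shows "heq (Comp (within s g (r @ t)) u)
    (Comp (within s (Tens g (Id (sizes r))) t) u)"
proof -
  note up = reduced_props[OF assms(2,4)]
  have o: "sizes s \<in> objects" "sizes t \<in> objects" "sizes r \<in> objects"
    using up by (auto simp: valid_def objects_sizes_iff)
  show ?thesis using o up assms heq_whisker_tens_Id_right[of g "sizes s" "sizes t" "sizes r"]
    by (intro heq_comp_left heq.sym[OF heq_whisker_tens_Id_right]) (auto intro: heq.sym)
qed

lemma heq_layer_right:
  assumes "well_formed g" "reduced x u (s @ r @ \<sigma> @ t)" "src g = sizes \<sigma>" "x \<in> objects"
  shows "heq (Comp (within (s @ r) g t) u)
    (Comp (within s (Tens (Id (sizes r)) g) t) u)"
proof -
  note up = reduced_props[OF assms(2,4)]
  have o: "sizes s \<in> objects" "sizes t \<in> objects" "sizes r \<in> objects"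
    using up by (auto simp: valid_def objects_sizes_iff)
  show ?thesis using o up assms heq_whisker_tens_Id_left[of g "sizes s" "sizes t" "sizes r"]
    by (intro heq_comp_left) (auto intro: heq.sym)
qed

lemma before_add_left: "before (A + B) C \<longleftrightarrow> before A C \<and> before B C"
  and before_add_right: "before A (B + C) \<longleftrightarrow> before A B \<and> before A C"
  and not_after_add_left: "not_after (A + B) C \<longleftrightarrow> not_after A C \<and> not_after B C"
  and not_after_add_right: "not_after A (B + C) \<longleftrightarrow> not_after A B \<and> not_after A C"
  by (auto simp: before_def not_after_def)

lemma order_trans_rows:
  "B \<noteq> {#} \<Longrightarrow> not_after A B \<Longrightarrow> before B C \<Longrightarrow> before A C"
  "B \<noteq> {#} \<Longrightarrow> before A B \<Longrightarrow> not_after B C \<Longrightarrow> before A C"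
  "B \<noteq> {#} \<Longrightarrow> not_after A B \<Longrightarrow> not_after B C \<Longrightarrow> not_after A C"
  unfolding before_def not_after_def
  by (meson multiset_nonemptyE le_less_trans less_le_trans order_trans)+

text \<open>By \<open>before_cut\<close> the row is a merge of three pieces, and the relation is
  associativity.\<close>

lemma join_merge_merge:
  assumes IH: "unique_below n x"
    and x: "x \<in> objects"
    and u: "reduced x u1 (s @ [A, B] @ t)" "reduced x u2 (s @ [A', B'] @ t)" "deg u1 < n" "deg u2 < n"
    and g: "A \<noteq> {#}" "B \<noteq> {#}" "before A B" "A' \<noteq> {#}" "B' \<noteq> {#}" "before A' B'"
    and e: "A + B = A' + B'" "size A \<le> size A'"
  shows "heq (Comp (within s (mrg A B) t) u1)
    (Comp (within s (mrg A' B') t) u2)"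
proof -
  obtain C where C: "A' = A + C" "B = C + B'" using before_cut[OF g(3,6) e] by blast
  show ?thesis
  proof (cases "C = {#}")
    case True
    then have "u1 = u1" "A = A'" "B = B'" using C by auto
    then have "heq u1 u2" using unique_belowD[OF IH] u by simp
    then show ?thesis using reduced_props[OF u(1) x] g unfolding \<open>A = A'\<close> \<open>B = B'\<close>
      by (intro heq_comp_right) (auto simp: objects_sizes_iff valid_def dest: size_pos)
  next
    case False
    have b: "before A C" "before A B'" "before C B'" using g C by (auto simp: before_add_left before_add_right)
    have h1: "moves (Tens (Id (sizes [A])) (mrg C B')) ([A] @ [C, B']) ([A] @ [C + B'])"
      using b g False by (intro moves.right move.merge) auto
    have h2: "moves (Tens (mrg A C) (Id (sizes [B']))) ([A, C] @ [B']) ([A + C] @ [B'])"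
      using b g False by (intro moves.left move.merge) auto
    have "heq (Comp (mrg A B) (Tens (Id (sizes [A])) (mrg C B')))
      (Comp (mrg A' B') (Tens (mrg A C) (Id (sizes [B']))))"
      using assoc_relation.assoc[of "size A" "size C" "size B'"] g False C
      by (intro heq.sym[OF heq_assoc]) (simp add: size_pos)
    with h1 h2 show ?thesis using u C
      by (intro join[OF IH x, of u1 s "[A, B]" t u2 "[A', B']"
            "Tens (Id (sizes [A])) (mrg C B')" "[A, C, B']"
            "Tens (mrg A C) (Id (sizes [B']))"]) auto
  qed
qed

text \<open>Two overlapping splits have the middle row in common, and the relation is
  coassociativity.\<close>

lemma join_split_split:
  assumes IH: "unique_below n x"
    and x: "x \<in> objects"
    and u: "reduced x u1 (s @ [P + Q, R] @ t)" "reduced x u2 (s @ [P, Q + R] @ t)" "deg u1 < n" "deg u2 < n"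
    and g: "P \<noteq> {#}" "Q \<noteq> {#}" "R \<noteq> {#}" "not_after Q P" "not_after R Q"
  shows "heq (Comp (within s (spl P Q) ([R] @ t)) u1)
    (Comp (within (s @ [P]) (spl Q R) t) u2)"
proof -
  have rp: "not_after R P" using order_trans_rows(3)[of Q R P] g by simp
  have h1: "moves (spl (P + Q) R) [(P + Q) + R] [P + Q, R]"
    using g rp by (intro moves.plain move.split) (auto simp: not_after_add_left not_after_add_right)
  have h2: "moves (spl P (Q + R)) [P + (Q + R)] [P, Q + R]"
    using g rp by (intro moves.plain move.split) (auto simp: not_after_add_left not_after_add_right)
  have "heq (Comp (Tens (spl P Q) (Id (sizes [R]))) (spl (P + Q) R))
    (Comp (Tens (Id (sizes [P])) (spl Q R)) (spl P (Q + R)))"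
    using assoc_relation.coassoc[of "size P" "size Q" "size R"] g
    by (intro heq_assoc) (simp add: size_pos)
  with h1 h2 have "heq (Comp (within s (Tens (spl P Q) (Id (sizes [R]))) t) u1)
    (Comp (within s (Tens (Id (sizes [P])) (spl Q R)) t) u2)"
    using u by (intro join[OF IH x, of u1 s "[P + Q, R]" t u2 "[P, Q + R]" _ "[P + Q + R]"]) (auto simp: add.assoc)
  moreover have "heq (Comp (within s (spl P Q) ([R] @ t)) u1)
     (Comp (within s (Tens (spl P Q) (Id (sizes [R]))) t) u1)"
    using u g x by (intro heq_layer_left[of _ x u1 s "[P + Q]" "[R]" t]) (auto simp: size_pos)
  moreover have "heq (Comp (within (s @ [P]) (spl Q R) t) u2)
     (Comp (within s (Tens (Id (sizes [P])) (spl Q R)) t) u2)"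
    using u g x by (intro heq_layer_right[of _ x u2 s "[P]" "[Q + R]" t]) (auto simp: size_pos)
  ultimately show ?thesis using heq.sym heq.trans by blast
qed

text \<open>The row \<open>A + B\<close> ends a merge and is at the same time the left leg of a
  split. The labels satisfy \<open>Q\<close>, then \<open>A\<close>, then \<open>B\<close> in
  weakly increasing order, so \<open>[A + Q, B]\<close> leads by moves to both predecessors, and
  these form a square relation.\<close>

lemma join_merge_split:
  assumes IH: "unique_below n x"
    and x: "x \<in> objects"
    and u: "reduced x u1 (s @ [A, B, Q] @ t)" "reduced x u2 (s @ [(A + B) + Q] @ t)" "deg u1 < n" "deg u2 < n"
    and g: "A \<noteq> {#}" "B \<noteq> {#}" "Q \<noteq> {#}" "before A B" "not_after Q (A + B)"
  shows "heq (Comp (within s (mrg A B) ([Q] @ t)) u1)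
    (Comp (within s (spl (A + B) Q) t) u2)"
proof -
  have o: "not_after Q A" "not_after Q B" "before Q B"
    using g order_trans_rows(1)[of A Q B] by (auto simp: not_after_add_right)
  let ?k1 = "Tens (spl A Q) (Id (sizes [B]))"
  let ?k2 = "Tens (Id (sizes [A])) (mrg Q B)"
  let ?k3 = "Tens (Id (sizes [A])) (spl B Q)"
  have k1: "moves ?k1 ([A + Q] @ [B]) ([A, Q] @ [B])"
    using g o by (intro moves.left move.split) auto
  have k2: "moves ?k2 ([A] @ [Q, B]) ([A] @ [Q + B])"
    using g o by (intro moves.right move.merge) auto
  have k3: "moves ?k3 ([A] @ [B + Q]) ([A] @ [B, Q])"
    using g o by (intro moves.right move.split) auto
  have h1: "moves (Comp ?k3 (Comp ?k2 ?k1)) [A + Q, B] [A, B, Q]"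
    using k1 k2 k3 by (intro moves.comp[of _ _ "[A, Q + B]"] moves.comp[of _ _ "[A, Q, B]"]) (auto simp: add.commute)
  have h2: "moves (mrg (A + Q) B) [A + Q, B] [(A + Q) + B]"
    using g o by (intro moves.plain move.merge) (auto simp: before_add_left)
  have pos: "1 \<le> size A" "1 \<le> size B" "1 \<le> size Q" using g size_pos by auto
  \<comment> \<open>The square relation is used with total thickness \<open>N\<close>, bottom
    labels \<open>size A + size Q\<close> and \<open>size B\<close>, and top labels \<open>size
    A + size B\<close> and \<open>size Q\<close>.\<close>
  define N where "N = size A + size B + size Q"
  have "sc_relation
    (Comp (Tens (Merge (size A + size Q + (size A + size B) - N) (N - (size A + size Q))) (Id [N - (size A + size B)]))
      (Comp (Tens (Id [size A + size Q + (size A + size B) - N]) (Split (N - (size A + size Q)) (N - (size A + size B))))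
        (Comp (Tens (Id [size A + size Q + (size A + size B) - N]) (Merge (N - (size A + size B)) (N - (size A + size Q))))
          (Tens (Split (size A + size Q + (size A + size B) - N) (N - (size A + size B))) (Id [N - (size A + size Q)])))))
    (Comp (Split (size A + size B) (N - (size A + size B))) (Merge (size A + size Q) (N - (size A + size Q))))"
    by (rule sc_relation.square_greater) (use pos in \<open>auto simp: N_def\<close>)
  then have sq: "sc_relation (Comp (Tens (mrg A B) (Id (sizes [Q]))) (Comp ?k3 (Comp ?k2 ?k1)))
    (Comp (spl (A + B) Q) (mrg (A + Q) B))"
    by (simp add: N_def)
  have "heq (Comp (Tens (mrg A B) (Id (sizes [Q]))) (Comp ?k3 (Comp ?k2 ?k1)))
    (Comp (spl (A + B) Q) (mrg (A + Q) B))"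
    by (rule heq.rel[OF sq]) (simp add: algebra_simps)
  with h1 h2 have "heq (Comp (within s (Tens (mrg A B) (Id (sizes [Q]))) t) u1)
    (Comp (within s (spl (A + B) Q) t) u2)"
    using u by (intro join[OF IH x, of u1 s "[A, B, Q]" t u2 "[A + B + Q]" _ "[A + Q, B]"]) (auto simp: ac_simps)
  moreover have "heq (Comp (within s (mrg A B) ([Q] @ t)) u1)
     (Comp (within s (Tens (mrg A B) (Id (sizes [Q]))) t) u1)"
    using u g x by (intro heq_layer_left[of _ x u1 s "[A, B]" "[Q]" t]) (auto simp: size_pos)
  ultimately show ?thesis using heq.sym heq.trans by blast
qed

text \<open>The mirror image: the row \<open>A + B\<close> ends a merge and is the right leg of
  a split, and the other square relation applies.\<close>

lemma join_split_merge:
  assumes IH: "unique_below n x"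
    and x: "x \<in> objects"
    and u: "reduced x u1 (s @ [P + (A + B)] @ t)" "reduced x u2 (s @ [P, A, B] @ t)" "deg u1 < n" "deg u2 < n"
    and g: "A \<noteq> {#}" "B \<noteq> {#}" "P \<noteq> {#}" "before A B" "not_after (A + B) P"
  shows "heq (Comp (within s (spl P (A + B)) t) u1)
    (Comp (within (s @ [P]) (mrg A B) t) u2)"
proof -
  have o: "not_after A P" "not_after B P" "before A P"
    using g order_trans_rows(2)[of B A P] by (auto simp: not_after_add_left)
  let ?k1 = "Tens (Id (sizes [A])) (spl P B)"
  let ?k2 = "Tens (mrg A P) (Id (sizes [B]))"
  let ?k3 = "Tens (spl P A) (Id (sizes [B]))"
  have k1: "moves ?k1 ([A] @ [P + B]) ([A] @ [P, B])"
    using g o by (intro moves.right move.split) auto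
  have k2: "moves ?k2 ([A, P] @ [B]) ([A + P] @ [B])"
    using g o by (intro moves.left move.merge) auto
  have k3: "moves ?k3 ([P + A] @ [B]) ([P, A] @ [B])"
    using g o by (intro moves.left move.split) auto
  have h2: "moves (Comp ?k3 (Comp ?k2 ?k1)) [A, P + B] [P, A, B]"
    using k1 k2 k3 by (intro moves.comp[of _ _ "[A + P, B]"] moves.comp[of _ _ "[A, P, B]"]) (auto simp: add.commute)
  have h1: "moves (mrg A (P + B)) [A, P + B] [A + (P + B)]"
    using g o by (intro moves.plain move.merge) (auto simp: before_add_right)
  have pos: "1 \<le> size A" "1 \<le> size B" "1 \<le> size P" using g size_pos by auto
  \<comment> \<open>The square relation is used with total thickness \<open>N\<close>, bottom
    left label \<open>size A\<close> and top left label \<open>size P\<close>.\<close>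
  define N where "N = size A + size B + size P"
  have "sc_relation
    (Comp (Tens (Id [size P]) (Merge (size A) (N - size A - size P)))
      (Comp (Tens (spl P A) (Id [N - size A - size P]))
        (Comp (Tens (mrg A P) (Id [N - size A - size P]))
          (Tens (Id [size A]) (Split (size P) (N - size A - size P))))))
    (Comp (Split (size P) (N - size P)) (Merge (size A) (N - size A)))"
    by (rule sc_relation.square_less) (use pos in \<open>auto simp: N_def\<close>)
  moreover have "N - size A - size P = size B" "N - size P = size (A + B)" "N - size A = size (P + B)"
    by (auto simp: N_def)
  ultimately have sq: "sc_relation (Comp (Tens (Id (sizes [P])) (mrg A B)) (Comp ?k3 (Comp ?k2 ?k1)))
    (Comp (spl P (A + B)) (mrg A (P + B)))"
    by simp
  have "heq (Comp (spl P (A + B)) (mrg A (P + B)))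
    (Comp (Tens (Id (sizes [P])) (mrg A B)) (Comp ?k3 (Comp ?k2 ?k1)))"
    by (rule heq.sym[OF heq.rel[OF sq]]) (simp add: algebra_simps)
  with h1 h2 have "heq (Comp (within s (spl P (A + B)) t) u1)
    (Comp (within s (Tens (Id (sizes [P])) (mrg A B)) t) u2)"
    using u by (intro join[OF IH x, of u1 s "[P + (A + B)]" t u2 "[P, A, B]" _ "[A, P + B]"]) (auto simp: ac_simps)
  moreover have "heq (Comp (within (s @ [P]) (mrg A B) t) u2)
     (Comp (within s (Tens (Id (sizes [P])) (mrg A B)) t) u2)"
    using u g x by (intro heq_layer_right[of _ x u2 s "[P]" "[A, B]" t]) (auto simp: size_pos)
  ultimately show ?thesis using heq.sym heq.trans by blast
qed

lemma append_cases:
  assumes "s1 @ \<tau>1 @ t1 = s2 @ \<tau>2 @ t2" "length s1 \<le> length s2"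
  obtains m where "s2 = s1 @ \<tau>1 @ m" "t1 = m @ \<tau>2 @ t2"
  | m r where "\<tau>1 = m @ r" "r \<noteq> []" "s2 = s1 @ m" "r @ t1 = \<tau>2 @ t2"
proof -
  have prefix: "\<exists>m. b = a @ m \<and> c = m @ d" if "a @ c = b @ d" "length a \<le> length b" for a b c d :: "'a list"
    using that by (auto simp: append_eq_append_conv2)
  obtain m where m: "s2 = s1 @ m" "\<tau>1 @ t1 = m @ \<tau>2 @ t2"
    using prefix[OF assms] by blast
  show ?thesis
  proof (cases "length \<tau>1 \<le> length m")
    case True
    from prefix[OF m(2) this] m(1) that(1) show ?thesis by auto
  next
    case False
    then obtain r where "\<tau>1 = m @ r" "\<tau>2 @ t2 = r @ t1"
      using prefix[OF m(2)[symmetric]] by auto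
    with m(1) False that(2)[of m r] show ?thesis by auto
  qed
qed

lemma join_any:
  assumes IH: "unique_below n x"
    and x: "x \<in> objects"
    and u: "reduced x u1 (s1 @ \<sigma>1 @ t1)" "reduced x u2 (s2 @ \<sigma>2 @ t2)" "deg u1 < n" "deg u2 < n"
    and g: "move g1 \<sigma>1 \<tau>1" "move g2 \<sigma>2 \<tau>2"
    and e: "s1 @ \<tau>1 @ t1 = s2 @ \<tau>2 @ t2" "length s1 \<le> length s2"
  shows "heq (Comp (within s1 g1 t1) u1) (Comp (within s2 g2 t2) u2)"
  using e
proof (cases rule: append_cases)
  case (1 m)
  then show ?thesis using join_apart[OF IH x, of u1 s1 \<sigma>1 m \<tau>2 t2 u2 \<tau>1 \<sigma>2 g1 g2] u g by simp
next
  case (2 m r)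
  have same: ?thesis if "\<sigma>1 = \<sigma>2" "s1 = s2" "t1 = t2" "g1 = g2"
  proof -
    have "heq u1 u2" using unique_belowD[OF IH u(3)] u that by simp
    then show ?thesis using reduced_props[OF u(1) x] move_props[OF g(1)]
      unfolding that(2-4)[symmetric]
      by (intro heq.comp[OF heq.refl]) (auto simp: objects_sizes_iff valid_def)
  qed
  from g(1) show ?thesis
  proof cases
    case (merge A B)
    then have m: "m = []" "r = [A + B]" using 2 by (auto simp: append_eq_Cons_conv)
    from g(2) show ?thesis
    proof cases
      case m2: (merge A' B')
      have e': "A + B = A' + B'" "s1 = s2" "t1 = t2" using 2 m m2 by auto
      show ?thesis
      proof (cases "size A \<le> size A'")
        case True
        then show ?thesis using join_merge_merge[OF IH x, of u1 s1 A B t1 u2 A' B'] u merge m2 e' by simp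
      next
        case False
        then have "heq (Comp (within s2 g2 t2) u2) (Comp (within s1 g1 t1) u1)"
          using join_merge_merge[OF IH x, of u2 s1 A' B' t1 u1 A B] u merge m2 e' by simp
        then show ?thesis by (rule heq.sym)
      qed
    next
      case s2: (split P Q)
      have e': "P = A + B" "s1 = s2" "t1 = Q # t2" using 2 m s2 by auto
      then show ?thesis using join_merge_split[OF IH x, of u1 s1 A B Q t2 u2] u merge s2 by simp
    qed
  next
    case (split P Q)
    then consider "m = []" "r = [P, Q]" | "m = [P]" "r = [Q]" using 2 by (auto simp: append_eq_Cons_conv)
    then show ?thesis
    proof cases
      case m: 1
      from g(2) show ?thesis
      proof cases
        case m2: (merge A B)
        have e': "P = A + B" "s1 = s2" "t2 = Q # t1" using 2 m m2 by auto
        then have "heq (Comp (within s2 g2 t2) u2) (Comp (within s1 g1 t1) u1)"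
          using join_merge_split[OF IH x, of u2 s1 A B Q t1 u1] u split m2 by simp
        then show ?thesis by (rule heq.sym)
      next
        case s2: (split P' Q')
        then show ?thesis using 2 m split by (intro same) auto
      qed
    next
      case m: 2
      from g(2) show ?thesis
      proof cases
        case m2: (merge A B)
        have e': "Q = A + B" "s2 = s1 @ [P]" "t2 = t1" using 2 m m2 by auto
        then show ?thesis using join_split_merge[OF IH x, of u1 s1 P A B t1 u2] u split m2 by simp
      next
        case s2: (split P' Q')
        have e': "P' = Q" "s2 = s1 @ [P]" "t1 = Q' # t2" using 2 m s2 by auto
        then show ?thesis using join_split_split[OF IH x, of u1 s1 P Q Q' t2 u2] u split s2 by simp
      qed
    qed
  qed
qed

text \<open>Matsumoto's argument: by induction on the degree, the last vertices of the two webs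
  are compared. Any two possible last vertices are either far apart, equal, or the last vertices
  of the two sides of a relation.\<close>

theorem reduced_unique:
  assumes "reduced x u s" "reduced x v s" "x \<in> objects"
  shows "heq u v"
  using assms
proof (induction "deg u" arbitrary: u v s rule: less_induct)
  case less
  have eq: "deg u = deg v"
    using reduced_props(5)[OF less.prems(1,3)] reduced_props(5)[OF less.prems(2,3)] by simp
  from less.prems(1) show ?case
  proof cases
    case Id
    from less.prems(2) show ?thesis
    proof cases
      case Id': Id
      then show ?thesis using Id less.prems(3) by (auto intro: heq.refl)
    next
      case (layer u2 s2 \<sigma>2 t2 g2 \<tau>2)
      then show ?thesis using Id eq move_props(8)[OF layer(4)] by simp
    qed
  next
    case u: (layer u1 s1 \<sigma>1 t1 g1 \<tau>1)
    from less.prems(2) show ?thesis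
    proof cases
      case Id
      then show ?thesis using u eq move_props(8)[OF u(4)] by simp
    next
      case v: (layer u2 s2 \<sigma>2 t2 g2 \<tau>2)
      have d: "deg u1 < deg u" "deg u2 < deg u"
        using u v eq move_props(8)[OF u(4)] move_props(8)[OF v(4)] by auto
      have IH: "unique_below (deg u) x"
        unfolding unique_below_def using less by blast
      have "s1 @ \<tau>1 @ t1 = s2 @ \<tau>2 @ t2" using u v by simp
      then consider "length s1 \<le> length s2" | "length s2 \<le> length s1" by linarith
      then show ?thesis
      proof cases
        case 1
        then show ?thesis using join_any[OF IH less.prems(3) u(3) v(3) d u(4) v(4)] u v by simp
      next
        case 2
        then show ?thesis using join_any[OF IH less.prems(3) v(3) u(3) d(2,1) v(4) u(4)] u v heq.sym by simp
      qed
    qed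
  qed
qed

text \<open>By uniqueness, a reduced web may be assumed to end with any moves that lead to its
  state. A relation can then be applied to these moves and to a further web \<open>G\<close> on
  top.\<close>

lemma reduced_rewrite_top:
  assumes "reduced x u (s @ \<tau> @ t)" "x \<in> objects" "moves h \<sigma> \<tau>" "heq (Comp G h) G'"
  obtains z where "reduced x z (s @ \<sigma> @ t)" "heq (Comp (within s G t) u) (Comp (within s G' t) z)"
proof -
  note up = reduced_props[OF assms(1,2)] and l = moves_props[OF assms(3)] and G = heq_wf_src_tgt[OF assms(4)]
  have "valid x (s @ \<sigma> @ t)" using up l by (auto simp: valid_def)
  then obtain z where z: "reduced x z (s @ \<sigma> @ t)" using reduced_exists assms(2) by blast
  note zp = reduced_props[OF z assms(2)]
  have o: "sizes s \<in> objects" "sizes t \<in> objects" using up by (auto simp: valid_def objects_sizes_iff)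
  obtain z' where z': "reduced x z' (s @ \<tau> @ t)" "heq (Comp (within s h t) z) z'"
    using reduced_moves[OF assms(3) z assms(2)] by blast
  have "heq u (Comp (within s h t) z)"
    using reduced_unique[OF assms(1) z'(1) assms(2)] z'(2) heq.sym heq.trans by blast
  then have "heq (Comp (within s G t) u) (Comp (within s G t) (Comp (within s h t) z))"
    using up l G o by (intro heq_comp_right) auto
  also have "heq \<dots> (Comp (within s (Comp G h) t) z)"
    using zp l G by (intro heq_whisker_comp_comp) auto
  also have "heq \<dots> (Comp (within s G' t) z)"
    using assms(4) zp l G o by (intro heq_comp_left heq_whisker) auto
  finally show ?thesis using that z by blast
qed

section \<open>Non-reduced webs\<close>

lemma degenerate_whisker: "degenerate g \<Longrightarrow> p \<in> objects \<Longrightarrow> r \<in> objects \<Longrightarrow> degenerate (whisker p g r)"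
  unfolding whisker_def by (intro degenerate.tens_left degenerate.tens_right) auto

text \<open>If every label in \<open>B\<close> is at most every label in \<open>A\<close>, then
  the state can be reached by splitting \<open>A + B\<close>, so the merge sits on a split.
  Otherwise one of the rows contains two different labels and is itself a merge; associativity
  then moves the piece that is in the correct order out of the way, and what remains is a
  smaller instance.\<close>

lemma degenerate_merge:
  assumes "reduced x u (s @ [A, B] @ t)" "x \<in> objects" "\<not> before A B"
  shows "degenerate (Comp (within s (mrg A B) t) u)"
  using assms
proof (induction "size A + size B" arbitrary: u s A B t rule: less_induct)
  case less
  note up = reduced_props[OF less.prems(1,2)]
  have ne: "A \<noteq> {#}" "B \<noteq> {#}" using up by (auto simp: valid_def)
  have o: "sizes s \<in> objects" "sizes t \<in> objects"
    using up by (auto simp: valid_def objects_sizes_iff)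
  obtain a b where ab: "a \<in># A" "b \<in># B" "b \<le> a" using less.prems(3) by (auto simp: before_def not_less)
  consider "not_after B A" | a' where "a' \<in># A" "a' < a" | b' where "b' \<in># B" "b < b'"
  proof (cases "not_after B A")
    case False
    then obtain a' b' where "a' \<in># A" "b' \<in># B" "a' < b'" by (auto simp: not_after_def not_le)
    then show ?thesis using that ab by (metis linorder_neqE_nat not_le order_less_trans)
  qed (use that in blast)
  then show ?case
  proof cases
    case 1
    have pos: "size A \<ge> 1" "size B \<ge> 1" using ne by (auto simp: Suc_le_eq nonempty_has_size)
    have "heq (Comp (mrg A B) (spl A B)) (Comp (mrg A B) (spl A B))" using pos by (intro heq.refl) auto
    from reduced_rewrite_top[OF less.prems(1,2) moves.plain[OF move.split[OF ne 1]] this]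
    obtain z where z: "reduced x z (s @ [A + B] @ t)"
      "heq (Comp (within s (mrg A B) t) u) (Comp (within s (Comp (mrg A B) (spl A B)) t) z)" .
    show ?thesis
      by (rule degenerate.heq[OF z(2)])
        (use reduced_props[OF z(1) less.prems(2)] o pos in \<open>auto intro!: degenerate.comp_right degenerate_whisker degenerate.bigon\<close>)
  next
    case (2 a')
    then obtain A1 A2 where A: "A = A1 + A2" "before A1 A2" "a' \<in># A1" "a \<in># A2"
      using filter_before[of a' A a] ab by blast
    then have ne': "A1 \<noteq> {#}" "A2 \<noteq> {#}" by auto
    then have pos: "size A1 \<ge> 1" "size A2 \<ge> 1" "size B \<ge> 1" using ne by (auto simp: Suc_le_eq nonempty_has_size)
    \<comment> \<open>The labels of \<open>A2\<close> include \<open>a\<close>, so the pair of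
      \<open>A2\<close> and \<open>B\<close> is still out of order.\<close>
    let ?g = "Merge (size A1) (size A2 + size B)" and ?h = "Tens (Id (sizes [A1])) (mrg A2 B)"
    have l: "moves (Tens (mrg A1 A2) (Id (sizes [B]))) [A1, A2, B] [A, B]"
      using moves.left[OF move.merge[OF ne' A(2)], of "[B]"] ne A(1) by simp
    have e: "heq (Comp (mrg A B) (Tens (mrg A1 A2) (Id (sizes [B])))) (Comp ?g ?h)"
      using assoc_relation.assoc[of "size A1" "size A2" "size B"] pos A by (intro heq_assoc) auto
    from reduced_rewrite_top[OF less.prems(1,2) l e] obtain z where z: "reduced x z (s @ [A1, A2, B] @ t)"
      "heq (Comp (within s (mrg A B) t) u) (Comp (within s (Comp ?g ?h) t) z)" .
    note zp = reduced_props[OF z(1) less.prems(2)]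
    have "reduced x z ((s @ [A1]) @ [A2, B] @ t)" using z(1) by simp
    moreover have "size A2 + size B < size A + size B" "\<not> before A2 B"
      using A ab pos by (auto simp: before_def not_less)
    ultimately have "degenerate (Comp (within (s @ [A1]) (mrg A2 B) t) z)"
      using less.hyps less.prems(2) by blast
    moreover have "heq (Comp (within s ?h t) z) (Comp (within (s @ [A1]) (mrg A2 B) t) z)"
      using z(1) pos less.prems by (intro heq.sym[OF heq_layer_right[of _ x z s "[A1]" "[A2, B]" t]]) auto
    ultimately have "degenerate (Comp (within s ?g t) (Comp (within s ?h t) z))"
      using o pos zp by (intro degenerate.comp_left degenerate.heq[of "Comp (within s ?h t) z"]) auto
    moreover have "heq (Comp (within s (mrg A B) t) u) (Comp (within s ?g t) (Comp (within s ?h t) z))"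
      by (rule heq.trans[OF z(2) heq.sym[OF heq_whisker_comp_comp]]) (use o pos zp in auto)
    ultimately show ?thesis using degenerate.heq by blast
  next
    case (3 b')
    then obtain B1 B2 where A: "B = B1 + B2" "before B1 B2" "b \<in># B1" "b' \<in># B2"
      using filter_before[of b B b'] ab by blast
    then have ne': "B1 \<noteq> {#}" "B2 \<noteq> {#}" by auto
    then have pos: "size B1 \<ge> 1" "size B2 \<ge> 1" "size A \<ge> 1" using ne by (auto simp: Suc_le_eq nonempty_has_size)
    \<comment> \<open>Likewise \<open>B1\<close> contains \<open>b\<close>.\<close>
    let ?g = "Merge (size A + size B1) (size B2)" and ?h = "Tens (mrg A B1) (Id (sizes [B2]))"
    have l: "moves (Tens (Id (sizes [A])) (mrg B1 B2)) [A, B1, B2] [A, B]"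
      using moves.right[OF move.merge[OF ne' A(2)], of "[A]"] ne A(1) by simp
    have e: "heq (Comp (mrg A B) (Tens (Id (sizes [A])) (mrg B1 B2))) (Comp ?g ?h)"
      using assoc_relation.assoc[of "size A" "size B1" "size B2"] pos A by (intro heq.sym[OF heq_assoc]) auto
    from reduced_rewrite_top[OF less.prems(1,2) l e] obtain z where z: "reduced x z (s @ [A, B1, B2] @ t)"
      "heq (Comp (within s (mrg A B) t) u) (Comp (within s (Comp ?g ?h) t) z)" .
    note zp = reduced_props[OF z(1) less.prems(2)]
    have "reduced x z (s @ [A, B1] @ ([B2] @ t))" using z(1) by simp
    moreover have "size A + size B1 < size A + size B" "\<not> before A B1"
      using A ab pos by (auto simp: before_def not_less)
    ultimately have "degenerate (Comp (within s (mrg A B1) ([B2] @ t)) z)"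
      using less.hyps less.prems(2) by blast
    moreover have "heq (Comp (within s ?h t) z) (Comp (within s (mrg A B1) ([B2] @ t)) z)"
      using z(1) pos less.prems by (intro heq.sym[OF heq_layer_left[of _ x z s "[A, B1]" "[B2]" t]]) auto
    ultimately have "degenerate (Comp (within s ?g t) (Comp (within s ?h t) z))"
      using o pos zp by (intro degenerate.comp_left degenerate.heq[of "Comp (within s ?h t) z"]) auto
    moreover have "heq (Comp (within s (mrg A B) t) u) (Comp (within s ?g t) (Comp (within s ?h t) z))"
      by (rule heq.trans[OF z(2) heq.sym[OF heq_whisker_comp_comp]]) (use o pos zp in auto)
    ultimately show ?thesis using degenerate.heq by blast
  qed
qed

lemma sorted_cut:
  fixes A :: "'a::linorder multiset"
  assumes "n \<le> size A"
  shows "\<exists>B C. A = B + C \<and> size C = n \<and> (\<forall>c\<in>#C. \<forall>b\<in>#B. c \<le> b)"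
proof -
  let ?l = "sorted_list_of_multiset A"
  have "A = mset (drop n ?l) + mset (take n ?l)"
    by (metis append_take_drop_id add.commute mset_append mset_sorted_list_of_multiset)
  moreover have "size (mset (take n ?l)) = n"
    using assms by (metis length_take min.absorb2 mset_sorted_list_of_multiset size_mset)
  moreover have "\<forall>c\<in>set (take n ?l). \<forall>b\<in>set (drop n ?l). c \<le> b"
    using sorted_sorted_list_of_multiset[of A] by (metis append_take_drop_id sorted_append)
  ultimately show ?thesis by (intro exI[of _ "mset (drop n ?l)"] exI[of _ "mset (take n ?l)"]) auto
qed

lemma sizes_eq_append:
  assumes "sizes s = p @ q @ r"
  obtains s1 \<sigma> s2 where "s = s1 @ \<sigma> @ s2" "sizes s1 = p" "sizes \<sigma> = q" "sizes s2 = r"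
proof -
  obtain s1 s' where 1: "s = s1 @ s'" "sizes s1 = p" "sizes s' = q @ r"
    using assms[unfolded map_eq_append_conv] by metis
  obtain \<sigma> s2 where "s' = \<sigma> @ s2" "sizes \<sigma> = q" "sizes s2 = r"
    using 1(3)[unfolded map_eq_append_conv] by metis
  with 1 that show ?thesis by blast
qed

lemma path_degenerate_or_reduced:
  assumes "path x u" "x \<in> objects"
  shows "degenerate u \<or> (\<exists>s. reduced x u s)"
  using assms
proof (induction rule: path.induct)
  case Id
  then show ?case using reduced.Id by blast
next
  case (layer u g p r)
  note u = path_well_formed[OF layer.hyps(1) layer.prems]
  then have "tgt u \<in> objects" using src_tgt_objects by blast
  then have "p @ src g @ r \<in> objects" unfolding layer.hyps(3) .
  then have o: "p \<in> objects" "r \<in> objects" by auto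
  show ?case
  proof (cases "degenerate u")
    case True
    then show ?thesis using o layer.hyps generator_well_formed by (auto intro!: degenerate.comp_left)
  next
    case False
    then obtain s where s: "reduced x u s" using layer by blast
    note sp = reduced_props[OF s layer.prems]
    obtain s1 \<sigma> s2 where s': "s = s1 @ \<sigma> @ s2" "sizes s1 = p" "sizes \<sigma> = src g" "sizes s2 = r"
      using sizes_eq_append[of s p "src g" r] sp layer.hyps by auto
    from layer.hyps(2) show ?thesis
    proof cases
      case (1 a b)
      then obtain A B where \<sigma>: "\<sigma> = [A, B]" "size A = a" "size B = b"
        using s'(3) by (auto simp: map_eq_Cons_conv)
      have "A \<noteq> {#}" "B \<noteq> {#}" using \<sigma> 1 by auto
      then show ?thesis
        using degenerate_merge[of x u s1 A B s2] reduced.layer[of x u s1 \<sigma> s2 g "[A + B]"] move.merge[of A B] s s' \<sigma> 1 layer.prems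
        by (cases "before A B") auto
    next
      case (2 a b)
      then obtain C where \<sigma>: "\<sigma> = [C]" "size C = a + b"
        using s'(3) by (auto simp: map_eq_Cons_conv)
      then obtain A B where C: "C = A + B" "size B = b" "not_after B A"
        using sorted_cut[of b C] by (auto simp: not_after_def)
      have "A \<noteq> {#}" "B \<noteq> {#}" "size A = a" using \<sigma> 2 C by auto
      then have "reduced x (Comp (whisker p g r) u) (s1 @ [A, B] @ s2)"
        using reduced.layer[of x u s1 \<sigma> s2 g "[A, B]"] move.split[of A B] s s' \<sigma> 2 C by simp
      then show ?thesis by blast
    qed
  qed
qed

section \<open>Reachable states and the classes of \<open>SC_Webs\<close>\<close>

text \<open>The states to which a web can lead if every split distributes the units of its
  strand arbitrarily.\<close>

primrec reach :: "web \<Rightarrow> state \<Rightarrow> state \<Rightarrow> bool" where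
  "reach (Id x) s t \<longleftrightarrow> sizes s = x \<and> t = s"
| "reach (Merge a b) s t \<longleftrightarrow> (\<exists>A B. s = [A, B] \<and> t = [A + B] \<and> size A = a \<and> size B = b)"
| "reach (Split a b) s t \<longleftrightarrow> (\<exists>A B. s = [A + B] \<and> t = [A, B] \<and> size A = a \<and> size B = b)"
| "reach (Comp g f) s t \<longleftrightarrow> (\<exists>r. reach f s r \<and> reach g r t)"
| "reach (Tens f g) s t \<longleftrightarrow> (\<exists>s1 s2 t1 t2. s = s1 @ s2 \<and> t = t1 @ t2 \<and> reach f s1 t1 \<and> reach g s2 t2)"

lemma reach_props:
  "reach w s t \<Longrightarrow> well_formed w \<Longrightarrow>
    sizes s = src w \<and> sizes t = tgt w \<and> sum_list s = sum_list t \<and> cost t \<le> cost s + 2 * deg w"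
proof (induction w arbitrary: s t)
  case (Merge a b)
  then show ?case using cost_merge_le by auto
next
  case (Split a b)
  then show ?case using cost_split_le by auto
next
  case (Comp g f)
  then obtain r where "reach f s r" "reach g r t" by auto
  with Comp show ?case by fastforce
next
  case (Tens f g)
  then obtain s1 s2 t1 t2 where "s = s1 @ s2" "t = t1 @ t2" "reach f s1 t1" "reach g s2 t2" by auto
  with Tens.IH(1)[of s1 t1] Tens.IH(2)[of s2 t2] Tens.prems show ?case by (auto simp: cost_append)
qed auto

lemma reach_whisker:
  "reach (whisker p g r) s t \<longleftrightarrow> (\<exists>s1 \<sigma> s2 \<tau>. s = s1 @ \<sigma> @ s2 \<and> t = s1 @ \<tau> @ s2 \<and>
    sizes s1 = p \<and> sizes s2 = r \<and> reach g \<sigma> \<tau>)"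
  unfolding whisker_def by (auto) blast+

lemma move_reach: "move g \<sigma> \<tau> \<Longrightarrow> reach g \<sigma> \<tau>"
  by (auto elim: move.cases)

lemma reduced_reach: "reduced x u s \<Longrightarrow> reach u (init x) s"
proof (induction rule: reduced.induct)
  case (layer u s \<sigma> t g \<tau>)
  then show ?case using move_reach by (fastforce simp: reach_whisker)
qed simp

text \<open>The cost can grow by twice the degree only if it does so at every vertex.\<close>

lemma path_geodesic_reduced:
  assumes "path x u" "x \<in> objects" "reach u (init x) s" "cost s = 2 * deg u"
  shows "reduced x u s"
  using assms
proof (induction arbitrary: s rule: path.induct)
  case Id
  then show ?case by (auto intro: reduced.Id)
next
  case (layer u g p r)
  note wf = path_well_formed[OF layer.hyps(1) layer.prems(1)] generator_well_formed[OF layer.hyps(2)]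
  from layer.prems(2) obtain m where m: "reach u (init x) m" "reach (whisker p g r) m s" by auto
  then obtain s1 \<sigma> s2 \<tau> where s: "m = s1 @ \<sigma> @ s2" "s = s1 @ \<tau> @ s2" "sizes s1 = p" "sizes s2 = r" "reach g \<sigma> \<tau>"
    unfolding reach_whisker by auto
  note g = reach_props[OF s(5) wf(2)]
  have u: "cost m \<le> 2 * deg u" using reach_props[OF m(1)] wf by simp
  have e: "cost s + cost \<sigma> = cost m + cost \<tau>" using cost_replace[of \<sigma> \<tau> s1 s2] g s by simp
  have c: "cost m = 2 * deg u" "cost \<tau> = cost \<sigma> + 2 * deg g" using e u g layer.prems(3) by auto
  have "move g \<sigma> \<tau>"
    using layer.hyps(2)
  proof cases
    case (1 a b)
    then obtain A B where "\<sigma> = [A, B]" "\<tau> = [A + B]" "size A = a" "size B = b" using s by auto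
    moreover from this 1 have "A \<noteq> {#}" "B \<noteq> {#}" by auto
    ultimately show ?thesis using c 1 move.merge[of A B] cost_merge_eq[of A B] by simp
  next
    case (2 a b)
    then obtain A B where "\<sigma> = [A + B]" "\<tau> = [A, B]" "size A = a" "size B = b" using s by auto
    moreover from this 2 have "A \<noteq> {#}" "B \<noteq> {#}" by auto
    ultimately show ?thesis using c 2 move.split[of A B] cost_split_eq[of A B] by simp
  qed
  moreover have "reduced x u m" using layer.IH layer.prems(1) m c by blast
  ultimately show ?case using reduced.layer s by blast
qed

lemma exists_submset_size:
  assumes "n \<le> size A"
  shows "\<exists>B. B \<subseteq># A \<and> size B = n"
proof -
  obtain xs where xs: "mset xs = A" by (metis ex_mset)
  then have "mset (take n xs) \<subseteq># A"
    by (metis append_take_drop_id mset_append mset_subset_eq_add_left)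
  moreover have "size (mset (take n xs)) = n" using xs assms by auto
  ultimately show ?thesis by blast
qed

text \<open>The pieces are \<open>A \<inter> S\<close>, \<open>A - S\<close>, \<open>S -
  A\<close>, and the rest.\<close>

lemma refinement:
  fixes A B S T :: "'a multiset"
  assumes "A + B = S + T"
  obtains AS AT BS BT where "A = AS + AT" "B = BS + BT" "S = AS + BS" "T = AT + BT"
proof
  show "A = (A \<inter># S) + (A - S)" by (simp add: multiset_eq_iff min_def)
  show "S = (A \<inter># S) + (S - A)" by (simp add: multiset_eq_iff min_def)
  show "B = (S - A) + (B - (S - A))" "T = (A - S) + (B - (S - A))"
  proof -
    have c: "count A i + count B i = count S i + count T i" for i
      using arg_cong[OF assms, of "\<lambda>M. count M i"] by simp
    then have "count B i = count S i - count A i + (count B i - (count S i - count A i))"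
      "count T i = count A i - count S i + (count B i - (count S i - count A i))" for i
      using c[of i] by linarith+
    then show "B = (S - A) + (B - (S - A))" "T = (A - S) + (B - (S - A))"
      by (auto simp: multiset_eq_iff)
  qed
qed

lemma structural_reach: "structural u v \<Longrightarrow> reach u s t = reach v s t"
proof (induction arbitrary: s t rule: structural.induct)
  case (comp_id_left f)
  then show ?case using reach_props by fastforce
next
  case (comp_id_right f)
  then show ?case using reach_props by fastforce
next
  case (tens_assoc f g h)
  show ?case
  proof
    assume "reach (Tens (Tens f g) h) s t"
    then obtain s1 s2 s3 t1 t2 t3 where "s = s1 @ (s2 @ s3)" "t = t1 @ (t2 @ t3)"
      "reach f s1 t1" "reach g s2 t2" "reach h s3 t3" by auto
    then show "reach (Tens f (Tens g h)) s t" unfolding reach.simps(5) by blast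
  next
    assume "reach (Tens f (Tens g h)) s t"
    then obtain s1 s2 s3 t1 t2 t3 where "s = (s1 @ s2) @ s3" "t = (t1 @ t2) @ t3"
      "reach f s1 t1" "reach g s2 t2" "reach h s3 t3" by auto
    then show "reach (Tens (Tens f g) h) s t" unfolding reach.simps(5) by blast
  qed
next
  case (tens_unit_left f)
  show ?case
  proof
    assume "reach f s t"
    moreover have "s = [] @ s" "t = [] @ t" "reach (Id []) [] []" by auto
    ultimately show "reach (Tens (Id []) f) s t" unfolding reach.simps(5) by blast
  qed auto
next
  case (tens_unit_right f)
  show ?case
  proof
    assume "reach f s t"
    moreover have "s = s @ []" "t = t @ []" "reach (Id []) [] []" by auto
    ultimately show "reach (Tens f (Id [])) s t" unfolding reach.simps(5) by blast
  qed auto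
next
  case (tens_id x y)
  show ?case by simp (metis map_append map_eq_append_conv)
next
  case (interchange g f g' f')
  show ?case
  proof
    assume "reach (Tens (Comp g f) (Comp g' f')) s t"
    then show "reach (Comp (Tens g g') (Tens f f')) s t" by simp metis
  next
    assume "reach (Comp (Tens g g') (Tens f f')) s t"
    then obtain s1 s2 r1 r2 r1' r2' t1 t2 where r: "s = s1 @ s2" "r1 @ r2 = r1' @ r2'" "t = t1 @ t2"
      "reach f s1 r1" "reach f' s2 r2" "reach g r1' t1" "reach g' r2' t2" unfolding reach.simps by metis
    have "length r1 = length r1'"
      using reach_props[OF r(4)] reach_props[OF r(6)] interchange by (metis length_map well_formed.simps(4,5))
    then have "r1 = r1'" "r2 = r2'" using r by auto
    then show "reach (Tens (Comp g f) (Comp g' f')) s t" using r unfolding reach.simps by blast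
  qed
qed auto

lemma reach_Id_Tens:
  "reach (Tens (Id [a]) g) s t \<longleftrightarrow> (\<exists>A s' t'. s = A # s' \<and> t = A # t' \<and> size A = a \<and> reach g s' t')"
proof
  assume "reach (Tens (Id [a]) g) s t"
  then obtain s1 s2 t2 where "s = s1 @ s2" "t = s1 @ t2" "sizes s1 = [a]" "reach g s2 t2"
    unfolding reach.simps(1,5) by metis
  moreover from this obtain A where "s1 = [A]" "size A = a" by (auto simp: map_eq_Cons_conv)
  ultimately show "\<exists>A s' t'. s = A # s' \<and> t = A # t' \<and> size A = a \<and> reach g s' t'"
    by (metis append_Cons append_Nil)
next
  assume "\<exists>A s' t'. s = A # s' \<and> t = A # t' \<and> size A = a \<and> reach g s' t'"
  then obtain A s' t' where "s = A # s'" "t = A # t'" "size A = a" "reach g s' t'" by blast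
  then have "s = [A] @ s'" "t = [A] @ t'" "reach (Id [a]) [A] [A]" "reach g s' t'" by simp_all
  then show "reach (Tens (Id [a]) g) s t" unfolding reach.simps(5) by blast
qed

lemma reach_Tens_Id:
  "reach (Tens g (Id [c])) s t \<longleftrightarrow> (\<exists>C s' t'. s = s' @ [C] \<and> t = t' @ [C] \<and> size C = c \<and> reach g s' t')"
proof
  assume "reach (Tens g (Id [c])) s t"
  then obtain s1 s2 t1 where "s = s1 @ s2" "t = t1 @ s2" "sizes s2 = [c]" "reach g s1 t1"
    unfolding reach.simps(1,5) by metis
  moreover from this obtain C where "s2 = [C]" "size C = c" by (auto simp: map_eq_Cons_conv)
  ultimately show "\<exists>C s' t'. s = s' @ [C] \<and> t = t' @ [C] \<and> size C = c \<and> reach g s' t'" by metis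
next
  assume "\<exists>C s' t'. s = s' @ [C] \<and> t = t' @ [C] \<and> size C = c \<and> reach g s' t'"
  then obtain C s' t' where "s = s' @ [C]" "t = t' @ [C]" "size C = c" "reach g s' t'" by blast
  then have "s = s' @ [C]" "t = t' @ [C]" "reach (Id [c]) [C] [C]" "reach g s' t'" by simp_all
  then show "reach (Tens g (Id [c])) s t" unfolding reach.simps(5) by blast
qed

lemma assoc_relation_reach:
  assumes "assoc_relation u v"
  shows "reach u s t = reach v s t"
  using assms
proof cases
  case (assoc a b c)
  have "reach u s t \<longleftrightarrow> (\<exists>A B C. s = [A, B, C] \<and> t = [A + B + C] \<and> size A = a \<and> size B = b \<and> size C = c)"
    unfolding assoc reach.simps(4) reach_Tens_Id by auto
  moreover have "reach v s t \<longleftrightarrow> (\<exists>A B C. s = [A, B, C] \<and> t = [A + B + C] \<and> size A = a \<and> size B = b \<and> size C = c)"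
    unfolding assoc reach.simps(4) reach_Id_Tens by (auto simp: add.assoc)
  ultimately show ?thesis by simp
next
  case (coassoc a b c)
  have "reach u s t \<longleftrightarrow> (\<exists>A B C. s = [A + B + C] \<and> t = [A, B, C] \<and> size A = a \<and> size B = b \<and> size C = c)"
    unfolding coassoc reach.simps(4) reach_Tens_Id by auto
  moreover have "reach v s t \<longleftrightarrow> (\<exists>A B C. s = [A + B + C] \<and> t = [A, B, C] \<and> size A = a \<and> size B = b \<and> size C = c)"
    unfolding coassoc reach.simps(4) reach_Id_Tens by (auto simp: add.assoc)
  ultimately show ?thesis by simp
qed

lemma sizes_pair: "sizes s = [a, b] \<longleftrightarrow> (\<exists>A B. s = [A, B] \<and> size A = a \<and> size B = b)"
  by (auto simp: map_eq_Cons_conv)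

lemma reach_intros:
  "size A = a \<Longrightarrow> size B = b \<Longrightarrow> C = A + B \<Longrightarrow> reach (Merge a b) [A, B] [C]"
  "size A = a \<Longrightarrow> size B = b \<Longrightarrow> C = A + B \<Longrightarrow> reach (Split a b) [C] [A, B]"
  "size A = a \<Longrightarrow> reach g s t \<Longrightarrow> reach (Tens (Id [a]) g) (A # s) (A # t)"
  "size C = c \<Longrightarrow> reach g [A] t \<Longrightarrow> reach (Tens g (Id [c])) [A, C] (t @ [C])"
  "size C = c \<Longrightarrow> reach g [A, B] t \<Longrightarrow> reach (Tens g (Id [c])) [A, B, C] (t @ [C])"
      apply simp
     apply simp
    apply (simp only: reach_Id_Tens, blast)
   apply (simp only: reach_Tens_Id, rule exI[of _ C], rule exI[of _ "[A]"], rule exI[of _ t], simp)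
  apply (simp only: reach_Tens_Id, rule exI[of _ C], rule exI[of _ "[A, B]"], rule exI[of _ t], simp)
  done

lemma reach_merge_split:
  "reach (Comp (Split b b') (Merge a a')) s t \<longleftrightarrow>
    sizes s = [a, a'] \<and> sizes t = [b, b'] \<and> sum_list s = sum_list t"
proof
  assume "sizes s = [a, a'] \<and> sizes t = [b, b'] \<and> sum_list s = sum_list t"
  then obtain A A' B B' where st: "s = [A, A']" "size A = a" "size A' = a'" "t = [B, B']" "size B = b"
    "size B' = b'" "A + A' = B + B'" by (auto simp: sizes_pair)
  then have "reach (Merge a a') s [A + A']" "reach (Split b b') [A + A'] t" by (auto intro: reach_intros)
  then show "reach (Comp (Split b b') (Merge a a')) s t" unfolding reach.simps(4) by blast
qed auto

text \<open>Both sides of a square relation reach every state with the right row sizes and the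
  right units. The intermediate strand of the longer side has to carry a prescribed number of
  units; it is filled up with units \<open>Y\<close> that return to where they came
  from.\<close>

lemma sc_relation_reach:
  assumes "sc_relation u v"
  shows "reach u s t = reach v s t"
  using assms
proof cases
  case (bigon a b)
  have "\<exists>B C. A = B + C \<and> size B = a \<and> size C = b" if "size A = a + b" for A :: "nat multiset"
    using exists_submset_size[of a A] that
    by (metis diff_add_inverse le_add1 size_Diff_submset subset_mset.add_diff_inverse)
  then show ?thesis using bigon by (fastforce simp: map_eq_Cons_conv)
next
  case assoc
  then show ?thesis by (rule assoc_relation_reach)
next
  case (square_less a N b)
  note wf = sc_relation_parallel[OF assms]
  show ?thesis
  proof
    assume "reach u s t"
    then have "sizes s = src v \<and> sizes t = tgt v \<and> sum_list s = sum_list t"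
      using reach_props[of u s t] wf by argo
    then show "reach v s t" unfolding square_less(2) reach_merge_split by simp
  next
    assume "reach v s t"
    then have p: "sizes s = [a, N - a]" "sizes t = [b, N - b]" "sum_list s = sum_list t"
      unfolding square_less(2) reach_merge_split by auto
    then obtain A X S T where st: "s = [A, X]" "t = [S, T]" "size A = a" "size X = N - a"
      "size S = b" "size T = N - b" "A + X = S + T" by (auto simp: sizes_pair)
    obtain AS AT XS XT where d: "A = AS + AT" "X = XS + XT" "S = AS + XS" "T = AT + XT"
      using refinement[OF st(7)] .
    have sz: "size AS + size AT = a" "size XS + size XT = N - a" "size AS + size XS = b"
      "size AT + size XT = N - b" using st d by auto
    then have "size AS \<le> size XT" using square_less by linarith
    then obtain Y Z where Y: "XT = Y + Z" "size Y = size AS"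
      using exists_submset_size by (metis subset_mset.add_diff_inverse)
    let ?c = "N - a - b"
    have sz': "size Z = ?c" "size (XS + Y) = b" "size (AT + Y) = a" using sz Y square_less by auto
    have "reach (Tens (Id [a]) (Split b ?c)) [A, X] [A, XS + Y, Z]"
      using sz' st d Y by (intro reach_intros) (auto simp: add.assoc)
    moreover have "reach (Tens (Merge a b) (Id [?c])) [A, XS + Y, Z] ([A + (XS + Y)] @ [Z])"
      using sz' st d Y by (intro reach_intros) auto
    moreover have "A + (XS + Y) = S + (AT + Y)" using d by (simp add: ac_simps)
    then have "reach (Tens (Split b a) (Id [?c])) [A + (XS + Y), Z] ([S, AT + Y] @ [Z])"
      using sz' st d Y by (intro reach_intros) auto
    moreover have "reach (Tens (Id [b]) (Merge a ?c)) [S, AT + Y, Z] [S, T]"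
      using sz' st d Y by (intro reach_intros) (auto simp: ac_simps)
    ultimately show "reach u s t" unfolding square_less(1) st(1,2) by (simp only: reach.simps(4) append.simps) blast
  qed
next
  case (square_greater a N b)
  note wf = sc_relation_parallel[OF assms]
  show ?thesis
  proof
    assume "reach u s t"
    then have "sizes s = src v \<and> sizes t = tgt v \<and> sum_list s = sum_list t"
      using reach_props[of u s t] wf by argo
    then show "reach v s t" unfolding square_greater(2) reach_merge_split by simp
  next
    assume "reach v s t"
    then have p: "sizes s = [a, N - a]" "sizes t = [b, N - b]" "sum_list s = sum_list t"
      unfolding square_greater(2) reach_merge_split by auto
    then obtain A X S T where st: "s = [A, X]" "t = [S, T]" "size A = a" "size X = N - a"
      "size S = b" "size T = N - b" "A + X = S + T" by (auto simp: sizes_pair)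
    obtain AS AT XS XT where d: "A = AS + AT" "X = XS + XT" "S = AS + XS" "T = AT + XT"
      using refinement[OF st(7)] .
    have sz: "size AS + size AT = a" "size XS + size XT = N - a" "size AS + size XS = b"
      "size AT + size XT = N - b" using st d by auto
    then have "size XT \<le> size AS" using square_greater by linarith
    then obtain Y Z where Y: "AS = Y + Z" "size Y = size XT"
      using exists_submset_size by (metis subset_mset.add_diff_inverse)
    let ?c = "a + b - N"
    have sz': "size Z = ?c" "size (AT + Y) = N - b" "size (XS + Y) = N - a" using sz Y square_greater by auto
    have AZ: "A = Z + (AT + Y)" using d Y by (simp add: ac_simps)
    have "reach (Tens (Split ?c (N - b)) (Id [N - a])) [A, X] ([Z, AT + Y] @ [X])"
      using sz' st AZ by (intro reach_intros) auto
    moreover have "reach (Tens (Id [?c]) (Merge (N - b) (N - a))) [Z, AT + Y, X] [Z, (AT + Y) + X]"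
      using sz' st by (intro reach_intros) auto
    moreover have "(AT + Y) + X = (XS + Y) + T" using d by (simp add: ac_simps)
    then have "reach (Tens (Id [?c]) (Split (N - a) (N - b))) [Z, (AT + Y) + X] [Z, XS + Y, T]"
      using sz' st by (intro reach_intros) auto
    moreover have "S = Z + (XS + Y)" using d Y by (simp add: ac_simps)
    then have "reach (Tens (Merge ?c (N - a)) (Id [N - b])) [Z, XS + Y, T] ([S] @ [T])"
      using sz' st by (intro reach_intros) auto
    ultimately show "reach u s t" unfolding square_greater(1) st(1,2) by (simp only: reach.simps(4) append.simps) blast
  qed
qed

lemma sc_eq_reach: "sc_eq u v \<Longrightarrow> reach u s t = reach v s t"
proof (induction arbitrary: s t rule: sc_eq.induct)
  case (struct u v)
  then show ?case by (rule structural_reach)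
next
  case (rel u v)
  then show ?case by (rule sc_relation_reach)
qed auto

lemma geodesic_heq:
  assumes "well_formed w" "reach w (init (src w)) s" "cost s = 2 * deg w" "reduced (src w) u s"
  shows "heq w u"
proof -
  obtain v where v: "path (src w) v" "heq w v" using heq_path assms by blast
  have "reach v (init (src w)) s" using assms(2) sc_eq_reach[OF heq_sc_eq[OF v(2)]] by simp
  then have "reduced (src w) v s"
    using path_geodesic_reduced v assms heq_deg[OF v(2)] src_tgt_objects by simp
  then show ?thesis using reduced_unique[OF _ assms(4)] v(2) heq.trans assms(1) src_tgt_objects by blast
qed

lemma minimal_reduced:
  assumes "well_formed w" "\<And>v. sc_eq w v \<Longrightarrow> deg w \<le> deg v"
  obtains u s where "reduced (src w) u s" "heq w u"
proof -
  obtain v where v: "path (src w) v" "heq w v" using heq_path assms by blast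
  have "\<not> degenerate v"
  proof
    assume "degenerate v"
    then obtain v' where v': "sc_eq v v'" "deg v' < deg v" using degenerate_sc_eq_lower by blast
    then show False
      using assms(2)[of v'] heq_deg[OF v(2)] sc_eq.trans[OF heq_sc_eq[OF v(2)]] by auto
  qed
  then obtain s where "reduced (src w) v s" using path_degenerate_or_reduced v assms(1) src_tgt_objects by blast
  then show ?thesis using that v by blast
qed

text \<open>If \<open>w\<close> were related to a reduced web, then \<open>v\<close> would reach
  a state whose cost exceeds twice the degree of \<open>v\<close>.\<close>

lemma nonminimal_degenerate:
  assumes "well_formed w" "sc_eq w v" "deg v < deg w"
  shows "degenerate w"
proof -
  obtain u where u: "path (src w) u" "heq w u" using heq_path assms by blast
  have o: "src w \<in> objects" using assms src_tgt_objects by blast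
  have "\<not> reduced (src w) u s" for s
  proof
    assume r: "reduced (src w) u s"
    have "sc_eq u v" using heq_sc_eq[OF u(2)] assms sc_eq.sym sc_eq.trans by blast
    then have "reach v (init (src w)) s" using reduced_reach[OF r] sc_eq_reach by blast
    then have "cost s \<le> 2 * deg v"
      using reach_props[of v "init (src w)" s] sc_eq_parallel[OF assms(2)] by simp
    then show False using reduced_props(5)[OF r o] heq_deg[OF u(2)] assms by simp
  qed
  then have "degenerate u" using path_degenerate_or_reduced u o by blast
  then show ?thesis using degenerate.heq u by blast
qed

section \<open>Linear combinations of webs\<close>

definition smul :: "laurent \<Rightarrow> ('a \<Rightarrow>\<^sub>0 laurent) \<Rightarrow> ('a \<Rightarrow>\<^sub>0 laurent)"
  where "smul c = Poly_Mapping.map (\<lambda>d. c * d)"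

lemma scale_eq_smul: "scale c p = smul c p"
  by (simp add: scale_def smul_def)

lemma lookup_smul [simp]: "Poly_Mapping.lookup (smul c p) a = c * Poly_Mapping.lookup p a"
  by (simp add: smul_def Poly_Mapping.map.rep_eq when_def)

lemma smul_simps [simp]:
  "smul c (p + r) = smul c p + smul c r" "smul c 0 = 0" "smul 0 p = 0" "smul 1 p = p"
  "smul c (smul d p) = smul (c * d) p" "smul c (Poly_Mapping.single a d) = Poly_Mapping.single a (c * d)"
  "smul c (p - r) = smul c p - smul c r" "smul (- 1) p = - p"
  by (rule poly_mapping_eqI; simp add: lookup_add lookup_minus lookup_single when_def algebra_simps)+

lemma smul_sum: "smul c (sum f A) = (\<Sum>a\<in>A. smul c (f a))"
  by (induction A rule: infinite_finite_induct) auto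

lemma smul_add_left: "smul (c + d) p = smul c p + smul d p"
  by (rule poly_mapping_eqI) (simp add: lookup_add algebra_simps)

lemma keys_smul: "Poly_Mapping.keys (smul c p) \<subseteq> Poly_Mapping.keys p"
  by (auto simp: in_keys_iff)

definition lin_ext :: "('a \<Rightarrow> ('b \<Rightarrow>\<^sub>0 laurent)) \<Rightarrow> ('a \<Rightarrow>\<^sub>0 laurent) \<Rightarrow> ('b \<Rightarrow>\<^sub>0 laurent)"
  where "lin_ext g p = (\<Sum>a\<in>Poly_Mapping.keys p. smul (Poly_Mapping.lookup p a) (g a))"

lemma lin_ext_superset:
  assumes "finite A" "Poly_Mapping.keys p \<subseteq> A"
  shows "lin_ext g p = (\<Sum>a\<in>A. smul (Poly_Mapping.lookup p a) (g a))"
  unfolding lin_ext_def using assms by (intro sum.mono_neutral_left) (auto simp: in_keys_iff)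

lemma lin_ext_add [simp]: "lin_ext g (p + r) = lin_ext g p + lin_ext g r"
proof -
  let ?A = "Poly_Mapping.keys p \<union> Poly_Mapping.keys r"
  have "lin_ext g (p + r) = (\<Sum>a\<in>?A. smul (Poly_Mapping.lookup (p + r) a) (g a))"
    by (rule lin_ext_superset) (use Poly_Mapping.keys_add[of p r] in auto)
  also have "\<dots> = (\<Sum>a\<in>?A. smul (Poly_Mapping.lookup p a) (g a)) + (\<Sum>a\<in>?A. smul (Poly_Mapping.lookup r a) (g a))"
    by (simp add: lookup_add smul_add_left sum.distrib)
  also have "\<dots> = lin_ext g p + lin_ext g r"
    using lin_ext_superset[of ?A p g] lin_ext_superset[of ?A r g] by simp
  finally show ?thesis .
qed

lemma lin_ext_smul [simp]: "lin_ext g (smul c p) = smul c (lin_ext g p)"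
proof -
  have "lin_ext g (smul c p) = (\<Sum>a\<in>Poly_Mapping.keys p. smul (Poly_Mapping.lookup (smul c p) a) (g a))"
    by (rule lin_ext_superset) (use keys_smul[of c p] in auto)
  also have "\<dots> = smul c (lin_ext g p)" by (simp add: lin_ext_def smul_sum)
  finally show ?thesis .
qed

lemma lin_ext_zero [simp]: "lin_ext g 0 = 0"
  by (simp add: lin_ext_def)

lemma lin_ext_diff [simp]: "lin_ext g (p - r) = lin_ext g p - lin_ext g r"
  using lin_ext_add[of g "p - r" r] by (simp add: algebra_simps)

lemma lin_ext_single [simp]: "lin_ext g (Poly_Mapping.single a c) = smul c (g a)"
  by (cases "c = 0") (auto simp: lin_ext_def)

lemma poly_mapping_expand: "p = lin_ext (\<lambda>a. Poly_Mapping.single a 1) p"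
proof (rule poly_mapping_eqI)
  fix b
  show "Poly_Mapping.lookup p b = Poly_Mapping.lookup (lin_ext (\<lambda>a. Poly_Mapping.single a 1) p) b"
    by (simp add: lin_ext_def lookup_sum lookup_single when_def in_keys_iff)
qed

lemma poly_mapping_span_induct [consumes 1, case_names zero single add]:
  assumes "Poly_Mapping.keys p \<subseteq> S" "P 0" "\<And>a c. a \<in> S \<Longrightarrow> P (Poly_Mapping.single a c)"
    "\<And>p r. P p \<Longrightarrow> P r \<Longrightarrow> P (p + r)"
  shows "P (p :: 'a \<Rightarrow>\<^sub>0 laurent)"
proof -
  have "P (\<Sum>a\<in>A. Poly_Mapping.single a (Poly_Mapping.lookup p a))" if "finite A" "A \<subseteq> S" for A
    using that by (induction A rule: finite_induct) (auto intro: assms)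
  from this[of "Poly_Mapping.keys p"] have "P (lin_ext (\<lambda>a. Poly_Mapping.single a 1) p)"
    using assms(1) by (simp add: lin_ext_def)
  then show ?thesis using poly_mapping_expand[of p] by simp
qed

lemma bilinear_ext_left: "bilinear_ext h p r = lin_ext (\<lambda>a. lin_ext (\<lambda>b. Poly_Mapping.single (h a b) 1) r) p"
  by (simp add: bilinear_ext_def lin_ext_def smul_sum)

lemma bilinear_ext_right: "bilinear_ext h p r = lin_ext (\<lambda>b. lin_ext (\<lambda>a. Poly_Mapping.single (h a b) 1) p) r"
  unfolding bilinear_ext_def by (subst sum.swap) (simp add: lin_ext_def smul_sum mult.commute)

lemma bilinear_ext_simps [simp]:
  "bilinear_ext h (p + p') r = bilinear_ext h p r + bilinear_ext h p' r"
  "bilinear_ext h (p - p') r = bilinear_ext h p r - bilinear_ext h p' r"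
  "bilinear_ext h p (r + r') = bilinear_ext h p r + bilinear_ext h p r'"
  "bilinear_ext h p (r - r') = bilinear_ext h p r - bilinear_ext h p r'"
  "bilinear_ext h (smul c p) r = smul c (bilinear_ext h p r)"
  "bilinear_ext h p (smul c r) = smul c (bilinear_ext h p r)"
  "bilinear_ext h 0 r = 0" "bilinear_ext h p 0 = 0"
  "bilinear_ext h (Poly_Mapping.single a c) (Poly_Mapping.single b d) = Poly_Mapping.single (h a b) (c * d)"
          apply (simp only: bilinear_ext_left lin_ext_add)
         apply (simp only: bilinear_ext_left lin_ext_diff)
        apply (simp only: bilinear_ext_right lin_ext_add)
       apply (simp only: bilinear_ext_right lin_ext_diff)
      apply (simp only: bilinear_ext_left lin_ext_smul)
     apply (simp only: bilinear_ext_right lin_ext_smul)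
    apply (simp only: bilinear_ext_left lin_ext_zero)
   apply (simp only: bilinear_ext_right lin_ext_zero)
  apply (simp add: bilinear_ext_left)
  done

lemma bilinear_ext_of_web [simp]: "bilinear_ext h (of_web u) (of_web v) = of_web (h u v)"
  by (simp add: of_web_def)

section \<open>Lower terms in \<open>Webs_inf\<close>\<close>

text \<open>The bound is strict, so that the part below degree 0 is zero.\<close>

definition free_lt :: "nat \<Rightarrow> nat list \<Rightarrow> nat list \<Rightarrow> lin_web set"
  where "free_lt k x y = {p. Poly_Mapping.keys p \<subseteq> {w \<in> webs x y. deg w < k}}"

lemma free_lt_closed:
  "0 \<in> free_lt k x y" "p \<in> free_lt k x y \<Longrightarrow> r \<in> free_lt k x y \<Longrightarrow> p + r \<in> free_lt k x y"
  "p \<in> free_lt k x y \<Longrightarrow> smul c p \<in> free_lt k x y"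
  using Poly_Mapping.keys_add[of p r] keys_smul[of c p] by (auto simp: free_lt_def)

lemma free_lt_diff: "p \<in> free_lt k x y \<Longrightarrow> r \<in> free_lt k x y \<Longrightarrow> p - r \<in> free_lt k x y"
  using free_lt_closed(2)[of p k x y "smul (-1) r"] free_lt_closed(3)[of r k x y "-1"] by simp

lemma free_lt_sum: "(\<And>a. a \<in> A \<Longrightarrow> f a \<in> free_lt k x y) \<Longrightarrow> sum f A \<in> free_lt k x y"
  by (induction A rule: infinite_finite_induct) (auto intro: free_lt_closed)

lemma free_lt_of_web: "w \<in> webs x y \<Longrightarrow> deg w < k \<Longrightarrow> of_web w \<in> free_lt k x y"
  by (simp add: free_lt_def of_web_def)

lemma free_lt_mono: "p \<in> free_lt k x y \<Longrightarrow> k \<le> l \<Longrightarrow> p \<in> free_lt l x y"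
  by (auto simp: free_lt_def)

text \<open>The combinations whose image in \<open>Webs_inf\<close> lies in filtration degree
  less than \<open>k\<close>.\<close>

definition low :: "nat \<Rightarrow> nat list \<Rightarrow> nat list \<Rightarrow> lin_web \<Rightarrow> bool"
  where "low k x y p \<longleftrightarrow> (\<exists>r\<in>free_lt k x y. inf_ideal x y (p - r))"

lemma inf_ideal_diff: "inf_ideal x y p \<Longrightarrow> inf_ideal x y r \<Longrightarrow> inf_ideal x y (p - r)"
  using inf_ideal.add[of x y p "scale (-1) r"] inf_ideal.scale[of x y r "-1"] by (simp add: scale_eq_smul)

lemma inf_ideal_smul: "inf_ideal x y p \<Longrightarrow> inf_ideal x y (smul c p)"
  using inf_ideal.scale[of x y p c] by (simp add: scale_eq_smul)

lemma low_ideal: "inf_ideal x y p \<Longrightarrow> low k x y p"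
  unfolding low_def using free_lt_closed(1) by (intro bexI[of _ 0]) auto

lemma low_free: "p \<in> free_lt k x y \<Longrightarrow> low k x y p"
  unfolding low_def by (intro bexI[of _ p]) (auto intro: inf_ideal.zero)

lemma low_add: "low k x y p \<Longrightarrow> low k x y p' \<Longrightarrow> low k x y (p + p')"
proof -
  assume "low k x y p" "low k x y p'"
  then obtain r r' where "r \<in> free_lt k x y" "inf_ideal x y (p - r)" "r' \<in> free_lt k x y" "inf_ideal x y (p' - r')"
    unfolding low_def by blast
  then show ?thesis unfolding low_def
    using inf_ideal.add[of x y "p - r" "p' - r'"] by (intro bexI[of _ "r + r'"] free_lt_closed) (auto simp: algebra_simps)
qed

lemma low_smul: "low k x y p \<Longrightarrow> low k x y (smul c p)"
  unfolding low_def using inf_ideal_smul free_lt_closed(3) by (metis smul_simps(7))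

lemma low_zero: "low k x y 0"
  by (intro low_ideal inf_ideal.zero)

lemma low_diff: "low k x y p \<Longrightarrow> low k x y p' \<Longrightarrow> low k x y (p - p')"
  using low_add[of k x y p "smul (-1) p'"] low_smul[of k x y p' "-1"] by simp

lemma low_lin_ext: "(\<And>a. a \<in> Poly_Mapping.keys p \<Longrightarrow> low k x y (g a)) \<Longrightarrow> low k x y (lin_ext g p)"
proof -
  assume *: "\<And>a. a \<in> Poly_Mapping.keys p \<Longrightarrow> low k x y (g a)"
  have "low k x y (\<Sum>a\<in>A. smul (Poly_Mapping.lookup p a) (g a))" if "finite A" "A \<subseteq> Poly_Mapping.keys p" for A
    using that by (induction A rule: finite_induct) (auto intro: low_zero low_add low_smul *)
  then show ?thesis unfolding lin_ext_def by simp
qed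

lemma webs_Comp: "w \<in> webs y z \<Longrightarrow> v \<in> webs x y \<Longrightarrow> Comp w v \<in> webs x z"
  and webs_Tens: "w \<in> webs x y \<Longrightarrow> v \<in> webs x' y' \<Longrightarrow> Tens w v \<in> webs (x @ x') (y @ y')"
  by (auto simp: webs_def)

lemma free_lt_bilinear:
  assumes "p \<in> free_lt k x y" "r \<in> free_lt l x' y'"
    "\<And>w v. w \<in> webs x y \<Longrightarrow> v \<in> webs x' y' \<Longrightarrow> h w v \<in> webs x'' y'' \<and> deg (h w v) = deg w + deg v"
    "k + l \<le> Suc n"
  shows "bilinear_ext h p r \<in> free_lt n x'' y''"
  using assms(1)[unfolded free_lt_def, simplified]
proof (induction rule: poly_mapping_span_induct)
  case (single w a)
  show ?case
    using assms(2)[unfolded free_lt_def, simplified]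
  proof (induction rule: poly_mapping_span_induct)
    case s: (single v b)
    have "bilinear_ext h (Poly_Mapping.single w a) (Poly_Mapping.single v b) = smul (a * b) (of_web (h w v))"
      by (simp add: of_web_def)
    then show ?case using assms(3)[of w v] single s assms(4) by (auto intro!: free_lt_closed free_lt_of_web)
  qed (auto intro: free_lt_closed)
qed (auto intro: free_lt_closed)

lemma low_op:
  assumes "low k x y p" "\<And>r. inf_ideal x y r \<Longrightarrow> inf_ideal x' y' (h r)" "\<And>r. r \<in> free_lt k x y \<Longrightarrow> h r \<in> free_lt l x' y'"
    "\<And>r s. h (r - s) = h r - h s"
  shows "low l x' y' (h p)"
  using assms unfolding low_def by metis

lemma low_comp_left:
  assumes "low k x y p" "w \<in> webs y z"
  shows "low (deg w + k) x z (lin_comp (of_web w) p)"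
  by (rule low_op[OF assms(1)])
    (use assms in \<open>auto intro!: inf_ideal.comp_left free_lt_bilinear[OF free_lt_of_web[of w _ _ "Suc (deg w)"]] webs_Comp\<close>)

lemma low_comp_right:
  assumes "low k y z p" "w \<in> webs x y"
  shows "low (deg w + k) x z (lin_comp p (of_web w))"
  by (rule low_op[OF assms(1)])
    (use assms in \<open>auto intro!: inf_ideal.comp_right free_lt_bilinear[OF _ free_lt_of_web[of w _ _ "Suc (deg w)"]] webs_Comp\<close>)

lemma low_tens_left:
  assumes "low k x y p" "w \<in> webs x' y'"
  shows "low (deg w + k) (x' @ x) (y' @ y) (lin_tens (of_web w) p)"
  by (rule low_op[OF assms(1)])
    (use assms in \<open>auto intro!: inf_ideal.tens_left free_lt_bilinear[OF free_lt_of_web[of w _ _ "Suc (deg w)"]] webs_Tens\<close>)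

lemma low_tens_right:
  assumes "low k x y p" "w \<in> webs x' y'"
  shows "low (deg w + k) (x @ x') (y @ y') (lin_tens p (of_web w))"
  by (rule low_op[OF assms(1)])
    (use assms in \<open>auto intro!: inf_ideal.tens_right free_lt_bilinear[OF _ free_lt_of_web[of w _ _ "Suc (deg w)"]] webs_Tens\<close>)

definition gr_eq :: "web \<Rightarrow> web \<Rightarrow> bool"
  where "gr_eq u v \<longleftrightarrow> well_formed u \<and> well_formed v \<and> src u = src v \<and> tgt u = tgt v \<and> deg u = deg v \<and>
    low (deg u) (src u) (tgt u) (of_web u - of_web v)"

lemma gr_eq_refl: "well_formed u \<Longrightarrow> gr_eq u u"
  by (simp add: gr_eq_def low_zero)

lemma gr_eq_sym: "gr_eq u v \<Longrightarrow> gr_eq v u"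
  unfolding gr_eq_def using low_smul[of "deg u" "src u" "tgt u" "of_web u - of_web v" "-1"] by auto

lemma gr_eq_trans [trans]: "gr_eq u v \<Longrightarrow> gr_eq v w \<Longrightarrow> gr_eq u w"
  unfolding gr_eq_def using low_add[of "deg u" "src u" "tgt u" "of_web u - of_web v" "of_web v - of_web w"] by auto

lemma gr_eq_bilinear:
  assumes "gr_eq u u'" "gr_eq v v'"
    "\<And>p. low (deg u) (src u) (tgt u) p \<Longrightarrow> low (deg (h u v)) (src (h u v)) (tgt (h u v)) (bilinear_ext h p (of_web v))"
    "\<And>p. low (deg v) (src v) (tgt v) p \<Longrightarrow> low (deg (h u v)) (src (h u v)) (tgt (h u v)) (bilinear_ext h (of_web u') p)"
  shows "low (deg (h u v)) (src (h u v)) (tgt (h u v)) (of_web (h u v) - of_web (h u' v'))"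
proof -
  have "of_web (h u v) - of_web (h u' v') =
    bilinear_ext h (of_web u - of_web u') (of_web v) + bilinear_ext h (of_web u') (of_web v - of_web v')"
    by simp
  moreover have "low (deg (h u v)) (src (h u v)) (tgt (h u v)) (bilinear_ext h (of_web u - of_web u') (of_web v))"
    by (rule assms(3)) (use assms(1) in \<open>unfold gr_eq_def, blast\<close>)
  moreover have "low (deg (h u v)) (src (h u v)) (tgt (h u v)) (bilinear_ext h (of_web u') (of_web v - of_web v'))"
    by (rule assms(4)) (use assms(2) in \<open>unfold gr_eq_def, blast\<close>)
  ultimately show ?thesis by (simp only: low_add)
qed

lemma gr_eq_comp:
  assumes "gr_eq u u'" "gr_eq v v'" "src u = tgt v"
  shows "gr_eq (Comp u v) (Comp u' v')"
proof -
  note u = assms(1)[unfolded gr_eq_def] and v = assms(2)[unfolded gr_eq_def]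
  have "low (deg (Comp u v)) (src (Comp u v)) (tgt (Comp u v)) (of_web (Comp u v) - of_web (Comp u' v'))"
    using assms(1,2)
  proof (rule gr_eq_bilinear)
    fix p assume "low (deg u) (src u) (tgt u) p"
    from low_comp_right[OF this[unfolded assms(3)], of v "src v"] u v assms(3)
    show "low (deg (Comp u v)) (src (Comp u v)) (tgt (Comp u v)) (lin_comp p (of_web v))"
      by (simp add: webs_def add.commute)
  next
    fix p assume "low (deg v) (src v) (tgt v) p"
    from low_comp_left[OF this, of u' "tgt u'"] u v assms(3)
    show "low (deg (Comp u v)) (src (Comp u v)) (tgt (Comp u v)) (lin_comp (of_web u') p)"
      by (simp add: webs_def)
  qed
  then show ?thesis using u v assms(3) by (simp add: gr_eq_def)
qed

lemma gr_eq_tens: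
  assumes "gr_eq u u'" "gr_eq v v'"
  shows "gr_eq (Tens u v) (Tens u' v')"
proof -
  note u = assms(1)[unfolded gr_eq_def] and v = assms(2)[unfolded gr_eq_def]
  have "low (deg (Tens u v)) (src (Tens u v)) (tgt (Tens u v)) (of_web (Tens u v) - of_web (Tens u' v'))"
    using assms(1,2)
  proof (rule gr_eq_bilinear)
    fix p assume "low (deg u) (src u) (tgt u) p"
    from low_tens_right[OF this, of v "src v" "tgt v"] u v
    show "low (deg (Tens u v)) (src (Tens u v)) (tgt (Tens u v)) (lin_tens p (of_web v))"
      by (simp add: webs_def add.commute)
  next
    fix p assume "low (deg v) (src v) (tgt v) p"
    from low_tens_left[OF this, of u' "src u'" "tgt u'"] u v
    show "low (deg (Tens u v)) (src (Tens u v)) (tgt (Tens u v)) (lin_tens (of_web u') p)"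
      by (simp add: webs_def)
  qed
  then show ?thesis using u v by (simp add: gr_eq_def)
qed

lemma gr_eq_struct: "structural u v \<Longrightarrow> gr_eq u v"
  using structural_parallel[of u v] structural_deg[of u v]
    low_ideal[OF inf_ideal.rel[OF inf_relation.struct[of u v]]] unfolding gr_eq_def by blast

lemma gr_eq_assoc: "assoc_relation u v \<Longrightarrow> gr_eq u v"
  using assoc_relation_parallel[of u v] assoc_relation_deg[of u v]
    low_ideal[OF inf_ideal.rel[OF inf_relation.assoc[of u v]]] unfolding gr_eq_def by blast

section \<open>Leading terms of the square flops\<close>

lemma merge_props: "well_formed (merge a b)" "src (merge a b) = erase [a, b]" "tgt (merge a b) = erase [a + b]"
    "deg (merge a b) = a * b"
  and split_props: "well_formed (split a b)" "src (split a b) = erase [a + b]" "tgt (split a b) = erase [a, b]"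
    "deg (split a b) = a * b"
  and idw_props: "well_formed (idw a)" "src (idw a) = erase [a]" "tgt (idw a) = erase [a]" "deg (idw a) = 0"
  by (auto simp: merge_def split_def idw_def erase_def objects_iff)

definition Eweb :: "nat \<Rightarrow> nat \<Rightarrow> nat \<Rightarrow> web"
  where "Eweb f a x = Comp (Tens (merge a f) (idw (x - f))) (Tens (idw a) (split f (x - f)))"

definition Fweb :: "nat \<Rightarrow> nat \<Rightarrow> nat \<Rightarrow> web"
  where "Fweb g a x = Comp (Tens (idw (a - g)) (merge g x)) (Tens (split (a - g) g) (idw x))"

lemma E_eq: "f \<le> x \<Longrightarrow> E f a x = of_web (Eweb f a x)"
  and F_eq: "g \<le> a \<Longrightarrow> F g a x = of_web (Fweb g a x)"
  by (simp_all add: E_def F_def Eweb_def Fweb_def)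

lemma Eweb_props:
  assumes "f \<le> x"
  shows "well_formed (Eweb f a x)" "src (Eweb f a x) = erase [a, x]" "tgt (Eweb f a x) = erase [a + f, x - f]"
    "deg (Eweb f a x) = a * f + f * (x - f)"
  using assms unfolding Eweb_def by (auto simp: merge_props split_props idw_props) (auto simp: erase_def)

lemma Fweb_props:
  assumes "g \<le> a"
  shows "well_formed (Fweb g a x)" "src (Fweb g a x) = erase [a, x]" "tgt (Fweb g a x) = erase [a - g, g + x]"
    "deg (Fweb g a x) = g * x + (a - g) * g"
  using assms unfolding Fweb_def by (auto simp: merge_props split_props idw_props) (auto simp: erase_def)

lemma qbinom_0: "qbinom k 0 = 1"
  by (rule qbinom_unique) simp

lemma gr_eq_tens_unit:
  "well_formed f \<Longrightarrow> gr_eq (Tens (Id []) f) f" "well_formed f \<Longrightarrow> gr_eq (Tens f (Id [])) f"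
  by (auto intro: gr_eq_struct structural.intros)

lemma gr_eq_comp_id:
  "well_formed f \<Longrightarrow> x = tgt f \<Longrightarrow> gr_eq (Comp (Id x) f) f" "well_formed f \<Longrightarrow> x = src f \<Longrightarrow> gr_eq (Comp f (Id x)) f"
  by (auto intro: gr_eq_struct structural.intros)

lemma gr_eq_tens_ids: "x \<in> objects \<Longrightarrow> y \<in> objects \<Longrightarrow> gr_eq (Tens (Id x) (Id y)) (Id (x @ y))"
  by (intro gr_eq_struct structural.tens_id) simp

lemma gr_eq_comp_assoc:
  "well_formed h \<Longrightarrow> well_formed g \<Longrightarrow> well_formed f \<Longrightarrow> src h = tgt g \<Longrightarrow> src g = tgt f \<Longrightarrow>
    gr_eq (Comp (Comp h g) f) (Comp h (Comp g f))"
  by (intro gr_eq_struct structural.comp_assoc) simp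

text \<open>The inequality between the degrees of the terms with index \<open>t\<close> and 0 of
  a square flop, in terms of the thicknesses \<open>f\<close> and \<open>g\<close> that are left
  over in the former.\<close>

lemma ladder_degree:
  fixes t f g d :: nat
  assumes "t > 0"
  shows "f * (2 * t + g + d) + g * (2 * t + f + d) < (t + f) * (t + g + d) + (t + g) * (t + f + d)"
  using assms by (simp add: algebra_simps)

text \<open>Only the term with index 0 of a flop has the degree of its left-hand side.\<close>

lemma gr_eq_flop:
  fixes v :: "nat \<Rightarrow> web"
  assumes I: "inf_ideal (src u) (tgt u) (of_web u - (\<Sum>t\<le>n. scale (c t) (of_web (v t))))"
    and c: "c 0 = 1"
    and v: "\<And>t. t \<le> n \<Longrightarrow> well_formed (v t) \<and> src (v t) = src u \<and> tgt (v t) = tgt u"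
    and d: "deg (v 0) = deg u" "\<And>t. t \<le> n \<Longrightarrow> t > 0 \<Longrightarrow> deg (v t) < deg u"
    and u: "well_formed u"
  shows "gr_eq u (v 0)"
proof -
  let ?r = "\<Sum>t\<in>{1..n}. scale (c t) (of_web (v t))"
  have "{..n} = insert 0 {1..n}" by auto
  then have "(\<Sum>t\<le>n. scale (c t) (of_web (v t))) = of_web (v 0) + ?r"
    using c by (simp add: scale_eq_smul)
  then have e: "of_web u - (\<Sum>t\<le>n. scale (c t) (of_web (v t))) = of_web u - of_web (v 0) - ?r"
    by (simp add: algebra_simps)
  have "?r \<in> free_lt (deg u) (src u) (tgt u)"
    using v d by (intro free_lt_sum) (auto simp: scale_eq_smul webs_def intro!: free_lt_closed free_lt_of_web)
  then have "low (deg u) (src u) (tgt u) (of_web u - of_web (v 0))"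
    unfolding low_def using I unfolding e by blast
  then show ?thesis using v[of 0] u d by (simp add: gr_eq_def)
qed

lemma erase_pos: "a \<noteq> 0 \<Longrightarrow> erase [a] = [a]" "erase [0] = []"
  by (auto simp: erase_def)

text \<open>The leading part of the flop of type \<open>FE\<close> with rungs of thickness
  \<open>b\<close> and \<open>a\<close>. Its term with index 0 moves the whole left strand to
  the right and \<open>b\<close> back to the left, so it is a merge followed by a split.\<close>

lemma gr_eq_square_less:
  assumes "1 \<le> a" "1 \<le> b" "a + b < N"
  shows "gr_eq (Comp (Tens (Id [b]) (Merge a (N - a - b)))
      (Comp (Tens (Split b a) (Id [N - a - b]))
        (Comp (Tens (Merge a b) (Id [N - a - b]))
          (Tens (Id [a]) (Split b (N - a - b))))))
    (Comp (Split b (N - b)) (Merge a (N - a)))" (is "gr_eq ?L ?R")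
proof -
  define d where "d = N - a - b"
  have N: "N = a + b + d" "d > 0" using assms by (auto simp: d_def)
  let ?x = "b + d"
  let ?u = "Comp (Fweb a (a + b) d) (Eweb b a ?x)"
  let ?v = "\<lambda>t. Comp (Eweb (b - t) (a - (a - t)) (?x + (a - t))) (Fweb (a - t) a ?x)"
  have st: "src ?u = erase [a, ?x]" "tgt ?u = erase [b, a + d]"
    using assms by (auto simp: Fweb_props Eweb_props add.commute)
  have rel: "inf_relation (erase [a, ?x]) (erase [a + b - a, ?x + a - b])
    (lin_comp (F a (a + b) (?x - b)) (E b a ?x)
      - (\<Sum>t\<le>min b a. scale (qbinom (int ?x - int a + int a - int b) t)
          (lin_comp (E (b - t) (a - (a - t)) (?x + (a - t))) (F (a - t) a ?x))))"
    by (rule inf_relation.flop_FE) auto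
  have sum: "(\<Sum>t\<le>min b a. scale (qbinom (int ?x - int a + int a - int b) t)
          (lin_comp (E (b - t) (a - (a - t)) (?x + (a - t))) (F (a - t) a ?x))) =
      (\<Sum>t\<le>min b a. scale (qbinom (int ?x - int a + int a - int b) t) (of_web (?v t)))"
  proof -
    have "E (b - t) (a - (a - t)) (?x + (a - t)) = of_web (Eweb (b - t) (a - (a - t)) (?x + (a - t)))" for t
      by (rule E_eq) arith
    moreover have "F (a - t) a ?x = of_web (Fweb (a - t) a ?x)" for t by (rule F_eq) arith
    ultimately show ?thesis by (simp only: bilinear_ext_of_web)
  qed
  have "inf_ideal (src ?u) (tgt ?u) (of_web ?u - (\<Sum>t\<le>min b a. scale (qbinom (int ?x - int a + int a - int b) t) (of_web (?v t))))"
    using inf_ideal.rel[OF rel] unfolding sum st by (simp add: E_eq F_eq add.commute)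
  then have "gr_eq ?u (?v 0)"
  proof (rule gr_eq_flop)
    show "qbinom (int ?x - int a + int a - int b) 0 = 1" by (rule qbinom_0)
    show "well_formed (?v t) \<and> src (?v t) = src ?u \<and> tgt (?v t) = tgt ?u" if "t \<le> min b a" for t
    proof -
      have "t \<le> a" "t \<le> b" using that by auto
      then obtain a' b' where "a = t + a'" "b = t + b'" using le_Suc_ex by blast
      then show ?thesis by (auto simp: Fweb_props Eweb_props add.commute add.left_commute)
    qed
    show "deg (?v 0) = deg ?u"
      using N by (simp add: Fweb_props Eweb_props algebra_simps)
    show "deg (?v t) < deg ?u" if "t \<le> min b a" "t > 0" for t
    proof -
      have "t \<le> a" "t \<le> b" using that by auto
      then obtain a' b' where ab: "a = t + a'" "b = t + b'" using le_Suc_ex by blast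
      have "deg (?v t) = b' * (2 * t + a' + d) + a' * (2 * t + b' + d)"
        unfolding ab by (simp add: Fweb_props Eweb_props algebra_simps)
      also have "\<dots> < (t + b') * (t + a' + d) + (t + a') * (t + b' + d)"
        using that by (intro ladder_degree)
      also have "\<dots> = deg ?u"
        unfolding ab by (simp add: Fweb_props Eweb_props algebra_simps)
      finally show ?thesis .
    qed
    show "well_formed ?u" by (auto simp: Fweb_props Eweb_props add.commute)
  qed
  moreover have "gr_eq ?L ?u"
  proof -
    have "?u = Comp (Comp (Tens (Id [b]) (Merge a d)) (Tens (Split b a) (Id [d])))
      (Comp (Tens (Merge a b) (Id [d])) (Tens (Id [a]) (Split b d)))"
      using assms N by (simp add: Fweb_def Eweb_def merge_def split_def idw_def erase_pos)
    then show ?thesis using assms N unfolding d_def[symmetric]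
      by (auto intro!: gr_eq_sym[OF gr_eq_comp_assoc])
  qed
  moreover have "gr_eq (?v 0) ?R"
  proof -
    have "?v 0 = Comp (Comp (Tens (Id [b]) (Id [a + d])) (Tens (Id []) (Split b (a + d))))
      (Comp (Tens (Id []) (Merge a (b + d))) (Tens (Id [a]) (Id [b + d])))"
      using assms N by (simp add: Fweb_def Eweb_def merge_def split_def idw_def erase_pos add.commute)
    also have "gr_eq \<dots> (Comp (Comp (Id ([b] @ [a + d])) (Split b (a + d))) (Comp (Merge a (b + d)) (Id ([a] @ [b + d]))))"
      using assms N by (intro gr_eq_comp gr_eq_tens_unit gr_eq_tens_ids) auto
    also have "gr_eq \<dots> (Comp (Split b (a + d)) (Merge a (b + d)))"
      using assms N by (intro gr_eq_comp gr_eq_comp_id) auto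
    finally show ?thesis using N by (simp add: add.commute add.left_commute)
  qed
  ultimately show ?thesis using gr_eq_trans by blast
qed

text \<open>The leading part of the flop of type \<open>EF\<close> with rungs of thickness
  \<open>N - a\<close> and \<open>N - b\<close>.\<close>

lemma gr_eq_square_greater:
  assumes "1 \<le> a" "a \<le> N - 1" "1 \<le> b" "b \<le> N - 1" "a + b > N"
  shows "gr_eq (Comp (Tens (Merge (a + b - N) (N - a)) (Id [N - b]))
      (Comp (Tens (Id [a + b - N]) (Split (N - a) (N - b)))
        (Comp (Tens (Id [a + b - N]) (Merge (N - b) (N - a)))
          (Tens (Split (a + b - N) (N - b)) (Id [N - a])))))
    (Comp (Split b (N - b)) (Merge a (N - a)))" (is "gr_eq ?L ?R")
proof -
  define d f g where "d = a + b - N" and "f = N - a" and "g = N - b"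
  have N: "a = g + d" "b = f + d" "N = f + g + d" "d > 0" "f > 0" "g > 0"
    using assms by (auto simp: d_def f_def g_def)
  let ?u = "Comp (Eweb f d (f + g)) (Fweb g a f)"
  let ?v = "\<lambda>t. Comp (Fweb (g - t) (a + (f - t)) (f - (f - t))) (Eweb (f - t) a f)"
  have st: "src ?u = erase [a, f]" "tgt ?u = erase [b, g]"
    using N by (auto simp: Fweb_props Eweb_props add.commute)
  have rel: "inf_relation (erase [a, f]) (erase [a + f - g, f + g - f])
    (lin_comp (E f (a - g) (f + g)) (F g a f)
      - (\<Sum>t\<le>min f g. scale (qbinom (int a - int f + int f - int g) t)
          (lin_comp (F (g - t) (a + (f - t)) (f - (f - t))) (E (f - t) a f))))"
    by (rule inf_relation.flop_EF) (use N in auto)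
  have sum: "(\<Sum>t\<le>min f g. scale (qbinom (int a - int f + int f - int g) t)
          (lin_comp (F (g - t) (a + (f - t)) (f - (f - t))) (E (f - t) a f))) =
      (\<Sum>t\<le>min f g. scale (qbinom (int a - int f + int f - int g) t) (of_web (?v t)))"
  proof -
    have "E (f - t) a f = of_web (Eweb (f - t) a f)" for t by (rule E_eq) arith
    moreover have "F (g - t) (a + (f - t)) (f - (f - t)) = of_web (Fweb (g - t) (a + (f - t)) (f - (f - t)))" for t
      by (rule F_eq) (use N in arith)
    ultimately show ?thesis by (simp only: bilinear_ext_of_web)
  qed
  have "inf_ideal (src ?u) (tgt ?u) (of_web ?u - (\<Sum>t\<le>min f g. scale (qbinom (int a - int f + int f - int g) t) (of_web (?v t))))"
    using inf_ideal.rel[OF rel] unfolding sum st using N by (simp add: E_eq F_eq add.commute)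
  then have "gr_eq ?u (?v 0)"
  proof (rule gr_eq_flop)
    show "qbinom (int a - int f + int f - int g) 0 = 1" by (rule qbinom_0)
    show "well_formed (?v t) \<and> src (?v t) = src ?u \<and> tgt (?v t) = tgt ?u" if "t \<le> min f g" for t
    proof -
      have "t \<le> f" "t \<le> g" using that by auto
      then obtain f' g' where "f = t + f'" "g = t + g'" using le_Suc_ex by blast
      then show ?thesis using N by (auto simp: Fweb_props Eweb_props add.commute add.left_commute)
    qed
    show "deg (?v 0) = deg ?u"
      using N by (simp add: Fweb_props Eweb_props algebra_simps)
    show "deg (?v t) < deg ?u" if "t \<le> min f g" "t > 0" for t
    proof -
      have "t \<le> f" "t \<le> g" using that by auto
      then obtain f' g' where fg: "f = t + f'" "g = t + g'" using le_Suc_ex by blast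
      have "deg (?v t) = f' * (2 * t + g' + d) + g' * (2 * t + f' + d)"
        unfolding N(1) fg by (simp add: Fweb_props Eweb_props algebra_simps)
      also have "\<dots> < (t + f') * (t + g' + d) + (t + g') * (t + f' + d)"
        using that by (intro ladder_degree)
      also have "\<dots> = deg ?u"
        unfolding N(1) fg by (simp add: Fweb_props Eweb_props algebra_simps)
      finally show ?thesis .
    qed
    show "well_formed ?u" using N by (auto simp: Fweb_props Eweb_props add.commute)
  qed
  moreover have "gr_eq ?L ?u"
  proof -
    have "?u = Comp (Comp (Tens (Merge d f) (Id [g])) (Tens (Id [d]) (Split f g)))
      (Comp (Tens (Id [d]) (Merge g f)) (Tens (Split d g) (Id [f])))"
      using N by (simp add: Fweb_def Eweb_def merge_def split_def idw_def erase_pos)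
    then show ?thesis using N unfolding d_def[symmetric] f_def[symmetric] g_def[symmetric]
      by (auto intro!: gr_eq_sym[OF gr_eq_comp_assoc] simp: add.commute)
  qed
  moreover have "gr_eq (?v 0) ?R"
  proof -
    have "?v 0 = Comp (Comp (Tens (Id [b]) (Id [g])) (Tens (Split b g) (Id [])))
      (Comp (Tens (Merge a f) (Id [])) (Tens (Id [a]) (Id [f])))"
      using N by (simp add: Fweb_def Eweb_def merge_def split_def idw_def erase_pos add.commute)
    also have "gr_eq \<dots> (Comp (Comp (Id ([b] @ [g])) (Split b g)) (Comp (Merge a f) (Id ([a] @ [f]))))"
      using N by (intro gr_eq_comp gr_eq_tens_unit gr_eq_tens_ids) auto
    also have "gr_eq \<dots> (Comp (Split b g) (Merge a f))"
      using N by (intro gr_eq_comp gr_eq_comp_id) auto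
    finally show ?thesis unfolding f_def g_def .
  qed
  ultimately show ?thesis using gr_eq_trans by blast
qed

lemma heq_gr_eq: "heq u v \<Longrightarrow> gr_eq u v"
proof (induction rule: heq.induct)
  case (rel u v)
  from rel(1) show ?case
  proof cases
    case (bigon a b)
    then show ?thesis using rel(2) by simp
  next
    case assoc
    then show ?thesis by (rule gr_eq_assoc)
  next
    case (square_less a N b)
    then show ?thesis using gr_eq_square_less[of a b N] by simp
  next
    case (square_greater a N b)
    then show ?thesis using gr_eq_square_greater[of a N b] by simp
  qed
qed (auto intro: gr_eq_struct gr_eq_refl gr_eq_sym gr_eq_trans gr_eq_comp gr_eq_tens)

lemma degenerate_low: "degenerate u \<Longrightarrow> low (deg u) (src u) (tgt u) (of_web u)"
proof (induction rule: degenerate.induct)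
  case (bigon a b)
  have "scale (qbinom (int (a + b)) a) (of_web (Id [a + b])) \<in> free_lt (2 * (a * b)) [a + b] [a + b]"
    using bigon by (auto simp: scale_eq_smul webs_def intro!: free_lt_closed free_lt_of_web)
  moreover have "inf_ideal [a + b] [a + b] (of_web (Comp (Merge a b) (Split a b))
      - scale (qbinom (int (a + b)) a) (of_web (Id [a + b])))"
    using bigon by (intro inf_ideal.rel inf_relation.bigon)
  moreover have "deg (Comp (Merge a b) (Split a b)) = 2 * (a * b)" by simp
  ultimately show ?case unfolding low_def by (simp only: src.simps tgt.simps) blast
next
  case (heq u v)
  note e = heq_gr_eq[OF heq.hyps(1), unfolded gr_eq_def]
  have "low (deg u) (src u) (tgt u) (of_web u - of_web v)" "low (deg u) (src u) (tgt u) (of_web v)"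
    using e heq.IH by auto
  then have "low (deg u) (src u) (tgt u) ((of_web u - of_web v) + of_web v)" by (rule low_add)
  then show ?case by simp
next
  case (comp_left u g)
  then show ?case using low_comp_left[of "deg u" "src u" "tgt u" "of_web u" g "tgt g"] by (simp add: webs_def)
next
  case (comp_right u g)
  then show ?case using low_comp_right[of "deg u" "src u" "tgt u" "of_web u" g "src g"]
    by (simp add: webs_def add.commute)
next
  case (tens_left u g)
  then show ?case using low_tens_left[of "deg u" "src u" "tgt u" "of_web u" g "src g" "tgt g"]
    by (simp add: webs_def)
next
  case (tens_right u g)
  then show ?case using low_tens_right[of "deg u" "src u" "tgt u" "of_web u" g "src g" "tgt g"]
    by (simp add: webs_def add.commute)
qed

section \<open>A quantum binomial identity\<close>

text \<open>The two signs give the two versions of the Pascal rule, which are exchanged by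
  inverting \<open>q\<close>.\<close>

lemma qbinom_Pascal:
  assumes "\<epsilon> = 1 \<or> \<epsilon> = - 1"
  shows "qbinom (k + 1) (Suc t) = qpow (- \<epsilon> * int (Suc t)) * qbinom k (Suc t) + qpow (\<epsilon> * (k - int t)) * qbinom k t"
proof (rule qbinom_unique)
  let ?d = "\<lambda>t. \<Prod>i=1..t. qint (int i)"
  let ?m = "\<Prod>i=1..t. qint (k - int i + 1)"
  have up: "(\<Prod>i=1..Suc t. qint (k + 1 - int i + 1)) = qint (k + 1) * ?m"
  proof -
    have "(\<Prod>i=1..Suc t. qint (k + 1 - int i + 1)) = qint (k + 1 - int 1 + 1) * (\<Prod>i=Suc 1..Suc t. qint (k + 1 - int i + 1))"
      by (rule prod.atLeast_Suc_atMost) simp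
    also have "(\<Prod>i=Suc 1..Suc t. qint (k + 1 - int i + 1)) = ?m"
      by (simp only: prod.shift_bounds_cl_Suc_ivl) simp
    finally show ?thesis by simp
  qed
  have down: "(\<Prod>i=1..Suc t. qint (k - int i + 1)) = qint (k - int t) * ?m"
    by (simp add: mult.commute)
  have split: "qint (k + 1) = qpow (- \<epsilon> * int (Suc t)) * qint (k - int t) + qpow (\<epsilon> * (k - int t)) * qint (int (Suc t))"
    using assms
  proof
    assume "\<epsilon> = 1"
    then show ?thesis using qint_split[of "k - int t" "int (Suc t)"] by (simp add: algebra_simps)
  next
    assume "\<epsilon> = - 1"
    then show ?thesis using qint_split[of "int (Suc t)" "k - int t"] by (simp add: algebra_simps)
  qed
  have "(qpow (- \<epsilon> * int (Suc t)) * qbinom k (Suc t) + qpow (\<epsilon> * (k - int t)) * qbinom k t) * ?d (Suc t) =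
    qpow (- \<epsilon> * int (Suc t)) * (qbinom k (Suc t) * ?d (Suc t)) +
    qpow (\<epsilon> * (k - int t)) * ((qbinom k t * ?d t) * qint (int (Suc t)))"
    by (simp only: distrib_right mult.assoc prod.atLeast1_atMost_eq prod.nat_ivl_Suc' le_SucI)
      (simp add: mult.assoc)
  also have "\<dots> = qint (k + 1) * ?m"
    unfolding qbinom_mult down split by (simp only: algebra_simps)
  finally show "(qpow (- \<epsilon> * int (Suc t)) * qbinom k (Suc t) + qpow (\<epsilon> * (k - int t)) * qbinom k t) * ?d (Suc t) =
    (\<Prod>i=1..Suc t. qint (k + 1 - int i + 1))" unfolding up .
qed

lemma qbinom_zero: "qbinom 0 (Suc t) = 0"
proof (rule qbinom_unique)
  have "(\<Prod>i=1..Suc t. qint (0 - int i + 1)) = 0"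
    by (rule prod_zero) (auto intro!: bexI[of _ 1] simp: qint_unique[of 0 0])
  then show "0 * (\<Prod>i=1..Suc t. qint (int i)) = (\<Prod>i=1..Suc t. qint (0 - int i + 1))" by simp
qed

definition inv_weight :: "int set \<Rightarrow> int set \<Rightarrow> int"
  where "inv_weight A B = (\<Sum>a\<in>A. \<Sum>b\<in>B. sgn (a - b))"

lemma inv_weight_empty [simp]: "inv_weight {} B = 0" "inv_weight A {} = 0"
  by (auto simp: inv_weight_def)

lemma inv_weight_Un:
  "finite A \<Longrightarrow> finite A' \<Longrightarrow> A \<inter> A' = {} \<Longrightarrow> inv_weight (A \<union> A') B = inv_weight A B + inv_weight A' B"
  "finite B \<Longrightarrow> finite B' \<Longrightarrow> B \<inter> B' = {} \<Longrightarrow> inv_weight A (B \<union> B') = inv_weight A B + inv_weight A B'"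
  by (auto simp: inv_weight_def sum.union_disjoint sum.distrib)

lemma inv_weight_antisym: "inv_weight B A = - inv_weight A B"
proof -
  have "inv_weight B A = (\<Sum>a\<in>A. \<Sum>b\<in>B. sgn (b - a))"
    unfolding inv_weight_def by (rule sum.swap)
  also have "\<dots> = (\<Sum>a\<in>A. \<Sum>b\<in>B. - sgn (a - b))"
    by (intro sum.cong HOL.refl) (simp add: sgn_if)
  finally show ?thesis by (simp add: inv_weight_def sum_negf)
qed

lemma inv_weight_top:
  assumes "\<And>b. b \<in> B \<Longrightarrow> b < e"
  shows "inv_weight {e} B = int (card B)" "inv_weight B {e} = - int (card B)"
proof -
  have "inv_weight {e} B = (\<Sum>b\<in>B. 1)"
    unfolding inv_weight_def using assms by (auto intro!: sum.cong)
  then show "inv_weight {e} B = int (card B)" by simp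
  then show "inv_weight B {e} = - int (card B)" by (simp add: inv_weight_antisym[of B])
qed

definition subsets :: "'a set \<Rightarrow> nat \<Rightarrow> 'a set set"
  where "subsets K n = {Y. Y \<subseteq> K \<and> card Y = n}"

lemma finite_subsets [simp]: "finite K \<Longrightarrow> finite (subsets K n)"
  by (simp add: subsets_def)

lemma subsets_insert:
  assumes "finite K" "e \<notin> K"
  shows "subsets (insert e K) (Suc n) = subsets K (Suc n) \<union> insert e ` subsets K n"
proof (intro equalityI subsetI)
  fix Y assume Y: "Y \<in> subsets (insert e K) (Suc n)"
  show "Y \<in> subsets K (Suc n) \<union> insert e ` subsets K n"
  proof (cases "e \<in> Y")
    case True
    then have "Y = insert e (Y - {e})" "Y - {e} \<in> subsets K n" using Y by (auto simp: subsets_def)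
    then show ?thesis by blast
  qed (use Y in \<open>auto simp: subsets_def\<close>)
next
  fix Y assume "Y \<in> subsets K (Suc n) \<union> insert e ` subsets K n"
  then show "Y \<in> subsets (insert e K) (Suc n)"
    using assms by (auto simp: subsets_def card_insert_if finite_subset[OF _ assms(1)])
qed

lemma subsets_0 [simp]: "finite K \<Longrightarrow> subsets K 0 = {{}}"
  by (auto simp: subsets_def dest: finite_subset)

lemma subsets_empty [simp]: "subsets {} (Suc n) = {}"
  by (auto simp: subsets_def)

text \<open>The total weight of the sets \<open>Y\<close> of size \<open>n\<close> that a ladder
  can carry from a strand containing \<open>K\<close> over to a strand containing
  \<open>C\<close> and back. Changing the sign of \<open>\<epsilon>\<close> reverses the order
  of the integers and with it the roles of the two strands.\<close>

definition subset_sum :: "int \<Rightarrow> int set \<Rightarrow> int set \<Rightarrow> nat \<Rightarrow> laurent"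
  where "subset_sum \<epsilon> C K n = (\<Sum>Y\<in>subsets K n. qpow (\<epsilon> * (inv_weight Y (K - Y) + inv_weight C Y)))"

lemma subset_sum_0 [simp]: "finite K \<Longrightarrow> subset_sum \<epsilon> C K 0 = 1"
  by (simp add: subset_sum_def qpow_0)

lemma subset_sum_insert_fixed:
  assumes "finite C" "finite K" "e \<notin> C" "\<And>b. b \<in> K \<Longrightarrow> b < e"
  shows "subset_sum \<epsilon> (insert e C) K n = qpow (\<epsilon> * int n) * subset_sum \<epsilon> C K n"
  unfolding subset_sum_def sum_distrib_left
proof (rule sum.cong[OF HOL.refl])
  fix Y assume Y: "Y \<in> subsets K n"
  then have "inv_weight {e} Y = int n" using inv_weight_top[of Y e] assms(4) by (auto simp: subsets_def)
  then have "inv_weight (insert e C) Y = int n + inv_weight C Y"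
    using inv_weight_Un(1)[of "{e}" C Y] assms by simp
  then show "qpow (\<epsilon> * (inv_weight Y (K - Y) + inv_weight (insert e C) Y)) =
      qpow (\<epsilon> * int n) * qpow (\<epsilon> * (inv_weight Y (K - Y) + inv_weight C Y))"
    by (simp add: qpow_add algebra_simps)
qed

lemma subset_sum_insert_range:
  assumes "finite C" "finite K" "\<And>b. b \<in> C \<union> K \<Longrightarrow> b < e"
  shows "subset_sum \<epsilon> C (insert e K) (Suc n) = qpow (- \<epsilon> * int (Suc n)) * subset_sum \<epsilon> C K (Suc n) +
    qpow (\<epsilon> * (int (card K) - int (card C) - int n)) * subset_sum \<epsilon> C K n"
proof -
  let ?w = "\<lambda>K Y. qpow (\<epsilon> * (inv_weight Y (K - Y) + inv_weight C Y))"
  have e: "e \<notin> K" using assms(3) by auto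
  have inj: "inj_on (insert e) (subsets K n)"
    using e by (auto simp: inj_on_def subsets_def)
  have "subset_sum \<epsilon> C (insert e K) (Suc n) =
    (\<Sum>Y\<in>subsets K (Suc n). ?w (insert e K) Y) + (\<Sum>Y\<in>insert e ` subsets K n. ?w (insert e K) Y)"
    unfolding subset_sum_def subsets_insert[OF assms(2) e]
    by (rule sum.union_disjoint) (use assms e in \<open>auto simp: subsets_def\<close>)
  also have "(\<Sum>Y\<in>subsets K (Suc n). ?w (insert e K) Y) = qpow (- \<epsilon> * int (Suc n)) * subset_sum \<epsilon> C K (Suc n)"
    unfolding subset_sum_def sum_distrib_left
  proof (rule sum.cong[OF HOL.refl])
    fix Y assume Y: "Y \<in> subsets K (Suc n)"
    then have fY: "finite Y" using assms(2) by (auto simp: subsets_def dest: finite_subset)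
    have "insert e K - Y = (K - Y) \<union> {e}" using Y e by (auto simp: subsets_def)
    then have "inv_weight Y (insert e K - Y) = inv_weight Y (K - Y) + inv_weight Y {e}"
      using inv_weight_Un(2)[of "K - Y" "{e}" Y] assms e by simp
    moreover have "inv_weight Y {e} = - int (Suc n)"
      using inv_weight_top(2)[of Y e] assms(3) Y by (auto simp: subsets_def)
    ultimately have w: "inv_weight Y (insert e K - Y) = inv_weight Y (K - Y) - int (Suc n)" by simp
    show "?w (insert e K) Y = qpow (- \<epsilon> * int (Suc n)) * ?w K Y"
      unfolding w qpow_add by (simp add: algebra_simps)
  qed
  also have "(\<Sum>Y\<in>insert e ` subsets K n. ?w (insert e K) Y) = (\<Sum>Y\<in>subsets K n. ?w (insert e K) (insert e Y))"
    by (simp add: sum.reindex[OF inj])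
  also have "\<dots> = qpow (\<epsilon> * (int (card K) - int (card C) - int n)) * subset_sum \<epsilon> C K n"
    unfolding subset_sum_def sum_distrib_left
  proof (rule sum.cong[OF HOL.refl])
    fix Y assume Y: "Y \<in> subsets K n"
    then have fY: "finite Y" "Y \<subseteq> K" "card Y = n" using assms(2) by (auto simp: subsets_def dest: finite_subset)
    have "insert e K - insert e Y = K - Y" using e by auto
    moreover have "inv_weight (insert e Y) (K - Y) = inv_weight {e} (K - Y) + inv_weight Y (K - Y)"
      using inv_weight_Un(1)[of "{e}" Y "K - Y"] fY e by auto
    moreover have "inv_weight {e} (K - Y) = int (card K) - int n"
      using inv_weight_top(1)[of "K - Y" e] assms(2,3) fY card_mono[of K Y]
      by (auto simp: card_Diff_subset of_nat_diff)
    moreover have "inv_weight C (insert e Y) = inv_weight C {e} + inv_weight C Y"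
      using inv_weight_Un(2)[of "{e}" Y C] fY e by auto
    moreover have "inv_weight C {e} = - int (card C)"
      using inv_weight_top(2)[of C e] assms(3) by auto
    ultimately have w: "inv_weight (insert e Y) (insert e K - insert e Y) + inv_weight C (insert e Y) =
        int (card K) - int (card C) - int n + (inv_weight Y (K - Y) + inv_weight C Y)" by simp
    show "?w (insert e K) (insert e Y) =
        qpow (\<epsilon> * (int (card K) - int (card C) - int n)) * ?w K Y"
      unfolding w qpow_add by (simp only: distrib_left)
  qed
  finally show ?thesis .
qed

text \<open>By induction on the number of elements. Removing the largest element
  \<open>e\<close> expresses both sides through smaller sets, by
  \<open>subset_sum_insert_fixed\<close> and \<open>subset_sum_insert_range\<close> with the
  roles of \<open>C\<close> and \<open>K\<close> exchanged between the sides, and the resulting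
  recursions agree by the Pascal rule.\<close>

theorem flop_identity:
  assumes "finite C" "finite K" "C \<inter> K = {}" "\<epsilon> = 1 \<or> \<epsilon> = - 1"
  shows "subset_sum \<epsilon> C K n =
    (\<Sum>t\<le>n. qbinom (int (card K) - int (card C)) t * subset_sum (- \<epsilon>) K C (n - t))"
  using assms(1-3)
proof (induction "card (C \<union> K)" arbitrary: C K n)
  case 0
  then have [simp]: "C = {}" "K = {}" by auto
  show ?case
  proof (cases n)
    case (Suc m)
    have "qbinom 0 t * subset_sum (- \<epsilon>) {} {} (Suc m - t) = 0" if "t \<le> Suc m" for t
      using that by (cases t) (auto simp: qbinom_zero subset_sum_def)
    then have "(\<Sum>t\<le>Suc m. qbinom 0 t * subset_sum (- \<epsilon>) {} {} (Suc m - t)) = 0"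
      by (intro sum.neutral) auto
    moreover have "subset_sum \<epsilon> {} {} (Suc m) = 0" by (simp add: subset_sum_def)
    ultimately show ?thesis using Suc by simp
  qed (simp add: qbinom_0)
next
  case (Suc N)
  define e where "e = Max (C \<union> K)"
  have fin: "finite (C \<union> K)" "C \<union> K \<noteq> {}" using Suc.hyps(2) Suc.prems by auto
  then have e: "e \<in> C \<union> K" unfolding e_def by (rule Max_in)
  have top: "b < e" if "b \<in> C \<union> K - {e}" for b
    using Max_ge[OF fin(1), of b] that by (auto simp: e_def)
  show ?case
  proof (cases "e \<in> K")
    case True
    define K' where "K' = K - {e}"
    have K: "K = insert e K'" "e \<notin> K'" "finite K'" "C \<inter> K' = {}" "e \<notin> C"
      using True Suc.prems by (auto simp: K'_def)
    have top': "b < e" if "b \<in> C \<union> K'" for b using top[of b] that K by auto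
    have "C \<union> K = insert e (C \<union> K')" "e \<notin> C \<union> K'" using K by auto
    then have N: "N = card (C \<union> K')" using Suc.hyps(2) Suc.prems K by simp
    note IH = Suc.hyps(1)[OF N Suc.prems(1) K(3,4)]
    define k where "k = int (card K') - int (card C)"
    have k: "int (card K) - int (card C) = k + 1" using K by (simp add: k_def)
    let ?L = "subset_sum (- \<epsilon>) K' C"
    have Q: "subset_sum (- \<epsilon>) K C m = qpow (- \<epsilon> * int m) * ?L m" for m
      unfolding K(1) using K Suc.prems top' by (intro subset_sum_insert_fixed) auto
    show ?thesis
    proof (cases n)
      case 0
      then show ?thesis using Suc.prems by (simp add: qbinom_0)
    next
      case (Suc m)
      have "(\<Sum>t\<le>Suc m. qbinom (k + 1) t * (qpow (- \<epsilon> * int (Suc m - t)) * ?L (Suc m - t))) =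
        qpow (- \<epsilon> * int (Suc m)) * ?L (Suc m) +
        (\<Sum>t\<le>m. qbinom (k + 1) (Suc t) * (qpow (- \<epsilon> * int (m - t)) * ?L (m - t)))"
        by (simp add: sum.atMost_Suc_shift qbinom_0 del: sum.atMost_Suc)
      also have "(\<Sum>t\<le>m. qbinom (k + 1) (Suc t) * (qpow (- \<epsilon> * int (m - t)) * ?L (m - t))) =
        (\<Sum>t\<le>m. qpow (- \<epsilon> * int (Suc m)) * (qbinom k (Suc t) * ?L (m - t)) +
          qpow (\<epsilon> * (k - int m)) * (qbinom k t * ?L (m - t)))"
      proof (rule sum.cong[OF HOL.refl])
        fix t assume "t \<in> {..m}"
        then have mt: "int (m - t) = int m - int t" by auto
        have 1: "qpow (- \<epsilon> * int (Suc t)) * qpow (- \<epsilon> * int (m - t)) = qpow (- \<epsilon> * int (Suc m))"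
          unfolding mt by (simp add: qpow_add algebra_simps)
        have 2: "qpow (\<epsilon> * (k - int t)) * qpow (- \<epsilon> * int (m - t)) = qpow (\<epsilon> * (k - int m))"
          unfolding mt by (simp add: qpow_add algebra_simps)
        have "qbinom (k + 1) (Suc t) * (qpow (- \<epsilon> * int (m - t)) * ?L (m - t)) =
          (qpow (- \<epsilon> * int (Suc t)) * qpow (- \<epsilon> * int (m - t))) * (qbinom k (Suc t) * ?L (m - t)) +
          (qpow (\<epsilon> * (k - int t)) * qpow (- \<epsilon> * int (m - t))) * (qbinom k t * ?L (m - t))"
          unfolding qbinom_Pascal[OF assms(4)] by (simp add: algebra_simps)
        then show "qbinom (k + 1) (Suc t) * (qpow (- \<epsilon> * int (m - t)) * ?L (m - t)) =
          qpow (- \<epsilon> * int (Suc m)) * (qbinom k (Suc t) * ?L (m - t)) +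
          qpow (\<epsilon> * (k - int m)) * (qbinom k t * ?L (m - t))" unfolding 1 2 .
      qed
      also have "\<dots> = qpow (- \<epsilon> * int (Suc m)) * (\<Sum>t\<le>m. qbinom k (Suc t) * ?L (m - t)) +
          qpow (\<epsilon> * (k - int m)) * (\<Sum>t\<le>m. qbinom k t * ?L (m - t))"
        by (simp add: sum.distrib sum_distrib_left)
      also have "(\<Sum>t\<le>m. qbinom k t * ?L (m - t)) = subset_sum \<epsilon> C K' m"
        using IH[of m] unfolding k_def by simp
      also have "qpow (- \<epsilon> * int (Suc m)) * ?L (Suc m) + (qpow (- \<epsilon> * int (Suc m)) * (\<Sum>t\<le>m. qbinom k (Suc t) * ?L (m - t)) +
          qpow (\<epsilon> * (k - int m)) * subset_sum \<epsilon> C K' m) =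
        qpow (- \<epsilon> * int (Suc m)) * (\<Sum>t\<le>Suc m. qbinom k t * ?L (Suc m - t)) + qpow (\<epsilon> * (k - int m)) * subset_sum \<epsilon> C K' m"
        by (simp add: sum.atMost_Suc_shift qbinom_0 distrib_left del: sum.atMost_Suc)
      also have "(\<Sum>t\<le>Suc m. qbinom k t * ?L (Suc m - t)) = subset_sum \<epsilon> C K' (Suc m)"
        using IH[of "Suc m"] unfolding k_def by simp
      also have "qpow (- \<epsilon> * int (Suc m)) * subset_sum \<epsilon> C K' (Suc m) + qpow (\<epsilon> * (k - int m)) * subset_sum \<epsilon> C K' m
        = subset_sum \<epsilon> C K (Suc m)"
        unfolding K(1) k_def using subset_sum_insert_range[of C K' e \<epsilon> m] Suc.prems K top' by simp
      finally show ?thesis unfolding Suc k Q by simp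
    qed
  next
    case False
    define C' where "C' = C - {e}"
    have C: "C = insert e C'" "e \<notin> C'" "finite C'" "C' \<inter> K = {}" "e \<notin> K"
      using e False Suc.prems by (auto simp: C'_def)
    have top': "b < e" if "b \<in> C' \<union> K" for b using top[of b] that C by auto
    have "C \<union> K = insert e (C' \<union> K)" "e \<notin> C' \<union> K" using C by auto
    then have N: "N = card (C' \<union> K)" using Suc.hyps(2) Suc.prems C by simp
    note IH = Suc.hyps(1)[OF N C(3) Suc.prems(2) C(4)]
    define k where "k = int (card K) - int (card C)"
    have k: "int (card K) - int (card C') = k + 1" using C by (simp add: k_def)
    let ?L = "subset_sum (- \<epsilon>) K C'"
    have Q: "subset_sum (- \<epsilon>) K C (Suc m) = qpow (\<epsilon> * int (Suc m)) * ?L (Suc m) + qpow (\<epsilon> * (k + 1 + int m)) * ?L m" for m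
    proof -
      have "subset_sum (- \<epsilon>) K C (Suc m) = qpow (- (- \<epsilon>) * int (Suc m)) * ?L (Suc m) +
          qpow (- \<epsilon> * (int (card C') - int (card K) - int m)) * ?L m"
        unfolding C(1) using C Suc.prems top' by (intro subset_sum_insert_range) auto
      moreover have "- \<epsilon> * (int (card C') - int (card K) - int m) = \<epsilon> * (k + 1 + int m)"
        using k by (simp add: algebra_simps)
      ultimately show ?thesis by simp
    qed
    show ?thesis
    proof (cases n)
      case 0
      then show ?thesis using Suc.prems by (simp add: qbinom_0)
    next
      case (Suc m)
      have "(\<Sum>t\<le>Suc m. qbinom k t * subset_sum (- \<epsilon>) K C (Suc m - t)) =
        (\<Sum>t\<le>m. qbinom k t * subset_sum (- \<epsilon>) K C (Suc (m - t))) + qbinom k (Suc m)"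
        using Suc.prems by (auto simp: Suc_diff_le intro!: sum.cong)
      also have "(\<Sum>t\<le>m. qbinom k t * subset_sum (- \<epsilon>) K C (Suc (m - t))) =
        (\<Sum>t\<le>m. qpow (\<epsilon> * int (Suc m - t)) * (qbinom k t * ?L (Suc m - t))) +
        (\<Sum>t\<le>m. qpow (\<epsilon> * (k + 1 + int m - int t)) * (qbinom k t * ?L (m - t)))"
        unfolding Q sum.distrib[symmetric]
        by (intro sum.cong HOL.refl) (auto simp: Suc_diff_le of_nat_diff algebra_simps)
      also have "(\<Sum>t\<le>m. qpow (\<epsilon> * int (Suc m - t)) * (qbinom k t * ?L (Suc m - t))) +
        (\<Sum>t\<le>m. qpow (\<epsilon> * (k + 1 + int m - int t)) * (qbinom k t * ?L (m - t))) + qbinom k (Suc m) =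
        (\<Sum>t\<le>Suc m. qpow (\<epsilon> * int (Suc m - t)) * (qbinom k t * ?L (Suc m - t))) +
        (\<Sum>t\<le>m. qpow (\<epsilon> * (k + 1 + int m - int t)) * (qbinom k t * ?L (m - t)))"
        using C by (simp add: qpow_0)
      also have "\<dots> = qpow (\<epsilon> * int (Suc m)) * ?L (Suc m) +
        (\<Sum>t\<le>m. qpow (\<epsilon> * int (m - t)) * (qbinom k (Suc t) * ?L (m - t)) + qpow (\<epsilon> * (k + 1 + int m - int t)) * (qbinom k t * ?L (m - t)))"
        by (simp add: sum.atMost_Suc_shift qbinom_0 sum.distrib del: sum.atMost_Suc)
      also have "(\<Sum>t\<le>m. qpow (\<epsilon> * int (m - t)) * (qbinom k (Suc t) * ?L (m - t)) + qpow (\<epsilon> * (k + 1 + int m - int t)) * (qbinom k t * ?L (m - t))) =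
        (\<Sum>t\<le>m. qpow (\<epsilon> * int (Suc m)) * (qbinom (k + 1) (Suc t) * ?L (m - t)))"
      proof (rule sum.cong[OF HOL.refl])
        fix t assume "t \<in> {..m}"
        then have mt: "int (m - t) = int m - int t" by auto
        have 1: "qpow (\<epsilon> * int (Suc m)) * qpow (- \<epsilon> * int (Suc t)) = qpow (\<epsilon> * int (m - t))"
          unfolding mt by (simp add: qpow_add algebra_simps)
        have 2: "qpow (\<epsilon> * int (Suc m)) * qpow (\<epsilon> * (k - int t)) = qpow (\<epsilon> * (k + 1 + int m - int t))"
          by (simp add: qpow_add algebra_simps)
        have "qpow (\<epsilon> * int (Suc m)) * (qbinom (k + 1) (Suc t) * ?L (m - t)) =
          (qpow (\<epsilon> * int (Suc m)) * qpow (- \<epsilon> * int (Suc t))) * (qbinom k (Suc t) * ?L (m - t)) +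
          (qpow (\<epsilon> * int (Suc m)) * qpow (\<epsilon> * (k - int t))) * (qbinom k t * ?L (m - t))"
          unfolding qbinom_Pascal[OF assms(4)] by (simp add: algebra_simps)
        then show "qpow (\<epsilon> * int (m - t)) * (qbinom k (Suc t) * ?L (m - t)) + qpow (\<epsilon> * (k + 1 + int m - int t)) * (qbinom k t * ?L (m - t))
          = qpow (\<epsilon> * int (Suc m)) * (qbinom (k + 1) (Suc t) * ?L (m - t))" unfolding 1 2 by simp
      qed
      also have "qpow (\<epsilon> * int (Suc m)) * ?L (Suc m) + \<dots> =
        qpow (\<epsilon> * int (Suc m)) * (\<Sum>t\<le>Suc m. qbinom (k + 1) t * ?L (Suc m - t))"
        by (simp add: sum.atMost_Suc_shift qbinom_0 distrib_left sum_distrib_left del: sum.atMost_Suc)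
      also have "(\<Sum>t\<le>Suc m. qbinom (k + 1) t * ?L (Suc m - t)) = subset_sum \<epsilon> C' K (Suc m)"
        using IH[of "Suc m"] unfolding k by simp
      also have "qpow (\<epsilon> * int (Suc m)) * subset_sum \<epsilon> C' K (Suc m) = subset_sum \<epsilon> C K (Suc m)"
        unfolding C(1) using subset_sum_insert_fixed[of C' K e \<epsilon> "Suc m"] C Suc.prems top' by simp
      finally show ?thesis unfolding Suc k_def by simp
    qed
  qed
qed

text \<open>The case of \<open>flop_identity\<close> in which \<open>C\<close> is empty.\<close>

lemma bigon_identity:
  assumes "finite U" "card U = a + b"
  shows "(\<Sum>S\<in>subsets U a. qpow (inv_weight S (U - S))) = qbinom (int (a + b)) a"
proof -
  have "(\<Sum>S\<in>subsets U a. qpow (inv_weight S (U - S))) = subset_sum 1 {} U a"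
    by (simp add: subset_sum_def)
  also have "\<dots> = (\<Sum>t\<le>a. qbinom (int (card U)) t * subset_sum (- 1) U {} (a - t))"
    using flop_identity[of "{}" U 1 a] assms by simp
  also have "\<dots> = (\<Sum>t\<le>a. if t = a then qbinom (int (card U)) a else 0)"
  proof (rule sum.cong[OF HOL.refl])
    fix t assume "t \<in> {..a}"
    then show "qbinom (int (card U)) t * subset_sum (- 1) U {} (a - t) = (if t = a then qbinom (int (card U)) a else 0)"
      by (cases "a - t") (auto simp: subset_sum_def[of _ _ _ "Suc _"])
  qed
  also have "\<dots> = qbinom (int (a + b)) a" using assms(2) by simp
  finally show ?thesis .
qed

section \<open>Laurent polynomials with non-negative coefficients\<close>

text \<open>Sums of powers of \<open>q\<close>. No cancellation occurs between them.\<close>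

definition nonneg :: "laurent \<Rightarrow> bool"
  where "nonneg p \<longleftrightarrow> (\<exists>M. p = (\<Sum>k\<in>#M. qpow k))"

lemma lookup_sum_qpow: "Poly_Mapping.lookup (\<Sum>k\<in>#M. qpow k) j = int (count M j)"
  by (induction M) (auto simp: lookup_add qpow_def lookup_single)

lemma nonneg_add: "nonneg p \<Longrightarrow> nonneg r \<Longrightarrow> nonneg (p + r)"
  unfolding nonneg_def by (metis image_mset_union sum_mset.union)

lemma nonneg_0: "nonneg 0"
  unfolding nonneg_def by (intro exI[of _ "{#}"]) simp

lemma nonneg_qpow: "nonneg p \<Longrightarrow> nonneg (qpow k * p)"
proof -
  assume "nonneg p"
  then obtain M where "p = (\<Sum>k\<in>#M. qpow k)" by (auto simp: nonneg_def)
  then have "qpow k * p = (\<Sum>j\<in>#image_mset (\<lambda>j. k + j) M. qpow j)"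
    by (simp add: sum_mset_distrib_left qpow_add image_mset.compositionality o_def)
  then show ?thesis unfolding nonneg_def by blast
qed

lemma nonneg_sum: "(\<And>a. a \<in> A \<Longrightarrow> nonneg (f a)) \<Longrightarrow> nonneg (sum f A)"
  by (induction A rule: infinite_finite_induct) (auto intro: nonneg_0 nonneg_add)

lemma nonneg_add_eq_0: "nonneg p \<Longrightarrow> nonneg r \<Longrightarrow> p + r = 0 \<Longrightarrow> p = 0"
proof -
  assume "nonneg p" "nonneg r" and e: "p + r = 0"
  then obtain M N where M: "p = (\<Sum>k\<in>#M. qpow k)" and N: "r = (\<Sum>k\<in>#N. qpow k)" by (auto simp: nonneg_def)
  have "int (count M j) + int (count N j) = 0" for j
    using arg_cong[OF e, of "\<lambda>p. Poly_Mapping.lookup p j"] unfolding M N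
    by (simp add: lookup_add lookup_sum_qpow)
  then have "M = {#}" by (intro multiset_eqI) (simp add: add_nonneg_eq_0_iff)
  then show "p = 0" using M by simp
qed

lemma nonneg_sum_nonzero:
  assumes "finite A" "\<And>a. a \<in> A \<Longrightarrow> nonneg (f a)" "a \<in> A" "f a \<noteq> 0"
  shows "sum f A \<noteq> 0"
  using nonneg_add_eq_0[of "f a" "sum f (A - {a})"] sum.remove[OF assms(1,3), of f] assms
  by (auto intro!: nonneg_sum)

lemma qpow_nonzero [simp]: "qpow k \<noteq> 0"
  by (metis mult_zero_left qpow_0 qpow_add add.right_inverse zero_neq_one)

section \<open>A representation of webs\<close>

type_synonym config = "int set list"

text \<open>Up to a rescaling of the basis, this is the action of webs on the multiplicity-free
  weight vectors in tensor products of quantum exterior powers. It is written as a right action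
  on functions of configurations: \<open>act w \<phi> c\<close> is the value of
  \<open>\<phi>\<close> on the image of the basis vector \<open>c\<close> under
  \<open>w\<close>.\<close>

primrec act :: "web \<Rightarrow> (config \<Rightarrow> laurent) \<Rightarrow> config \<Rightarrow> laurent" where
  "act (Id x) \<phi> c = \<phi> c"
| "act (Merge a b) \<phi> c = \<phi> [c ! 0 \<union> c ! 1]"
| "act (Split a b) \<phi> c = (\<Sum>S\<in>subsets (c ! 0) a. qpow (inv_weight S (c ! 0 - S)) * \<phi> [S, c ! 0 - S])"
| "act (Comp g f) \<phi> c = act f (act g \<phi>) c"
| "act (Tens f g) \<phi> c = act f (\<lambda>d. act g (\<lambda>e. \<phi> (d @ e)) (drop (length (src f)) c)) (take (length (src f)) c)"

definition linear_functional :: "((config \<Rightarrow> laurent) \<Rightarrow> laurent) \<Rightarrow> bool"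
  where "linear_functional \<Lambda> \<longleftrightarrow> (\<forall>\<phi> \<psi>. \<Lambda> (\<lambda>c. \<phi> c + \<psi> c) = \<Lambda> \<phi> + \<Lambda> \<psi>) \<and> (\<forall>a \<phi>. \<Lambda> (\<lambda>c. a * \<phi> c) = a * \<Lambda> \<phi>)"

lemma linear_functional_zero: "linear_functional \<Lambda> \<Longrightarrow> \<Lambda> (\<lambda>c. 0) = 0"
proof -
  assume "linear_functional \<Lambda>"
  then have "\<forall>a \<phi>. \<Lambda> (\<lambda>c. a * \<phi> c) = a * \<Lambda> \<phi>" by (simp add: linear_functional_def)
  from this[rule_format, of 0 "\<lambda>_. 0"] show ?thesis by simp
qed

lemma linear_functional_sum:
  "linear_functional \<Lambda> \<Longrightarrow> \<Lambda> (\<lambda>c. \<Sum>a\<in>A. f a * \<phi> a c) = (\<Sum>a\<in>A. f a * \<Lambda> (\<phi> a))"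
proof (induction A rule: infinite_finite_induct)
  case (insert a A)
  have "\<Lambda> (\<lambda>c. f a * \<phi> a c + (\<Sum>a\<in>A. f a * \<phi> a c)) = \<Lambda> (\<lambda>c. f a * \<phi> a c) + \<Lambda> (\<lambda>c. \<Sum>a\<in>A. f a * \<phi> a c)"
    using insert.prems by (simp add: linear_functional_def)
  also have "\<Lambda> (\<lambda>c. f a * \<phi> a c) = f a * \<Lambda> (\<phi> a)"
    using insert.prems by (simp add: linear_functional_def)
  finally show ?case using insert by simp
qed (auto simp: linear_functional_zero)

lemma act_linear: "linear_functional (\<lambda>\<phi>. act w \<phi> c)"
proof -
  have add: "act w (\<lambda>c. \<phi> c + \<psi> c) c = act w \<phi> c + act w \<psi> c" for \<phi> \<psi>
  proof (induction w arbitrary: \<phi> \<psi> c)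
    case (Comp g f)
    have "act g (\<lambda>c. \<phi> c + \<psi> c) = (\<lambda>c. act g \<phi> c + act g \<psi> c)" by (rule ext) (rule Comp.IH(1))
    then show ?case using Comp.IH(2) by simp
  qed (auto simp: sum.distrib distrib_left)
  have mult: "act w (\<lambda>c. a * \<phi> c) c = a * act w \<phi> c" for a \<phi>
  proof (induction w arbitrary: \<phi> c)
    case (Comp g f)
    have "act g (\<lambda>c. a * \<phi> c) = (\<lambda>c. a * act g \<phi> c)" by (rule ext) (rule Comp.IH(1))
    then show ?case using Comp.IH(2) by simp
  qed (auto simp: sum_distrib_left mult.left_commute)
  show ?thesis unfolding linear_functional_def using add mult by blast
qed

text \<open>Webs act linearly on one variable while \<open>\<Lambda>\<close> acts on another.
  This is the source of the interchange law.\<close>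

lemma act_commute:
  "linear_functional \<Lambda> \<Longrightarrow> act f (\<lambda>d. \<Lambda> (h d)) c = \<Lambda> (\<lambda>e. act f (\<lambda>d. h d e) c)"
proof (induction f arbitrary: h c)
  case (Split a b)
  show ?case
    using linear_functional_sum[OF Split, of "\<lambda>S. qpow (inv_weight S (c ! 0 - S))" "\<lambda>S. h [S, c ! 0 - S]" "subsets (c ! 0) a"]
    by simp
next
  case (Comp g f)
  have "act g (\<lambda>d. \<Lambda> (h d)) = (\<lambda>c. \<Lambda> (\<lambda>e. act g (\<lambda>d. h d e) c))"
    by (rule ext) (rule Comp.IH(1)[OF Comp.prems])
  then show ?case using Comp.IH(2)[OF Comp.prems] by simp
qed auto

lemma act_swap: "act f (\<lambda>d. act g (h d) c') c = act g (\<lambda>e. act f (\<lambda>d. h d e) c) c'"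
  using act_commute[where \<Lambda> = "\<lambda>\<phi>. act g \<phi> c'", OF act_linear] by simp

definition typed :: "nat list \<Rightarrow> config \<Rightarrow> bool"
  where "typed x c \<longleftrightarrow> (\<forall>S\<in>set c. finite S) \<and> sorted_wrt (\<lambda>A B. A \<inter> B = {}) c \<and> map card c = x"

lemma typed_length: "typed x c \<Longrightarrow> length c = length x"
  by (auto simp: typed_def)

lemma typed_append:
  "length c = length x \<Longrightarrow> typed (x @ y) (c @ d) \<longleftrightarrow> typed x c \<and> typed y d \<and> \<Union>(set c) \<inter> \<Union>(set d) = {}"
  by (auto simp: typed_def sorted_wrt_append)

lemma typed_split:
  assumes "typed (x @ y) c"
  shows "typed x (take (length x) c)" "typed y (drop (length x) c)"
    "\<Union>(set (take (length x) c)) \<inter> \<Union>(set (drop (length x) c)) = {}"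
proof -
  have "length (take (length x) c) = length x" using typed_length[OF assms] by simp
  from typed_append[OF this, of y "drop (length x) c"] assms
  show "typed x (take (length x) c)" "typed y (drop (length x) c)"
    "\<Union>(set (take (length x) c)) \<inter> \<Union>(set (drop (length x) c)) = {}" by auto
qed

lemma Union_take_drop: "\<Union>(set (take n c)) \<union> \<Union>(set (drop n c)) = \<Union>(set c)"
  by (metis Union_Un_distrib append_take_drop_id set_append)

lemma typed_1: "typed [a] c \<longleftrightarrow> (\<exists>A. c = [A] \<and> finite A \<and> card A = a)"
  by (auto simp: typed_def map_eq_Cons_conv)

lemma typed_2: "typed [a, b] c \<longleftrightarrow> (\<exists>A B. c = [A, B] \<and> finite A \<and> finite B \<and> A \<inter> B = {} \<and> card A = a \<and> card B = b)"
  by (auto simp: typed_def map_eq_Cons_conv)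

text \<open>The function \<open>\<beta>\<close> labels the integers by source strands, which
  turns configurations into states.\<close>

definition row :: "(int \<Rightarrow> nat) \<Rightarrow> int set \<Rightarrow> nat multiset"
  where "row \<beta> S = image_mset \<beta> (mset_set S)"

lemma row_Un: "finite A \<Longrightarrow> finite B \<Longrightarrow> A \<inter> B = {} \<Longrightarrow> row \<beta> (A \<union> B) = row \<beta> A + row \<beta> B"
  by (simp add: row_def mset_set_Union)

lemma row_Diff: "finite U \<Longrightarrow> S \<subseteq> U \<Longrightarrow> row \<beta> U = row \<beta> S + row \<beta> (U - S)"
  using row_Un[of S "U - S" \<beta>] by (simp add: finite_subset Un_absorb1)

lemma size_row [simp]: "size (row \<beta> S) = card S"
  by (simp add: row_def)

lemma typed_sizes: "typed x c \<Longrightarrow> sizes (map (row \<beta>) c) = x"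
  by (simp add: typed_def o_def)

text \<open>Only configurations whose states are reachable contribute.\<close>

lemma act_cong:
  assumes "well_formed w" "typed (src w) c"
    "\<And>c'. typed (tgt w) c' \<Longrightarrow> \<Union>(set c') = \<Union>(set c) \<Longrightarrow> reach w (map (row \<beta>) c) (map (row \<beta>) c') \<Longrightarrow> \<phi> c' = \<psi> c'"
  shows "act w \<phi> c = act w \<psi> c"
  using assms
proof (induction w arbitrary: c \<phi> \<psi>)
  case (Id x)
  then have "sizes (map (row \<beta>) c) = x" using typed_sizes by simp
  then have "\<phi> c = \<psi> c" using Id.prems by (intro Id.prems(3)) (auto simp del: map_map)
  then show ?case by simp
next
  case (Merge a b)
  then obtain A B where c: "c = [A, B]" "finite A" "finite B" "A \<inter> B = {}" "card A = a" "card B = b"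
    by (auto simp: typed_2)
  have "\<phi> [A \<union> B] = \<psi> [A \<union> B]"
    using c by (intro Merge.prems(3)) (auto simp: typed_1 card_Un_disjoint row_Un)
  then show ?case using c by simp
next
  case (Split a b)
  then obtain U where c: "c = [U]" "finite U" "card U = a + b" by (auto simp: typed_1)
  have "\<phi> [S, U - S] = \<psi> [S, U - S]" if "S \<in> subsets U a" for S
  proof -
    have S: "S \<subseteq> U" "card S = a" "finite S" using that c by (auto simp: subsets_def finite_subset)
    then show ?thesis using c row_Diff[of U S \<beta>]
      by (intro Split.prems(3)) (auto simp: typed_2 card_Diff_subset)
  qed
  then show ?case using c by simp
next
  case (Comp g f)
  have "act f (act g \<phi>) c = act f (act g \<psi>) c"
  proof (rule Comp.IH(2))
    fix c' assume c': "typed (tgt f) c'" "\<Union>(set c') = \<Union>(set c)" "reach f (map (row \<beta>) c) (map (row \<beta>) c')"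
    show "act g \<phi> c' = act g \<psi> c'"
    proof (rule Comp.IH(1))
      fix c'' assume "typed (tgt g) c''" "\<Union>(set c'') = \<Union>(set c')" "reach g (map (row \<beta>) c') (map (row \<beta>) c'')"
      then show "\<phi> c'' = \<psi> c''" using c' by (intro Comp.prems(3)) auto
    qed (use Comp.prems c' in auto)
  qed (use Comp.prems in auto)
  then show ?case by simp
next
  case (Tens f g)
  let ?c1 = "take (length (src f)) c" and ?c2 = "drop (length (src f)) c"
  note t = typed_split[OF Tens.prems(2)[unfolded src.simps]]
  have "act f (\<lambda>d. act g (\<lambda>e. \<phi> (d @ e)) ?c2) ?c1 = act f (\<lambda>d. act g (\<lambda>e. \<psi> (d @ e)) ?c2) ?c1"
  proof (rule Tens.IH(1))
    fix d assume d: "typed (tgt f) d" "\<Union>(set d) = \<Union>(set ?c1)" "reach f (map (row \<beta>) ?c1) (map (row \<beta>) d)"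
    show "act g (\<lambda>e. \<phi> (d @ e)) ?c2 = act g (\<lambda>e. \<psi> (d @ e)) ?c2"
    proof (rule Tens.IH(2))
      fix e assume e: "typed (tgt g) e" "\<Union>(set e) = \<Union>(set ?c2)" "reach g (map (row \<beta>) ?c2) (map (row \<beta>) e)"
      show "\<phi> (d @ e) = \<psi> (d @ e)"
      proof (rule Tens.prems(3))
        show "typed (tgt (Tens f g)) (d @ e)"
          using d e t typed_append[of d "tgt f" "tgt g" e] typed_length[OF d(1)] by simp
        show "\<Union>(set (d @ e)) = \<Union>(set c)"
          using d(2) e(2) Union_take_drop[of "length (src f)" c] by simp
        have "map (row \<beta>) c = map (row \<beta>) ?c1 @ map (row \<beta>) ?c2" by (simp flip: map_append)
        moreover have "map (row \<beta>) (d @ e) = map (row \<beta>) d @ map (row \<beta>) e" by simp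
        ultimately show "reach (Tens f g) (map (row \<beta>) c) (map (row \<beta>) (d @ e))"
          unfolding reach.simps(5) using d(3) e(3) by blast
      qed
    qed (use Tens.prems t in auto)
  qed (use Tens.prems t in auto)
  then show ?case by simp
qed

lemma act_zero:
  assumes "well_formed w" "typed (src w) c"
    "\<And>c'. typed (tgt w) c' \<Longrightarrow> reach w (map (row \<beta>) c) (map (row \<beta>) c') \<Longrightarrow> \<phi> c' = 0"
  shows "act w \<phi> c = 0"
proof -
  have "act w \<phi> c = act w (\<lambda>c. 0) c" by (rule act_cong[where \<beta> = \<beta>]) (use assms in auto)
  then show ?thesis using linear_functional_zero[OF act_linear] by simp
qed

lemma act_nonneg: "(\<And>c. nonneg (\<phi> c)) \<Longrightarrow> nonneg (act w \<phi> c)"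
proof (induction w arbitrary: \<phi> c)
  case (Split a b)
  then show ?case by (auto intro!: nonneg_sum nonneg_qpow)
qed auto

lemma row_split:
  assumes "finite U" "row \<beta> U = A + B"
  obtains S where "S \<subseteq> U" "row \<beta> S = A" "row \<beta> (U - S) = B"
proof -
  obtain M N where MN: "mset_set U = M + N" "image_mset \<beta> M = A" "image_mset \<beta> N = B"
    using assms(2) unfolding row_def by (metis image_mset_eq_plusD)
  have sub: "set_mset M \<subseteq> U" using MN(1) assms(1) by (metis finite_set_mset_mset_set set_mset_union Un_upper1)
  have "count M i \<le> 1" for i
    using arg_cong[OF MN(1), of "\<lambda>M. count M i"] by (simp add: count_mset_set' split: if_splits)
  then have M: "M = mset_set (set_mset M)"
    by (intro multiset_eqI) (metis One_nat_def count_greater_zero_iff count_mset_set'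
        finite_set_mset le_antisym not_gr_zero not_in_iff Suc_leI)
  then have "row \<beta> (set_mset M) = A" using MN by (simp add: row_def)
  moreover from this have "row \<beta> (U - set_mset M) = B"
    using row_Diff[OF assms(1) sub, of \<beta>] assms(2) by simp
  ultimately show ?thesis using that sub by blast
qed

text \<open>All matrix coefficients are sums of powers of \<open>q\<close>, so a single path to
  the state \<open>t\<close> suffices.\<close>

lemma act_nonzero:
  assumes "well_formed w" "typed (src w) c" "reach w (map (row \<beta>) c) t" "\<And>c'. nonneg (\<phi> c')"
    "\<And>c'. typed (tgt w) c' \<Longrightarrow> \<Union>(set c') = \<Union>(set c) \<Longrightarrow> map (row \<beta>) c' = t \<Longrightarrow> \<phi> c' \<noteq> 0"
  shows "act w \<phi> c \<noteq> 0"
  using assms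
proof (induction w arbitrary: c t \<phi>)
  case (Id x)
  then show ?case by auto
next
  case (Merge a b)
  then obtain A B where c: "c = [A, B]" "finite A" "finite B" "A \<inter> B = {}" "card A = a" "card B = b"
    by (auto simp: typed_2)
  have "\<phi> [A \<union> B] \<noteq> 0"
    using c Merge.prems(3) by (intro Merge.prems(5)) (auto simp: typed_1 card_Un_disjoint row_Un)
  then show ?case using c by simp
next
  case (Split a b)
  then obtain U where c: "c = [U]" "finite U" "card U = a + b" by (auto simp: typed_1)
  with Split.prems(3) obtain A B where AB: "row \<beta> U = A + B" "t = [A, B]" "size A = a" "size B = b" by auto
  obtain S where S: "S \<subseteq> U" "row \<beta> S = A" "row \<beta> (U - S) = B" using row_split[OF c(2) AB(1)] .
  then have card: "card S = a" "card (U - S) = b" "finite S" using AB c size_row by (auto simp: finite_subset)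
  have "\<phi> [S, U - S] \<noteq> 0"
    using c AB S card by (intro Split.prems(5)) (auto simp: typed_2)
  then have "(\<Sum>S\<in>subsets U a. qpow (inv_weight S (U - S)) * \<phi> [S, U - S]) \<noteq> 0"
    using c S card Split.prems(4)
    by (intro nonneg_sum_nonzero[of _ _ S]) (auto simp: subsets_def intro!: nonneg_qpow)
  then show ?case using c by simp
next
  case (Comp g f)
  then obtain r where r: "reach f (map (row \<beta>) c) r" "reach g r t" by auto
  have "act f (act g \<phi>) c \<noteq> 0"
  proof (rule Comp.IH(2)[of _ r])
    fix c' assume c': "typed (tgt f) c'" "\<Union>(set c') = \<Union>(set c)" "map (row \<beta>) c' = r"
    then show "act g \<phi> c' \<noteq> 0"
      using Comp.prems r by (intro Comp.IH(1)[of c' t]) auto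
  qed (use Comp.prems r act_nonneg in auto)
  then show ?case by simp
next
  case (Tens f g)
  let ?c1 = "take (length (src f)) c" and ?c2 = "drop (length (src f)) c"
  note t = typed_split[OF Tens.prems(2)[unfolded src.simps]]
  from Tens.prems(3) obtain s1 s2 t1 t2 where s: "map (row \<beta>) c = s1 @ s2" "t = t1 @ t2" "reach f s1 t1" "reach g s2 t2"
    by auto
  have m: "map (row \<beta>) c = map (row \<beta>) ?c1 @ map (row \<beta>) ?c2" by (simp flip: map_append)
  have "sizes s1 = src f" using reach_props[OF s(3)] Tens.prems by simp
  then have "length s1 = length (src f)" by (metis length_map)
  moreover have "length (map (row \<beta>) ?c1) = length (src f)" using typed_length[OF t(1)] by simp
  ultimately have e: "s1 = map (row \<beta>) ?c1" "s2 = map (row \<beta>) ?c2"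
    using s(1) m by (metis append_eq_append_conv)+
  have "act f (\<lambda>d. act g (\<lambda>e. \<phi> (d @ e)) ?c2) ?c1 \<noteq> 0"
  proof (rule Tens.IH(1)[of _ t1])
    fix d assume d: "typed (tgt f) d" "\<Union>(set d) = \<Union>(set ?c1)" "map (row \<beta>) d = t1"
    show "act g (\<lambda>e. \<phi> (d @ e)) ?c2 \<noteq> 0"
    proof (rule Tens.IH(2)[of _ t2])
      fix e' assume e': "typed (tgt g) e'" "\<Union>(set e') = \<Union>(set ?c2)" "map (row \<beta>) e' = t2"
      show "\<phi> (d @ e') \<noteq> 0"
      proof (rule Tens.prems(5))
        show "typed (tgt (Tens f g)) (d @ e')"
          using d e' t typed_append[of d "tgt f" "tgt g" e'] typed_length[OF d(1)] by simp
        show "\<Union>(set (d @ e')) = \<Union>(set c)"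
          using d(2) e'(2) Union_take_drop[of "length (src f)" c] by simp
        show "map (row \<beta>) (d @ e') = t" using d e' s by simp
      qed
    qed (use Tens.prems t s e in auto)
  qed (use Tens.prems t s e act_nonneg in auto)
  then show ?case by simp
qed

section \<open>Monoidal and associativity relations in the representation\<close>

lemma act_fun_simps [simp]: "act (Id x) \<phi> = \<phi>" "act (Comp g f) \<phi> = act f (act g \<phi>)"
  by (auto simp: fun_eq_iff)

lemma structural_act:
  assumes "structural u v" "typed (src u) c"
  shows "act u \<phi> c = act v \<phi> c"
  using assms
proof cases
  case (tens_assoc f g h)
  then show ?thesis by (simp add: drop_take add.commute)
next
  case tens_unit_right
  then show ?thesis using typed_length[OF assms(2)] by simp
next
  case (interchange g f g' f')
  let ?c1 = "take (length (src f)) c" and ?c2 = "drop (length (src f)) c"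
  have wf: "well_formed f" "well_formed f'" "src g = tgt f" "src g' = tgt f'" using interchange by auto
  have "typed (src f @ src f') c" using assms(2) interchange by simp
  note t = typed_split[OF this]
  have "act v \<phi> c = act f (\<lambda>d. act f' (\<lambda>e. act (Tens g g') \<phi> (d @ e)) ?c2) ?c1"
    using interchange by simp
  also have "\<dots> = act f (\<lambda>d. act f' (\<lambda>e. act g (\<lambda>d'. act g' (\<lambda>e'. \<phi> (d' @ e')) e) d) ?c2) ?c1"
  proof (rule act_cong[where \<beta> = "\<lambda>_. 0"])
    fix d assume d: "typed (tgt f) d"
    then have "length d = length (src g)" using typed_length wf by metis
    then show "act f' (\<lambda>e. act (Tens g g') \<phi> (d @ e)) ?c2 = act f' (\<lambda>e. act g (\<lambda>d'. act g' (\<lambda>e'. \<phi> (d' @ e')) e) d) ?c2"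
      by simp
  qed (use wf t in auto)
  also have "\<dots> = act f (\<lambda>d. act g (\<lambda>d'. act f' (\<lambda>e. act g' (\<lambda>e'. \<phi> (d' @ e')) e) ?c2) d) ?c1"
    by (rule arg_cong2[where f = "act f"], rule ext, rule act_swap, rule HOL.refl)
  finally show ?thesis using interchange by simp
qed simp_all

lemma assoc_relation_act:
  assumes "assoc_relation u v" "typed (src u) c"
  shows "act u \<phi> c = act v \<phi> c"
  using assms
proof cases
  case (assoc a b k)
  then have "length c = 3" using typed_length[OF assms(2)] by simp
  then obtain A B C where "c = [A, B, C]" by (auto simp: length_Suc_conv numeral_3_eq_3)
  then show ?thesis using assoc by (simp add: Un_assoc)
next
  case (coassoc a b k)
  then obtain U where c: "c = [U]" "finite U" "card U = a + b + k" using assms(2) by (auto simp: typed_1)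
  let ?A = "SIGMA S:subsets U (a + b). subsets S a"
  let ?B = "SIGMA S:subsets U a. subsets (U - S) b"
  have fin: "\<forall>S\<in>subsets U (a + b). finite (subsets S a)" "\<forall>S\<in>subsets U a. finite (subsets (U - S) b)"
    using c by (auto intro!: finite_subsets simp: subsets_def[of U] finite_subset)
  have "act u \<phi> c = (\<Sum>S\<in>subsets U (a + b). \<Sum>R\<in>subsets S a.
      qpow (inv_weight S (U - S)) * (qpow (inv_weight R (S - R)) * \<phi> [R, S - R, U - S]))"
    using coassoc c by (simp add: sum_distrib_left)
  also have "\<dots> = (\<Sum>(S, R)\<in>?A. qpow (inv_weight S (U - S)) * (qpow (inv_weight R (S - R)) * \<phi> [R, S - R, U - S]))"
    using c fin by (intro sum.Sigma) auto
  also have "\<dots> = (\<Sum>(R, Q)\<in>?B. qpow (inv_weight R (U - R)) * (qpow (inv_weight Q (U - R - Q)) * \<phi> [R, Q, U - R - Q]))"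
  proof (rule sum.reindex_bij_witness[of _ "\<lambda>(R, Q). (R \<union> Q, R)" "\<lambda>(S, R). (R, S - R)"])
    fix p assume "p \<in> ?A"
    then obtain S R where p: "p = (S, R)" "S \<subseteq> U" "card S = a + b" "R \<subseteq> S" "card R = a" by (auto simp: subsets_def)
    then have f: "finite S" "finite R" using c by (auto intro: finite_subset)
    show "(case (case p of (S, R) \<Rightarrow> (R, S - R)) of (R, Q) \<Rightarrow> (R \<union> Q, R)) = p" using p by auto
    show "(case p of (S, R) \<Rightarrow> (R, S - R)) \<in> ?B" using p f by (auto simp: subsets_def card_Diff_subset)
    have e: "U - R - (S - R) = U - S" using p by auto
    have "U - R = (S - R) \<union> (U - S)" "(S - R) \<inter> (U - S) = {}" using p by auto
    then have "inv_weight R (U - R) = inv_weight R (S - R) + inv_weight R (U - S)"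
      using inv_weight_Un(2)[of "S - R" "U - S" R] f c by simp
    moreover have "inv_weight S (U - S) = inv_weight R (U - S) + inv_weight (S - R) (U - S)"
      using inv_weight_Un(1)[of R "S - R" "U - S"] p f by (simp add: Un_absorb1)
    ultimately show "(case (case p of (S, R) \<Rightarrow> (R, S - R)) of (R, Q) \<Rightarrow>
        qpow (inv_weight R (U - R)) * (qpow (inv_weight Q (U - R - Q)) * \<phi> [R, Q, U - R - Q])) =
      (case p of (S, R) \<Rightarrow> qpow (inv_weight S (U - S)) * (qpow (inv_weight R (S - R)) * \<phi> [R, S - R, U - S]))"
      unfolding p(1) by (simp add: e qpow_add mult.assoc[symmetric] add.commute add.left_commute)
  next
    fix p assume "p \<in> ?B"
    then obtain R Q where p: "p = (R, Q)" "R \<subseteq> U" "card R = a" "Q \<subseteq> U - R" "card Q = b" by (auto simp: subsets_def)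
    then have f: "finite Q" "finite R" using c by (auto intro: finite_subset)
    show "(case (case p of (R, Q) \<Rightarrow> (R \<union> Q, R)) of (S, R) \<Rightarrow> (R, S - R)) = p" using p by auto
    have "card (R \<union> Q) = a + b" using p f by (subst card_Un_disjoint) auto
    then show "(case p of (R, Q) \<Rightarrow> (R \<union> Q, R)) \<in> ?A" using p by (auto simp: subsets_def)
  qed
  also have "\<dots> = (\<Sum>R\<in>subsets U a. \<Sum>Q\<in>subsets (U - R) b.
      qpow (inv_weight R (U - R)) * (qpow (inv_weight Q (U - R - Q)) * \<phi> [R, Q, U - R - Q]))"
    using c fin by (intro sum.Sigma[symmetric]) auto
  also have "\<dots> = act v \<phi> c" using coassoc c by (simp add: sum_distrib_left)
  finally show ?thesis .
qed

section \<open>The action of linear combinations\<close>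

text \<open>The linear extension of \<open>act\<close> in the web; the one-point index set makes
  \<open>lin_ext\<close> applicable to scalars.\<close>

definition lin_act :: "lin_web \<Rightarrow> (config \<Rightarrow> laurent) \<Rightarrow> config \<Rightarrow> laurent"
  where "lin_act p \<phi> c = Poly_Mapping.lookup (lin_ext (\<lambda>w. Poly_Mapping.single () (act w \<phi> c)) p) ()"

lemma lin_act_simps [simp]:
  "lin_act 0 \<phi> c = 0" "lin_act (p + r) \<phi> c = lin_act p \<phi> c + lin_act r \<phi> c"
  "lin_act (p - r) \<phi> c = lin_act p \<phi> c - lin_act r \<phi> c"
  "lin_act (smul a p) \<phi> c = a * lin_act p \<phi> c"
  "lin_act (Poly_Mapping.single w a) \<phi> c = a * act w \<phi> c"
  "lin_act (of_web w) \<phi> c = act w \<phi> c"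
  by (simp_all add: lin_act_def lookup_add lookup_minus of_web_def)

lemma lin_act_sum [simp]: "lin_act (\<Sum>a\<in>A. f a) \<phi> c = (\<Sum>a\<in>A. lin_act (f a) \<phi> c)"
  by (induction A rule: infinite_finite_induct) auto

lemma lin_act_expand: "lin_act p \<phi> c = (\<Sum>w\<in>Poly_Mapping.keys p. Poly_Mapping.lookup p w * act w \<phi> c)"
  by (simp add: lin_act_def lin_ext_def lookup_sum)

lemma act_add: "act w (\<lambda>c. \<phi> c + \<psi> c) c = act w \<phi> c + act w \<psi> c"
  and act_mult: "act w (\<lambda>c. a * \<phi> c) c = a * act w \<phi> c"
  and act_0: "act w (\<lambda>c. 0) c = 0"
  using act_linear[of w c] linear_functional_zero[OF act_linear[of w c]]
  by (auto simp: linear_functional_def)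

lemma lin_act_comp: "lin_act (lin_comp p r) \<phi> c = lin_act r (\<lambda>c'. lin_act p \<phi> c') c"
  using subset_UNIV
proof (induction r rule: poly_mapping_span_induct)
  case (single v b)
  show ?case
    using subset_UNIV
  proof (induction p rule: poly_mapping_span_induct)
    case (single w a)
    then show ?case by (simp add: act_mult mult.assoc mult.left_commute)
  qed (simp_all add: act_0 act_add distrib_left)
qed simp_all

lemma lin_act_tens_left:
  "lin_act (lin_tens (of_web w) p) \<phi> c =
    act w (\<lambda>d. lin_act p (\<lambda>e. \<phi> (d @ e)) (drop (length (src w)) c)) (take (length (src w)) c)"
  using subset_UNIV
proof (induction p rule: poly_mapping_span_induct)
  case (single v b)
  then show ?case by (simp add: act_mult of_web_def)
qed (simp_all add: act_0 act_add)

lemma lin_act_tens_right: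
  assumes "Poly_Mapping.keys p \<subseteq> webs x y"
  shows "lin_act (lin_tens p (of_web w)) \<phi> c =
    lin_act p (\<lambda>d. act w (\<lambda>e. \<phi> (d @ e)) (drop (length x) c)) (take (length x) c)"
  using assms
proof (induction p rule: poly_mapping_span_induct)
  case (single v b)
  then show ?case by (simp add: act_mult of_web_def webs_def)
qed simp_all

section \<open>The action of ladders\<close>

text \<open>Strands of thickness 0 are erased, so the corresponding empty sets are erased as
  well.\<close>

definition drop_empty :: "config \<Rightarrow> config"
  where "drop_empty c = filter (\<lambda>S. S \<noteq> {}) c"

lemma drop_empty_append: "drop_empty (c @ d) = drop_empty c @ drop_empty d"
  by (simp add: drop_empty_def)

lemma drop_empty_length: "finite A \<Longrightarrow> length (drop_empty [A]) = length (erase [card A])"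
  by (simp add: drop_empty_def erase_def)

lemma drop_empty_length2: "finite A \<Longrightarrow> finite B \<Longrightarrow> length (drop_empty [A, B]) = length (erase [card A, card B])"
  by (simp add: drop_empty_def erase_def)

lemma typed_erase_pair:
  assumes "typed (erase [a, x]) c"
  obtains A X where "c = drop_empty [A, X]" "finite A" "finite X" "A \<inter> X = {}" "card A = a" "card X = x"
proof -
  consider "a = 0" "x = 0" | "a = 0" "x > 0" | "a > 0" "x = 0" | "a > 0" "x > 0" by linarith
  then show ?thesis
  proof cases
    case 1
    then show ?thesis using assms that[of "{}" "{}"] by (auto simp: erase_def typed_def drop_empty_def)
  next
    case 2
    then obtain X where "c = [X]" "finite X" "card X = x" using assms by (auto simp: erase_def typed_1)
    moreover from this 2 have "X \<noteq> {}" by auto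
    ultimately show ?thesis using 2 that[of "{}" X] by (simp add: drop_empty_def)
  next
    case 3
    then obtain A where "c = [A]" "finite A" "card A = a" using assms by (auto simp: erase_def typed_1)
    moreover from this 3 have "A \<noteq> {}" by auto
    ultimately show ?thesis using 3 that[of A "{}"] by (simp add: drop_empty_def)
  next
    case 4
    then obtain A X where "c = [A, X]" "finite A" "finite X" "A \<inter> X = {}" "card A = a" "card X = x"
      using assms by (auto simp: erase_def typed_2)
    moreover from this 4 have "A \<noteq> {}" "X \<noteq> {}" by auto
    ultimately show ?thesis using 4 that[of A X] by (simp add: drop_empty_def)
  qed
qed

lemma act_idw [simp]: "act (idw a) \<phi> c = \<phi> c"
  by (simp add: idw_def)

lemma act_merge:
  assumes "finite A" "finite B" "card A = a" "card B = b"
  shows "act (merge a b) \<phi> (drop_empty [A, B]) = \<phi> (drop_empty [A \<union> B])"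
  using assms by (auto simp: merge_def idw_def drop_empty_def)

text \<open>With a thickness equal to 0 the sum has a single term of weight 1, in agreement with
  the identity web.\<close>

lemma act_split:
  assumes "finite U" "card U = a + b"
  shows "act (split a b) \<phi> (drop_empty [U]) =
    (\<Sum>S\<in>subsets U a. qpow (inv_weight S (U - S)) * \<phi> (drop_empty [S, U - S]))"
proof -
  consider "a = 0" | "a > 0" "b = 0" | "a > 0" "b > 0" by linarith
  then show ?thesis
  proof cases
    case 1
    then show ?thesis using assms by (simp add: split_def idw_def drop_empty_def qpow_0)
  next
    case 2
    have "subsets U (card U) = {U}" using assms(1) card_subset_eq[of U] by (auto simp: subsets_def)
    then show ?thesis using 2 assms by (simp add: split_def idw_def drop_empty_def qpow_0)
  next
    case 3
    have "\<phi> (drop_empty [S, U - S]) = \<phi> [S, U - S]" if "S \<in> subsets U a" for S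
    proof -
      have "S \<noteq> {}" using that 3 by (auto simp: subsets_def)
      moreover have "U - S \<noteq> {}"
      proof
        assume "U - S = {}"
        then have "S = U" using that by (auto simp: subsets_def)
        then show False using that 3 assms by (auto simp: subsets_def)
      qed
      ultimately show ?thesis by (simp add: drop_empty_def)
    qed
    moreover have "drop_empty [U] = [U]" using 3 assms by (auto simp: drop_empty_def)
    ultimately show ?thesis using 3 by (simp add: split_def)
  qed
qed

lemma act_Tens_drop_empty:
  assumes "length (src f) = length (drop_empty c1)"
  shows "act (Tens f g) \<phi> (drop_empty (c1 @ c2)) = act f (\<lambda>d. act g (\<lambda>e. \<phi> (d @ e)) (drop_empty c2)) (drop_empty c1)"
  using assms by (simp add: drop_empty_append)

lemma finite_in_subsets: "finite K \<Longrightarrow> Y \<in> subsets K n \<Longrightarrow> finite Y \<and> Y \<subseteq> K \<and> card Y = n"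
  by (auto simp: subsets_def finite_subset)

lemma lin_act_E:
  assumes "finite A" "finite X" "card A = a" "card X = x"
  shows "lin_act (E f a x) \<phi> (drop_empty [A, X]) =
    (\<Sum>P\<in>subsets X f. qpow (inv_weight P (X - P)) * \<phi> (drop_empty [A \<union> P, X - P]))"
proof (cases "f \<le> x")
  case True
  have l: "length (src (idw a)) = length (drop_empty [A])"
    using assms drop_empty_length[of A] by (simp add: idw_props)
  have "act (Eweb f a x) \<phi> (drop_empty ([A] @ [X])) =
    act (split f (x - f)) (\<lambda>e. act (Tens (merge a f) (idw (x - f))) \<phi> (drop_empty [A] @ e)) (drop_empty [X])"
    unfolding Eweb_def act.simps(4) act_Tens_drop_empty[OF l] by simp
  also have "\<dots> = (\<Sum>P\<in>subsets X f. qpow (inv_weight P (X - P)) *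
      act (Tens (merge a f) (idw (x - f))) \<phi> (drop_empty ([A, P] @ [X - P])))"
    using assms True by (subst act_split) (auto simp flip: drop_empty_append)
  also have "\<dots> = (\<Sum>P\<in>subsets X f. qpow (inv_weight P (X - P)) * \<phi> (drop_empty [A \<union> P, X - P]))"
  proof (rule sum.cong[OF HOL.refl])
    fix P assume "P \<in> subsets X f"
    note P = finite_in_subsets[OF assms(2) this]
    have "length (src (merge a f)) = length (drop_empty [A, P])"
      using assms P drop_empty_length2[of A P] by (simp add: merge_props)
    then have "act (Tens (merge a f) (idw (x - f))) \<phi> (drop_empty ([A, P] @ [X - P])) = \<phi> (drop_empty ([A \<union> P] @ [X - P]))"
      unfolding act_Tens_drop_empty[OF \<open>length (src (merge a f)) = length (drop_empty [A, P])\<close>]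
      unfolding drop_empty_append using act_merge[of A P a f] assms P by simp
    then show "qpow (inv_weight P (X - P)) * act (Tens (merge a f) (idw (x - f))) \<phi> (drop_empty ([A, P] @ [X - P])) =
      qpow (inv_weight P (X - P)) * \<phi> (drop_empty [A \<union> P, X - P])" by simp
  qed
  finally show ?thesis using True by (simp add: E_eq)
next
  case False
  then have "subsets X f = {}" using assms card_mono by (auto simp: subsets_def)
  then show ?thesis using False by (simp add: E_def)
qed

lemma lin_act_F:
  assumes "finite A" "finite X" "card A = a" "card X = x"
  shows "lin_act (F g a x) \<phi> (drop_empty [A, X]) =
    (\<Sum>G\<in>subsets A g. qpow (inv_weight (A - G) G) * \<phi> (drop_empty [A - G, G \<union> X]))"
proof (cases "g \<le> a")
  case True
  have l: "length (src (split (a - g) g)) = length (drop_empty [A])"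
    using assms True drop_empty_length[of A] by (simp add: split_props)
  have "act (Fweb g a x) \<phi> (drop_empty ([A] @ [X])) =
    act (split (a - g) g) (\<lambda>d. act (Tens (idw (a - g)) (merge g x)) \<phi> (d @ drop_empty [X])) (drop_empty [A])"
    unfolding Fweb_def act.simps(4) act_Tens_drop_empty[OF l] by simp
  also have "\<dots> = (\<Sum>S\<in>subsets A (a - g). qpow (inv_weight S (A - S)) *
      act (Tens (idw (a - g)) (merge g x)) \<phi> (drop_empty ([S] @ [A - S, X])))"
    using assms True by (subst act_split) (auto simp flip: drop_empty_append)
  also have "\<dots> = (\<Sum>S\<in>subsets A (a - g). qpow (inv_weight S (A - S)) * \<phi> (drop_empty [S, (A - S) \<union> X]))"
  proof (rule sum.cong[OF HOL.refl])
    fix S assume "S \<in> subsets A (a - g)"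
    note S = finite_in_subsets[OF assms(1) this]
    have "card (A - S) = g" using S assms True by (simp add: card_Diff_subset)
    have l: "length (src (idw (a - g))) = length (drop_empty [S])"
      using S drop_empty_length[of S] by (simp add: idw_props)
    have "act (Tens (idw (a - g)) (merge g x)) \<phi> (drop_empty ([S] @ [A - S, X])) = \<phi> (drop_empty ([S] @ [(A - S) \<union> X]))"
      unfolding act_Tens_drop_empty[OF l]
      unfolding drop_empty_append using act_merge[of "A - S" X g x] assms S \<open>card (A - S) = g\<close> by simp
    then show "qpow (inv_weight S (A - S)) * act (Tens (idw (a - g)) (merge g x)) \<phi> (drop_empty ([S] @ [A - S, X])) =
      qpow (inv_weight S (A - S)) * \<phi> (drop_empty [S, (A - S) \<union> X])" by simp
  qed
  also have "\<dots> = (\<Sum>G\<in>subsets A g. qpow (inv_weight (A - G) G) * \<phi> (drop_empty [A - G, G \<union> X]))"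
  proof (rule sum.reindex_bij_witness[of _ "\<lambda>G. A - G" "\<lambda>S. A - S"])
    fix S assume "S \<in> subsets A (a - g)"
    note S = finite_in_subsets[OF assms(1) this]
    then show "A - (A - S) = S" "A - S \<in> subsets A g"
      using assms True by (auto simp: subsets_def card_Diff_subset)
    then show "qpow (inv_weight (A - (A - S)) (A - S)) * \<phi> (drop_empty [A - (A - S), A - S \<union> X]) =
      qpow (inv_weight S (A - S)) * \<phi> (drop_empty [S, A - S \<union> X])" by simp
  next
    fix G assume "G \<in> subsets A g"
    note G = finite_in_subsets[OF assms(1) this]
    then show "A - (A - G) = G" "A - G \<in> subsets A (a - g)"
      using assms True by (auto simp: subsets_def card_Diff_subset)
  qed
  finally show ?thesis using True by (simp add: F_eq)
next
  case False
  then have "subsets A g = {}" using assms card_mono by (auto simp: subsets_def)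
  then show ?thesis using False by (simp add: F_def)
qed

section \<open>Square flops in the representation\<close>

text \<open>A term of a ladder on strands \<open>A\<close> and \<open>X\<close> is determined by
  the set \<open>D\<close> that moves to the right for good, the set \<open>H\<close> that moves
  to the left for good, and the set that moves over and back. The first two determine the final
  configuration and a common power of \<open>q\<close>.\<close>

definition flop_base :: "(config \<Rightarrow> laurent) \<Rightarrow> int set \<Rightarrow> int set \<Rightarrow> int set \<Rightarrow> int set \<Rightarrow> laurent"
  where "flop_base \<phi> A X D H = qpow (inv_weight H (X - H) + inv_weight H D + inv_weight (A - D) D) *
    \<phi> (drop_empty [(A - D) \<union> H, D \<union> (X - H)])"

text \<open>The rungs carry \<open>f\<close> units to the left and \<open>g\<close> to the
  right, so \<open>f - card H\<close> and \<open>g - card D\<close> are both the number of units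
  that move over and back.\<close>

definition flop_coeff :: "(nat \<Rightarrow> laurent) \<Rightarrow> nat \<Rightarrow> nat \<Rightarrow> int set \<Rightarrow> int set \<Rightarrow> laurent"
  where "flop_coeff L f g D H = (if card H \<le> f \<and> f + card D = g + card H then L (f - card H) else 0)"

lemma flop_coeff_sum:
  assumes "finite K"
  shows "flop_coeff (subset_sum \<epsilon> C K) f g D H =
    (\<Sum>Y\<in>{Y. Y \<subseteq> K \<and> card H + card Y = f \<and> card D + card Y = g}. qpow (\<epsilon> * (inv_weight Y (K - Y) + inv_weight C Y)))"
proof (cases "card H \<le> f \<and> f + card D = g + card H")
  case True
  then have "{Y. Y \<subseteq> K \<and> card H + card Y = f \<and> card D + card Y = g} = subsets K (f - card H)"
    by (auto simp: subsets_def)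
  then show ?thesis using True by (simp add: flop_coeff_def subset_sum_def)
next
  case False
  then have e: "{Y. Y \<subseteq> K \<and> card H + card Y = f \<and> card D + card Y = g} = {}" by auto
  show ?thesis unfolding e flop_coeff_def using False by (simp only: if_False sum.empty)
qed

lemma qpow_rearrange: "a + b = c + d \<Longrightarrow> qpow a * (qpow b * p) = qpow c * p * qpow d"
  by (metis mult.assoc mult.commute qpow_add)

text \<open>The rungs carry \<open>P\<close> to the left and then \<open>G\<close> to the right;
  the elements of \<open>G \<inter> P\<close> move over and back.\<close>

lemma FE_sum:
  assumes "finite A" "finite X" "A \<inter> X = {}"
  shows "(\<Sum>P\<in>subsets X f. qpow (inv_weight P (X - P)) * (\<Sum>G\<in>subsets (A \<union> P) g.
      qpow (inv_weight ((A \<union> P) - G) G) * \<phi> (drop_empty [(A \<union> P) - G, G \<union> (X - P)]))) =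
    (\<Sum>(D, H)\<in>Pow A \<times> Pow X. flop_base \<phi> A X D H * flop_coeff (subset_sum 1 (A - D) (X - H)) f g D H)"
proof -
  let ?S = "SIGMA P:subsets X f. subsets (A \<union> P) g"
  let ?Y = "\<lambda>(D, H). {Y. Y \<subseteq> X - H \<and> card H + card Y = f \<and> card D + card Y = g}"
  let ?R = "SIGMA p:Pow A \<times> Pow X. ?Y p"
  let ?l = "\<lambda>P G. qpow (inv_weight P (X - P)) * (qpow (inv_weight ((A \<union> P) - G) G) * \<phi> (drop_empty [(A \<union> P) - G, G \<union> (X - P)]))"
  let ?r = "\<lambda>(D, H) Y. flop_base \<phi> A X D H * qpow (1 * (inv_weight Y (X - H - Y) + inv_weight (A - D) Y))"
  have finY: "finite (?Y p)" for p using assms by (cases p) auto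
  have "(\<Sum>P\<in>subsets X f. qpow (inv_weight P (X - P)) * (\<Sum>G\<in>subsets (A \<union> P) g.
      qpow (inv_weight ((A \<union> P) - G) G) * \<phi> (drop_empty [(A \<union> P) - G, G \<union> (X - P)]))) = (\<Sum>P\<in>subsets X f. \<Sum>G\<in>subsets (A \<union> P) g. ?l P G)"
    by (simp add: sum_distrib_left)
  also have "\<dots> = (\<Sum>(P, G)\<in>?S. ?l P G)"
    using assms finite_in_subsets[OF assms(2)] by (intro sum.Sigma) auto
  also have "\<dots> = (\<Sum>(p, Y)\<in>?R. ?r p Y)"
  proof (rule sum.reindex_bij_witness[of _ "\<lambda>((D, H), Y). (H \<union> Y, D \<union> Y)" "\<lambda>(P, G). ((G \<inter> A, P - G), G \<inter> P)"])
    fix s assume "s \<in> ?S"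
    then obtain P G where s: "s = (P, G)" "P \<in> subsets X f" "G \<in> subsets (A \<union> P) g" by auto
    note P = finite_in_subsets[OF assms(2) s(2)]
    have G: "finite G" "G \<subseteq> A \<union> P" "card G = g" using finite_in_subsets[OF _ s(3)] assms P by auto
    show "(\<lambda>((D, H), Y). (H \<union> Y, D \<union> Y)) ((\<lambda>(P, G). ((G \<inter> A, P - G), G \<inter> P)) s) = s"
      using s(1) G by auto
    have "(P - G) \<inter> (G \<inter> P) = {}" "(P - G) \<union> (G \<inter> P) = P" by auto
    then have "card (P - G) + card (G \<inter> P) = card P"
      using card_Un_disjoint[of "P - G" "G \<inter> P"] P by simp
    moreover have "G \<inter> A \<union> G \<inter> P = G" "G \<inter> A \<inter> (G \<inter> P) = {}" using G P assms(3) by auto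
    then have "card (G \<inter> A) + card (G \<inter> P) = card G"
      using card_Un_disjoint[of "G \<inter> A" "G \<inter> P"] G by simp
    ultimately show "(\<lambda>(P, G). ((G \<inter> A, P - G), G \<inter> P)) s \<in> ?R" using s(1) P G by auto
    define D H Y where d: "D = G \<inter> A" "H = P - G" "Y = G \<inter> P"
    define C K where CK: "C = A - D" "K = X - H"
    have e: "P = H \<union> Y" "G = D \<union> Y" "(A \<union> P) - G = C \<union> H" "X - P = K - Y" "G \<union> (X - P) = D \<union> K" "Y \<subseteq> K"
      using G P assms(3) by (auto simp: d CK)
    have fin: "finite D" "finite H" "finite Y" "finite C" "finite K" using P G assms by (auto simp: d CK)
    have disj: "H \<inter> Y = {}" "D \<inter> Y = {}" "C \<inter> H = {}" using G P assms(3) by (auto simp: d CK)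
    have "K = Y \<union> (K - Y)" using e by auto
    then have w3: "inv_weight H K = inv_weight H Y + inv_weight H (K - Y)"
      using inv_weight_Un(2)[of Y "K - Y" H] fin by auto
    have w1: "inv_weight P (X - P) = inv_weight H (K - Y) + inv_weight Y (K - Y)"
      unfolding e(4) unfolding e(1) using inv_weight_Un(1)[of H Y] fin disj by simp
    have w2: "inv_weight ((A \<union> P) - G) G = inv_weight C D + inv_weight C Y + inv_weight H D + inv_weight H Y"
      unfolding e(3) unfolding e(2) using inv_weight_Un(1)[of C H] inv_weight_Un(2)[of D Y] fin disj by simp
    have "?l P G = qpow (inv_weight H K + inv_weight H D + inv_weight C D) * \<phi> (drop_empty [C \<union> H, D \<union> K]) *
      qpow (1 * (inv_weight Y (K - Y) + inv_weight C Y))"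
      unfolding w1 w2 w3 unfolding e(3,5) by (rule qpow_rearrange) simp
    also have "\<dots> = ?r (D, H) Y" by (simp add: flop_base_def CK)
    finally show "(\<lambda>(p, Y). ?r p Y) ((\<lambda>(P, G). ((G \<inter> A, P - G), G \<inter> P)) s) = (\<lambda>(P, G). ?l P G) s"
      unfolding s(1) d by simp
  next
    fix s assume "s \<in> ?R"
    then obtain D H Y where s: "s = ((D, H), Y)" "D \<subseteq> A" "H \<subseteq> X" "Y \<subseteq> X - H" "card H + card Y = f" "card D + card Y = g"
      by auto
    then have fin: "finite D" "finite H" "finite Y" using assms by (auto intro: finite_subset)
    show "(\<lambda>(P, G). ((G \<inter> A, P - G), G \<inter> P)) ((\<lambda>((D, H), Y). (H \<union> Y, D \<union> Y)) s) = s"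
      using s assms(3) by auto
    have "card (H \<union> Y) = f" using s fin by (subst card_Un_disjoint) auto
    moreover have "card (D \<union> Y) = g" using s fin assms(3) by (subst card_Un_disjoint) auto
    ultimately show "(\<lambda>((D, H), Y). (H \<union> Y, D \<union> Y)) s \<in> ?S" using s by (auto simp: subsets_def)
  qed
  also have "\<dots> = (\<Sum>p\<in>Pow A \<times> Pow X. \<Sum>Y\<in>?Y p. ?r p Y)"
    using assms finY by (intro sum.Sigma[symmetric]) auto
  also have "\<dots> = (\<Sum>(D, H)\<in>Pow A \<times> Pow X. flop_base \<phi> A X D H * flop_coeff (subset_sum 1 (A - D) (X - H)) f g D H)"
    by (intro sum.cong HOL.refl) (auto simp: flop_coeff_sum assms sum_distrib_left)
  finally show ?thesis .
qed

text \<open>Here the rungs carry first \<open>G\<close> to the right and then \<open>P\<close>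
  to the left.\<close>

lemma EF_sum:
  assumes "finite A" "finite X" "A \<inter> X = {}"
  shows "(\<Sum>G\<in>subsets A g. qpow (inv_weight (A - G) G) * (\<Sum>P\<in>subsets (G \<union> X) f.
      qpow (inv_weight P ((G \<union> X) - P)) * \<phi> (drop_empty [(A - G) \<union> P, (G \<union> X) - P]))) =
    (\<Sum>(D, H)\<in>Pow A \<times> Pow X. flop_base \<phi> A X D H * flop_coeff (subset_sum (- 1) (X - H) (A - D)) f g D H)"
proof -
  let ?S = "SIGMA G:subsets A g. subsets (G \<union> X) f"
  let ?Y = "\<lambda>(D, H). {Z. Z \<subseteq> A - D \<and> card H + card Z = f \<and> card D + card Z = g}"
  let ?R = "SIGMA p:Pow A \<times> Pow X. ?Y p"
  let ?l = "\<lambda>G P. qpow (inv_weight (A - G) G) * (qpow (inv_weight P ((G \<union> X) - P)) * \<phi> (drop_empty [(A - G) \<union> P, (G \<union> X) - P]))"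
  let ?r = "\<lambda>(D, H) Z. flop_base \<phi> A X D H * qpow (- 1 * (inv_weight Z (A - D - Z) + inv_weight (X - H) Z))"
  have finY: "finite (?Y p)" for p using assms by (cases p) auto
  have "(\<Sum>G\<in>subsets A g. qpow (inv_weight (A - G) G) * (\<Sum>P\<in>subsets (G \<union> X) f.
      qpow (inv_weight P ((G \<union> X) - P)) * \<phi> (drop_empty [(A - G) \<union> P, (G \<union> X) - P]))) = (\<Sum>G\<in>subsets A g. \<Sum>P\<in>subsets (G \<union> X) f. ?l G P)"
    by (simp add: sum_distrib_left)
  also have "\<dots> = (\<Sum>(G, P)\<in>?S. ?l G P)"
    using assms finite_in_subsets[OF assms(1)] by (intro sum.Sigma) auto
  also have "\<dots> = (\<Sum>(p, Z)\<in>?R. ?r p Z)"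
  proof (rule sum.reindex_bij_witness[of _ "\<lambda>((D, H), Z). (D \<union> Z, H \<union> Z)" "\<lambda>(G, P). ((G - P, P \<inter> X), G \<inter> P)"])
    fix s assume "s \<in> ?S"
    then obtain P G where s: "s = (G, P)" "G \<in> subsets A g" "P \<in> subsets (G \<union> X) f" by auto
    note G = finite_in_subsets[OF assms(1) s(2)]
    have P: "finite P" "P \<subseteq> G \<union> X" "card P = f" using finite_in_subsets[OF _ s(3)] assms G by auto
    show "(\<lambda>((D, H), Z). (D \<union> Z, H \<union> Z)) ((\<lambda>(G, P). ((G - P, P \<inter> X), G \<inter> P)) s) = s"
      using s(1) P by auto
    have "(G - P) \<inter> (G \<inter> P) = {}" "(G - P) \<union> (G \<inter> P) = G" by auto
    then have "card (G - P) + card (G \<inter> P) = card G"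
      using card_Un_disjoint[of "G - P" "G \<inter> P"] G by simp
    moreover have "P \<inter> X \<union> G \<inter> P = P" "P \<inter> X \<inter> (G \<inter> P) = {}" using G P assms(3) by auto
    then have "card (P \<inter> X) + card (G \<inter> P) = card P"
      using card_Un_disjoint[of "P \<inter> X" "G \<inter> P"] G P by simp
    ultimately show "(\<lambda>(G, P). ((G - P, P \<inter> X), G \<inter> P)) s \<in> ?R" using s(1) P G by auto
    define D H Z where d: "D = G - P" "H = P \<inter> X" "Z = G \<inter> P"
    define C K where CK: "C = A - D" "K = X - H"
    have e: "P = H \<union> Z" "G = D \<union> Z" "A - G = C - Z" "(G \<union> X) - P = D \<union> K" "(A - G) \<union> P = C \<union> H" "Z \<subseteq> C"
      using G P assms(3) by (auto simp: d CK)
    have fin: "finite D" "finite H" "finite Z" "finite C" "finite K" using P G assms by (auto simp: d CK)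
    have disj: "H \<inter> Z = {}" "D \<inter> Z = {}" "D \<inter> K = {}" using G P assms(3) by (auto simp: d CK)
    have "C = Z \<union> (C - Z)" using e by auto
    then have w3: "inv_weight C D = inv_weight Z D + inv_weight (C - Z) D"
      using inv_weight_Un(1)[of Z "C - Z" D] fin by auto
    have w1: "inv_weight (A - G) G = inv_weight (C - Z) D + inv_weight (C - Z) Z"
      unfolding e(3) unfolding e(2) using inv_weight_Un(2)[of D Z] fin disj by simp
    have w2: "inv_weight P ((G \<union> X) - P) = inv_weight H D + inv_weight H K + inv_weight Z D + inv_weight Z K"
      unfolding e(4) unfolding e(1) using inv_weight_Un(1)[of H Z] inv_weight_Un(2)[of D K] fin disj by simp
    have w4: "- 1 * (inv_weight Z (C - Z) + inv_weight K Z) = inv_weight (C - Z) Z + inv_weight Z K"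
      using inv_weight_antisym[of Z "C - Z"] inv_weight_antisym[of K Z] by simp
    have "?l G P = qpow (inv_weight H K + inv_weight H D + inv_weight C D) * \<phi> (drop_empty [C \<union> H, D \<union> K]) *
      qpow (- 1 * (inv_weight Z (C - Z) + inv_weight K Z))"
      unfolding w1 w2 w3 w4 unfolding e(4,5) by (rule qpow_rearrange) simp
    also have "\<dots> = ?r (D, H) Z" by (simp add: flop_base_def CK)
    finally show "(\<lambda>(p, Z). ?r p Z) ((\<lambda>(G, P). ((G - P, P \<inter> X), G \<inter> P)) s) = (\<lambda>(G, P). ?l G P) s"
      unfolding s(1) d by simp
  next
    fix s assume "s \<in> ?R"
    then obtain D H Z where s: "s = ((D, H), Z)" "D \<subseteq> A" "H \<subseteq> X" "Z \<subseteq> A - D" "card H + card Z = f" "card D + card Z = g"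
      by auto
    then have fin: "finite D" "finite H" "finite Z" using assms by (auto intro: finite_subset)
    show "(\<lambda>(G, P). ((G - P, P \<inter> X), G \<inter> P)) ((\<lambda>((D, H), Z). (D \<union> Z, H \<union> Z)) s) = s"
      using s assms(3) by auto
    have "card (H \<union> Z) = f" using s fin assms(3) by (subst card_Un_disjoint) auto
    moreover have "card (D \<union> Z) = g" using s fin by (subst card_Un_disjoint) auto
    ultimately show "(\<lambda>((D, H), Z). (D \<union> Z, H \<union> Z)) s \<in> ?S" using s by (auto simp: subsets_def)
  qed
  also have "\<dots> = (\<Sum>p\<in>Pow A \<times> Pow X. \<Sum>Y\<in>?Y p. ?r p Y)"
    using assms finY by (intro sum.Sigma[symmetric]) auto
  also have "\<dots> = (\<Sum>(D, H)\<in>Pow A \<times> Pow X. flop_base \<phi> A X D H * flop_coeff (subset_sum (- 1) (X - H) (A - D)) f g D H)"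
    by (intro sum.cong HOL.refl) (auto simp: flop_coeff_sum assms sum_distrib_left)
  finally show ?thesis .
qed

lemma lin_act_FE:
  assumes "finite A" "finite X" "A \<inter> X = {}" "card A = a" "card X = x"
  shows "lin_act (lin_comp (F g (a + f) (x - f)) (E f a x)) \<phi> (drop_empty [A, X]) =
    (\<Sum>(D, H)\<in>Pow A \<times> Pow X. flop_base \<phi> A X D H * flop_coeff (subset_sum 1 (A - D) (X - H)) f g D H)"
proof -
  have "lin_act (F g (a + f) (x - f)) \<phi> (drop_empty [A \<union> P, X - P]) =
    (\<Sum>G\<in>subsets (A \<union> P) g. qpow (inv_weight ((A \<union> P) - G) G) * \<phi> (drop_empty [(A \<union> P) - G, G \<union> (X - P)]))"
    if "P \<in> subsets X f" for P
  proof -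
    note P = finite_in_subsets[OF assms(2) that]
    have "card (A \<union> P) = a + f" using P assms by (subst card_Un_disjoint) auto
    moreover have "card (X - P) = x - f" using P assms by (simp add: card_Diff_subset)
    ultimately show ?thesis using P assms by (intro lin_act_F) auto
  qed
  then show ?thesis unfolding lin_act_comp lin_act_E[OF assms(1,2,4,5)]
    using FE_sum[OF assms(1-3), where f = f and g = g and \<phi> = \<phi>] by simp
qed

lemma lin_act_EF:
  assumes "finite A" "finite X" "A \<inter> X = {}" "card A = a" "card X = x"
  shows "lin_act (lin_comp (E f (a - g) (x + g)) (F g a x)) \<phi> (drop_empty [A, X]) =
    (\<Sum>(D, H)\<in>Pow A \<times> Pow X. flop_base \<phi> A X D H * flop_coeff (subset_sum (- 1) (X - H) (A - D)) f g D H)"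
proof -
  have "lin_act (E f (a - g) (x + g)) \<phi> (drop_empty [A - G, G \<union> X]) =
    (\<Sum>P\<in>subsets (G \<union> X) f. qpow (inv_weight P ((G \<union> X) - P)) * \<phi> (drop_empty [(A - G) \<union> P, (G \<union> X) - P]))"
    if "G \<in> subsets A g" for G
  proof -
    note G = finite_in_subsets[OF assms(1) that]
    have "card (G \<union> X) = x + g" using G assms by (subst card_Un_disjoint) auto
    moreover have "card (A - G) = a - g" using G assms by (simp add: card_Diff_subset)
    ultimately show ?thesis using G assms by (intro lin_act_E) auto
  qed
  then show ?thesis unfolding lin_act_comp lin_act_F[OF assms(1,2,4,5)]
    using EF_sum[OF assms(1-3), where f = f and g = g and \<phi> = \<phi>] by simp
qed

lemma flop_coeff_identity:
  assumes "\<And>n. f = n + card H \<Longrightarrow> f + card D = g + card H \<Longrightarrow> L n = (\<Sum>t\<le>n. c t * L' (n - t))"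
  shows "flop_coeff L f g D H = (\<Sum>t\<le>min f g. c t * flop_coeff L' (f - t) (g - t) D H)"
proof (cases "card H \<le> f \<and> f + card D = g + card H")
  case True
  define n where "n = f - card H"
  have "flop_coeff L f g D H = (\<Sum>t\<le>n. c t * L' (n - t))"
    using True assms[of n] by (simp add: flop_coeff_def n_def)
  also have "\<dots> = (\<Sum>t\<le>n. c t * flop_coeff L' (f - t) (g - t) D H)"
    using True by (intro sum.cong HOL.refl) (auto simp: flop_coeff_def n_def diff_commute add.commute)
  also have "\<dots> = (\<Sum>t\<le>min f g. c t * flop_coeff L' (f - t) (g - t) D H)"
    using True by (intro sum.mono_neutral_left) (auto simp: flop_coeff_def n_def)
  finally show ?thesis .
next
  case False
  then have "flop_coeff L' (f - t) (g - t) D H = 0" if "t \<le> min f g" for t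
    using that by (auto simp: flop_coeff_def)
  then show ?thesis using False by (auto simp: flop_coeff_def intro!: sum.neutral[symmetric])
qed

lemma card_Diff_int: "finite A \<Longrightarrow> D \<subseteq> A \<Longrightarrow> int (card (A - D)) = int (card A) - int (card D)"
  by (simp add: card_Diff_subset finite_subset of_nat_diff card_mono)

lemma flop_FE_act:
  assumes "finite A" "finite X" "A \<inter> X = {}" "card A = a" "card X = x"
  shows "lin_act (lin_comp (F g (a + f) (x - f)) (E f a x)
      - (\<Sum>t\<le>min f g. scale (qbinom (int x - int a + int g - int f) t)
          (lin_comp (E (f - t) (a - (g - t)) (x + (g - t))) (F (g - t) a x)))) \<phi> (drop_empty [A, X]) = 0"
proof -
  let ?k = "int x - int a + int g - int f"
  have "flop_coeff (subset_sum 1 (A - D) (X - H)) f g D H =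
    (\<Sum>t\<le>min f g. qbinom ?k t * flop_coeff (subset_sum (- 1) (X - H) (A - D)) (f - t) (g - t) D H)"
    if "D \<subseteq> A" "H \<subseteq> X" for D H
  proof (rule flop_coeff_identity)
    fix n assume n: "f = n + card H" "f + card D = g + card H"
    have "int (card (X - H)) - int (card (A - D)) = ?k"
      using n assms that by (simp add: card_Diff_int)
    then show "subset_sum 1 (A - D) (X - H) n = (\<Sum>t\<le>n. qbinom ?k t * subset_sum (- 1) (X - H) (A - D) (n - t))"
      using flop_identity[of "A - D" "X - H" 1 n] assms by auto
  qed
  then have "(\<Sum>(D, H)\<in>Pow A \<times> Pow X. flop_base \<phi> A X D H * flop_coeff (subset_sum 1 (A - D) (X - H)) f g D H) =
    (\<Sum>(D, H)\<in>Pow A \<times> Pow X. \<Sum>t\<le>min f g. qbinom ?k t * (flop_base \<phi> A X D H * flop_coeff (subset_sum (- 1) (X - H) (A - D)) (f - t) (g - t) D H))"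
    by (intro sum.cong HOL.refl) (auto simp: sum_distrib_left mult.left_commute)
  also have "\<dots> = (\<Sum>t\<le>min f g. qbinom ?k t * (\<Sum>(D, H)\<in>Pow A \<times> Pow X. flop_base \<phi> A X D H * flop_coeff (subset_sum (- 1) (X - H) (A - D)) (f - t) (g - t) D H))"
    unfolding sum_distrib_left case_prod_unfold by (rule sum.swap)
  finally show ?thesis
    by (simp only: lin_act_simps lin_act_sum scale_eq_smul lin_act_FE[OF assms] lin_act_EF[OF assms] diff_self)
qed

lemma flop_EF_act:
  assumes "finite A" "finite X" "A \<inter> X = {}" "card A = a" "card X = x"
  shows "lin_act (lin_comp (E f (a - g) (x + g)) (F g a x)
      - (\<Sum>t\<le>min f g. scale (qbinom (int a - int x + int f - int g) t)
          (lin_comp (F (g - t) (a + (f - t)) (x - (f - t))) (E (f - t) a x)))) \<phi> (drop_empty [A, X]) = 0"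
proof -
  let ?k = "int a - int x + int f - int g"
  have "flop_coeff (subset_sum (- 1) (X - H) (A - D)) f g D H =
    (\<Sum>t\<le>min f g. qbinom ?k t * flop_coeff (subset_sum 1 (A - D) (X - H)) (f - t) (g - t) D H)"
    if "D \<subseteq> A" "H \<subseteq> X" for D H
  proof (rule flop_coeff_identity)
    fix n assume n: "f = n + card H" "f + card D = g + card H"
    have "int (card (A - D)) - int (card (X - H)) = ?k"
      using n assms that by (simp add: card_Diff_int)
    then show "subset_sum (- 1) (X - H) (A - D) n = (\<Sum>t\<le>n. qbinom ?k t * subset_sum 1 (A - D) (X - H) (n - t))"
      using flop_identity[of "X - H" "A - D" "- 1" n] assms by auto
  qed
  then have "(\<Sum>(D, H)\<in>Pow A \<times> Pow X. flop_base \<phi> A X D H * flop_coeff (subset_sum (- 1) (X - H) (A - D)) f g D H) =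
    (\<Sum>(D, H)\<in>Pow A \<times> Pow X. \<Sum>t\<le>min f g. qbinom ?k t * (flop_base \<phi> A X D H * flop_coeff (subset_sum 1 (A - D) (X - H)) (f - t) (g - t) D H))"
    by (intro sum.cong HOL.refl) (auto simp: sum_distrib_left mult.left_commute)
  also have "\<dots> = (\<Sum>t\<le>min f g. qbinom ?k t * (\<Sum>(D, H)\<in>Pow A \<times> Pow X. flop_base \<phi> A X D H * flop_coeff (subset_sum 1 (A - D) (X - H)) (f - t) (g - t) D H))"
    unfolding sum_distrib_left case_prod_unfold by (rule sum.swap)
  finally show ?thesis
    by (simp only: lin_act_simps lin_act_sum scale_eq_smul lin_act_FE[OF assms] lin_act_EF[OF assms] diff_self)
qed

section \<open>The relations of \<open>Webs_inf\<close> act by zero\<close>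

definition free_span :: "nat list \<Rightarrow> nat list \<Rightarrow> lin_web set"
  where "free_span x y = {p. Poly_Mapping.keys p \<subseteq> webs x y}"

lemma free_span_closed:
  "0 \<in> free_span x y" "p \<in> free_span x y \<Longrightarrow> r \<in> free_span x y \<Longrightarrow> p + r \<in> free_span x y"
  "p \<in> free_span x y \<Longrightarrow> smul c p \<in> free_span x y"
  using Poly_Mapping.keys_add[of p r] keys_smul[of c p] by (auto simp: free_span_def)

lemma free_span_diff: "p \<in> free_span x y \<Longrightarrow> r \<in> free_span x y \<Longrightarrow> p - r \<in> free_span x y"
  using free_span_closed(2)[of p x y "smul (-1) r"] free_span_closed(3)[of r x y "-1"] by simp

lemma free_span_sum: "(\<And>a. a \<in> A \<Longrightarrow> f a \<in> free_span x y) \<Longrightarrow> sum f A \<in> free_span x y"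
  by (induction A rule: infinite_finite_induct) (auto intro: free_span_closed)

lemma free_span_of_web: "w \<in> webs x y \<Longrightarrow> of_web w \<in> free_span x y"
  by (simp add: free_span_def of_web_def)

lemma free_span_bilinear:
  assumes "p \<in> free_span x y" "r \<in> free_span x' y'"
    "\<And>w v. w \<in> webs x y \<Longrightarrow> v \<in> webs x' y' \<Longrightarrow> h w v \<in> webs x'' y''"
  shows "bilinear_ext h p r \<in> free_span x'' y''"
  using assms(1)[unfolded free_span_def, simplified]
proof (induction rule: poly_mapping_span_induct)
  case (single w a)
  show ?case
    using assms(2)[unfolded free_span_def, simplified]
  proof (induction rule: poly_mapping_span_induct)
    case (single v b)
    have "bilinear_ext h (Poly_Mapping.single w a) (Poly_Mapping.single v b) = smul (a * b) (of_web (h w v))"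
      by (simp add: of_web_def)
    then show ?case using assms(3) single \<open>w \<in> webs x y\<close> by (auto intro!: free_span_closed free_span_of_web)
  qed (auto intro: free_span_closed)
qed (auto intro: free_span_closed)

lemma E_free_span:
  assumes "a' = a + f" "x = x' + f \<or> x < f"
  shows "E f a x \<in> free_span (erase [a, x]) (erase [a', x'])"
proof (cases "f \<le> x")
  case True
  then show ?thesis using assms by (auto simp: E_eq webs_def Eweb_props intro!: free_span_of_web)
qed (simp add: E_def free_span_closed)

lemma F_free_span:
  assumes "a = a' + g \<or> a < g" "x' = x + g"
  shows "F g a x \<in> free_span (erase [a, x]) (erase [a', x'])"
proof (cases "g \<le> a")
  case True
  then show ?thesis using assms by (auto simp: F_eq webs_def Fweb_props add.commute intro!: free_span_of_web)
qed (simp add: F_def free_span_closed)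

lemma inf_relation_free_span:
  assumes "inf_relation x y p"
  shows "p \<in> free_span x y"
  using assms
proof cases
  case (struct u v)
  then show ?thesis using structural_parallel[of u v]
    by (auto simp: webs_def intro!: free_span_diff free_span_of_web)
next
  case (assoc u v)
  then show ?thesis using assoc_relation_parallel[of u v]
    by (auto simp: webs_def intro!: free_span_diff free_span_of_web)
next
  case (bigon a b)
  then show ?thesis
    by (auto simp: webs_def scale_eq_smul intro!: free_span_diff free_span_closed free_span_of_web)
next
  case (flop_FE g a f x')
  have "lin_comp (F g (a + f) (x' - f)) (E f a x') \<in> free_span x y"
  proof (cases "f \<le> x'")
    case True
    have "F g (a + f) (x' - f) \<in> free_span (erase [a + f, x' - f]) (erase [a + f - g, x' + g - f])"
      using True flop_FE(4,5) by (intro F_free_span) arith+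
    moreover have "E f a x' \<in> free_span (erase [a, x']) (erase [a + f, x' - f])"
      using True by (intro E_free_span) arith+
    ultimately show ?thesis unfolding flop_FE(1,2) by (rule free_span_bilinear) (rule webs_Comp)
  qed (simp add: E_def free_span_closed)
  moreover have "lin_comp (E (f - t) (a - (g - t)) (x' + (g - t))) (F (g - t) a x') \<in> free_span x y"
    if "t \<le> min f g" for t
  proof (cases "g - t \<le> a")
    case True
    have "t \<le> f" "t \<le> g" using that by auto
    have "E (f - t) (a - (g - t)) (x' + (g - t)) \<in> free_span (erase [a - (g - t), x' + (g - t)]) (erase [a + f - g, x' + g - f])"
      using True \<open>t \<le> f\<close> \<open>t \<le> g\<close> flop_FE(4,5) by (intro E_free_span) arith+
    moreover have "F (g - t) a x' \<in> free_span (erase [a, x']) (erase [a - (g - t), x' + (g - t)])"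
      using True by (intro F_free_span) arith+
    ultimately show ?thesis unfolding flop_FE(1,2) by (rule free_span_bilinear) (rule webs_Comp)
  qed (simp add: F_def free_span_closed)
  ultimately show ?thesis unfolding flop_FE(3) scale_eq_smul
    by (intro free_span_diff free_span_sum free_span_closed) auto
next
  case (flop_EF g a f x')
  have "lin_comp (E f (a - g) (x' + g)) (F g a x') \<in> free_span x y"
  proof (cases "g \<le> a")
    case True
    have "E f (a - g) (x' + g) \<in> free_span (erase [a - g, x' + g]) (erase [a + f - g, x' + g - f])"
      using True flop_EF(4,5) by (intro E_free_span) arith+
    moreover have "F g a x' \<in> free_span (erase [a, x']) (erase [a - g, x' + g])"
      using True by (intro F_free_span) arith+
    ultimately show ?thesis unfolding flop_EF(1,2) by (rule free_span_bilinear) (rule webs_Comp)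
  qed (simp add: F_def free_span_closed)
  moreover have "lin_comp (F (g - t) (a + (f - t)) (x' - (f - t))) (E (f - t) a x') \<in> free_span x y"
    if "t \<le> min f g" for t
  proof (cases "f - t \<le> x'")
    case True
    have "t \<le> f" "t \<le> g" using that by auto
    have "F (g - t) (a + (f - t)) (x' - (f - t)) \<in> free_span (erase [a + (f - t), x' - (f - t)]) (erase [a + f - g, x' + g - f])"
      using True \<open>t \<le> f\<close> \<open>t \<le> g\<close> flop_EF(4,5) by (intro F_free_span) arith+
    moreover have "E (f - t) a x' \<in> free_span (erase [a, x']) (erase [a + (f - t), x' - (f - t)])"
      using True by (intro E_free_span) arith+
    ultimately show ?thesis unfolding flop_EF(1,2) by (rule free_span_bilinear) (rule webs_Comp)
  qed (simp add: E_def free_span_closed)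
  ultimately show ?thesis unfolding flop_EF(3) scale_eq_smul
    by (intro free_span_diff free_span_sum free_span_closed) auto
qed

text \<open>In \<open>lin_act_tens_right\<close> the place at which a configuration is cut
  depends on the source of the left factor, which is why the sources of the webs that occur in a
  relation matter.\<close>

lemma inf_ideal_free_span: "inf_ideal x y p \<Longrightarrow> p \<in> free_span x y"
proof (induction rule: inf_ideal.induct)
  case (comp_left x y p w z)
  then show ?case
    by (intro free_span_bilinear[OF free_span_of_web]) (auto intro: webs_Comp)
next
  case (comp_right y z p w x)
  then show ?case
    by (intro free_span_bilinear[OF _ free_span_of_web]) (auto intro: webs_Comp)
next
  case (tens_left x y p w x' y')
  then show ?case
    by (intro free_span_bilinear[OF free_span_of_web]) (auto intro: webs_Tens)
next
  case (tens_right x y p w x' y')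
  then show ?case
    by (intro free_span_bilinear[OF _ free_span_of_web]) (auto intro: webs_Tens)
qed (auto simp: scale_eq_smul intro: free_span_closed inf_relation_free_span)

lemma inf_relation_act:
  assumes "inf_relation x y p" "typed x c"
  shows "lin_act p \<phi> c = 0"
  using assms(1)
proof cases
  case (struct u v)
  then show ?thesis using structural_act[of u v c \<phi>] assms by simp
next
  case (assoc u v)
  then show ?thesis using assoc_relation_act[of u v c \<phi>] assms by simp
next
  case (bigon a b)
  then obtain U where U: "c = [U]" "finite U" "card U = a + b" using assms(2) by (auto simp: typed_1)
  have "act (Comp (Merge a b) (Split a b)) \<phi> c = (\<Sum>S\<in>subsets U a. qpow (inv_weight S (U - S)) * \<phi> c)"
    using U by (auto simp: subsets_def Un_absorb1 intro!: sum.cong)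
  also have "\<dots> = qbinom (int (a + b)) a * \<phi> c"
    using bigon_identity[OF U(2,3)] by (simp flip: sum_distrib_right)
  finally show ?thesis using bigon by (simp add: scale_eq_smul del: act.simps)
next
  case (flop_FE g a f x')
  obtain A X where c: "c = drop_empty [A, X]" "finite A" "finite X" "A \<inter> X = {}" "card A = a" "card X = x'"
    using typed_erase_pair assms(2) flop_FE(1) by metis
  show ?thesis unfolding flop_FE(3) c(1) by (rule flop_FE_act[OF c(2-)])
next
  case (flop_EF g a f x')
  obtain A X where c: "c = drop_empty [A, X]" "finite A" "finite X" "A \<inter> X = {}" "card A = a" "card X = x'"
    using typed_erase_pair assms(2) flop_EF(1) by metis
  show ?thesis unfolding flop_EF(3) c(1) by (rule flop_EF_act[OF c(2-)])
qed

text \<open>The representation thus descends to \<open>Webs_inf\<close>.\<close>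

theorem inf_ideal_act: "inf_ideal x y p \<Longrightarrow> typed x c \<Longrightarrow> lin_act p \<phi> c = 0"
proof (induction arbitrary: c \<phi> rule: inf_ideal.induct)
  case (rel x y p)
  then show ?case using inf_relation_act by blast
next
  case (scale x y p a)
  then show ?case by (simp add: scale_eq_smul)
next
  case (comp_left x y p w z)
  then show ?case by (simp add: lin_act_comp)
next
  case (comp_right y z p w x)
  have "act w (\<lambda>c'. lin_act p \<phi> c') c = 0"
    by (rule act_zero[where \<beta> = "\<lambda>_. 0"]) (use comp_right in \<open>auto simp: webs_def\<close>)
  then show ?case by (simp add: lin_act_comp)
next
  case (tens_left x y p w x' y')
  note t = typed_split[OF tens_left.prems]
  have "src w = x'" using tens_left by (simp add: webs_def)
  then show ?case using tens_left.IH[OF t(2)] by (simp add: lin_act_tens_left act_0)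
next
  case (tens_right x y p w x' y')
  note t = typed_split[OF tens_right.prems]
  have "Poly_Mapping.keys p \<subseteq> webs x y" using inf_ideal_free_span[OF tens_right.hyps(1)] by (simp add: free_span_def)
  then show ?case using tens_right.IH[OF t(1)] by (simp add: lin_act_tens_right)
qed simp_all

section \<open>Comparison of the leading relations\<close>

lemma lin_ext_cong: "(\<And>a. a \<in> Poly_Mapping.keys p \<Longrightarrow> g a = h a) \<Longrightarrow> lin_ext g p = lin_ext h p"
  unfolding lin_ext_def by (intro sum.cong) auto

lemma lin_ext_sub: "lin_ext (\<lambda>a. g a - h a) p = lin_ext g p - lin_ext h p"
  by (simp add: lin_ext_def sum_subtractf)

lemma lin_ext_lin_ext: "lin_ext g (lin_ext h p) = lin_ext (\<lambda>a. lin_ext g (h a)) p"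
proof -
  have "lin_ext g (\<Sum>a\<in>A. smul (f a) (h a)) = (\<Sum>a\<in>A. smul (f a) (lin_ext g (h a)))" for A f
    by (induction A rule: infinite_finite_induct) auto
  then show ?thesis unfolding lin_ext_def[of h] lin_ext_def[of "\<lambda>a. lin_ext g (h a)"] .
qed

definition sc_proj :: "lin_web \<Rightarrow> (web set \<Rightarrow>\<^sub>0 laurent)"
  where "sc_proj = lin_ext (\<lambda>w. Poly_Mapping.single (sc_class w) 1)"

lemma sc_proj_simps [simp]:
  "sc_proj 0 = 0" "sc_proj (p + r) = sc_proj p + sc_proj r" "sc_proj (p - r) = sc_proj p - sc_proj r"
  "sc_proj (smul c p) = smul c (sc_proj p)" "sc_proj (Poly_Mapping.single w c) = Poly_Mapping.single (sc_class w) c"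
  "sc_proj (of_web w) = Poly_Mapping.single (sc_class w) 1"
  by (simp_all add: sc_proj_def of_web_def)

lemma lookup_sc_proj:
  "Poly_Mapping.lookup (sc_proj p) X = (\<Sum>w\<in>{w \<in> Poly_Mapping.keys p. sc_class w = X}. Poly_Mapping.lookup p w)"
proof -
  have "Poly_Mapping.lookup (sc_proj p) X = (\<Sum>w\<in>Poly_Mapping.keys p. if sc_class w = X then Poly_Mapping.lookup p w else 0)"
    unfolding sc_proj_def lin_ext_def lookup_sum by (intro sum.cong) (auto simp: lookup_single when_def)
  then show ?thesis by (simp add: sum.inter_filter)
qed

lemma keys_sc_proj: "Poly_Mapping.keys (sc_proj p) \<subseteq> sc_class ` Poly_Mapping.keys p"
proof
  fix X assume "X \<in> Poly_Mapping.keys (sc_proj p)"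
  then have "(\<Sum>w\<in>{w \<in> Poly_Mapping.keys p. sc_class w = X}. Poly_Mapping.lookup p w) \<noteq> 0"
    by (simp add: in_keys_iff lookup_sc_proj)
  then have "{w \<in> Poly_Mapping.keys p. sc_class w = X} \<noteq> {}" by (metis sum.empty)
  then show "X \<in> sc_class ` Poly_Mapping.keys p" by blast
qed

lemma sc_class_eq_iff: "well_formed w \<Longrightarrow> sc_class w = sc_class v \<longleftrightarrow> sc_eq w v"
  unfolding sc_class_def by (auto intro: sc_eq.sym sc_eq.trans sc_eq.refl)

definition shortest :: "web set \<Rightarrow> web"
  where "shortest X = arg_min deg (\<lambda>v. v \<in> X)"

lemma shortest:
  assumes "well_formed w"
  shows "sc_eq w (shortest (sc_class w))" "sc_eq w v \<Longrightarrow> deg (shortest (sc_class w)) \<le> deg v"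
    "sc_class (shortest (sc_class w)) = sc_class w"
proof -
  have "w \<in> sc_class w" using assms by (auto simp: sc_class_def intro: sc_eq.refl)
  from arg_min_nat_lemma[of "\<lambda>v. v \<in> sc_class w", OF this, of deg]
  show 1: "sc_eq w (shortest (sc_class w))" and "sc_eq w v \<Longrightarrow> deg (shortest (sc_class w)) \<le> deg v"
    by (auto simp: shortest_def sc_class_def)
  show "sc_class (shortest (sc_class w)) = sc_class w" using 1 sc_class_eq_iff[OF assms] by metis
qed

lemma shortest_webs: "w \<in> webs x y \<Longrightarrow> shortest (sc_class w) \<in> webs x y"
  using sc_eq_parallel[OF shortest(1)[of w]] by (auto simp: webs_def)

text \<open>If the degree of \<open>w\<close> is not minimal in its class, then \<open>w\<close>
  is degenerate. If it is minimal, then both webs are related to the same reduced web by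
  relations that preserve the degree.\<close>

lemma low_diff_shortest:
  assumes "w \<in> webs x y" "deg w \<le> k"
  shows "low k x y (of_web w - of_web (shortest (sc_class w)))"
proof -
  let ?r = "shortest (sc_class w)"
  have w: "well_formed w" "src w = x" "tgt w = y" using assms by (auto simp: webs_def)
  note s = shortest[OF w(1)]
  have r: "?r \<in> webs x y" using shortest_webs assms by blast
  have le: "deg ?r \<le> deg w" using s(2)[OF sc_eq.refl] w by simp
  consider "deg w < k" | "deg w = k" "deg ?r < k" | "deg w = k" "deg ?r = k" using le assms by linarith
  then show ?thesis
  proof cases
    case 1
    then show ?thesis using assms r le by (intro low_free free_lt_diff free_lt_of_web) auto
  next
    case 2
    then have "degenerate w" using nonminimal_degenerate[OF w(1) s(1)] by simp
    then have "low k x y (of_web w)" using degenerate_low[of w] w 2 by simp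
    from low_diff[OF this low_free[OF free_lt_of_web[OF r]]] show ?thesis using 2 by simp
  next
    case 3
    have "deg w \<le> deg v" if "sc_eq w v" for v using s(2)[OF that] 3 by simp
    then obtain u t where u: "reduced (src w) u t" "heq w u" using minimal_reduced[OF w(1)] by metis
    have rp: "well_formed ?r" "src ?r = src w" using r w by (auto simp: webs_def)
    have o: "src w \<in> objects" using w src_tgt_objects by blast
    have "reach w (init (src w)) t" using reduced_reach[OF u(1)] sc_eq_reach[OF heq_sc_eq[OF u(2)]] by simp
    then have "reach ?r (init (src w)) t" using sc_eq_reach[OF s(1)] by simp
    moreover have "cost t = 2 * deg ?r" using reduced_props(5)[OF u(1) o] heq_deg[OF u(2)] 3 by simp
    ultimately have "heq ?r u" using geodesic_heq[of ?r t u] rp u(1) by simp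
    then have "gr_eq w ?r" using u(2) heq.sym heq.trans heq_gr_eq by blast
    then have "low (deg w) (src w) (tgt w) (of_web w - of_web ?r)" unfolding gr_eq_def by blast
    then show ?thesis unfolding w(2,3) 3(1) .
  qed
qed

text \<open>Replacing each web by a shortest one in its class changes \<open>p\<close> by lower
  terms only. The result depends only on the image of \<open>p\<close> in
  \<open>SC_Webs\<close>, so it is 0.\<close>

theorem sc_kernel_low:
  assumes "p \<in> free_lt (Suc k) x y" "sc_proj p = 0"
  shows "low k x y p"
proof -
  have p: "w \<in> webs x y \<and> deg w \<le> k" if "w \<in> Poly_Mapping.keys p" for w
    using assms(1) that by (auto simp: free_lt_def)
  have "low k x y (lin_ext (\<lambda>w. of_web w - of_web (shortest (sc_class w))) p)"
    using p by (intro low_lin_ext low_diff_shortest) auto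
  also have "lin_ext (\<lambda>w. of_web w - of_web (shortest (sc_class w))) p = p - lin_ext (\<lambda>X. of_web (shortest X)) (sc_proj p)"
    unfolding lin_ext_sub sc_proj_def lin_ext_lin_ext using poly_mapping_expand[of p]
    by (simp add: of_web_def)
  finally show ?thesis using assms(2) by simp
qed

lemma init_config:
  obtains \<beta> c where "typed x c" "map (row \<beta>) c = init x"
proof
  define \<beta> :: "int \<Rightarrow> nat" where "\<beta> n = fst (prod_decode (nat n))" for n
  \<comment> \<open>The source strand \<open>i\<close> consists of the integers that encode a
    pair with first component \<open>i\<close>.\<close>
  define e where "e i j = int (prod_encode (i, j))" for i j
  define block where "block i = e i ` {..<x ! i}" for i
  have inj: "inj_on (e i) A" for i A by (auto simp: inj_on_def e_def prod_encode_eq)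
  have \<beta>e: "\<beta> (e i j) = i" for i j by (simp add: \<beta>_def e_def)
  show "typed x (map block [0..<length x])"
    unfolding typed_def
  proof (intro conjI)
    show "sorted_wrt (\<lambda>A B. A \<inter> B = {}) (map block [0..<length x])"
      unfolding sorted_wrt_map by (rule sorted_wrt_mono_rel[OF _ sorted_wrt_upt]) (auto simp: block_def e_def prod_encode_eq)
    show "map card (map block [0..<length x]) = x"
      by (rule nth_equalityI) (auto simp: block_def card_image inj)
  qed (auto simp: block_def)
  have "row \<beta> (block i) = replicate_mset (x ! i) i" for i
  proof -
    have "row \<beta> (block i) = image_mset (\<lambda>j. \<beta> (e i j)) (mset_set {..<x ! i})"
      unfolding row_def block_def image_mset_mset_set[OF inj, symmetric]
      by (simp add: image_mset.compositionality o_def)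
    then show ?thesis unfolding \<beta>e by (simp add: image_mset_const_eq)
  qed
  then show "map (row \<beta>) (map block [0..<length x]) = init x" by (simp add: init_def)
qed

text \<open>Let \<open>u\<close> be a reduced web for the class of \<open>w0\<close>, with state
  \<open>t\<close> of cost \<open>2 * k\<close>, and let \<open>\<phi>\<close> be the indicator
  function of the configurations with state \<open>t\<close>. A web of degree at most
  \<open>k\<close> that reaches \<open>t\<close> has degree \<open>k\<close> and is related to
  \<open>u\<close> by relations that preserve the degree, so it lies in the class of
  \<open>w0\<close> and takes the same value on \<open>\<phi>\<close> as \<open>u\<close>.
  Evaluating \<open>p\<close> on \<open>\<phi>\<close> gives this value, which is not zero,
  times the coefficient in question.\<close>

lemma leading_coefficient_zero:
  assumes p: "p \<in> free_lt (Suc k) x y" "inf_ideal x y p"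
    and w0: "w0 \<in> webs x y" "deg (shortest (sc_class w0)) = k"
  shows "Poly_Mapping.lookup (sc_proj p) (sc_class w0) = 0"
proof -
  let ?w = "shortest (sc_class w0)"
  have wf0: "well_formed w0" using w0 by (simp add: webs_def)
  have "?w \<in> webs x y" by (rule shortest_webs[OF w0(1)])
  then have w: "well_formed ?w" "src ?w = x" "tgt ?w = y" by (auto simp: webs_def)
  note s = shortest[OF wf0]
  have "deg ?w \<le> deg v" if "sc_eq ?w v" for v using s(2)[OF sc_eq.trans[OF s(1) that]] .
  then obtain u t where u: "reduced x u t" "heq ?w u" using minimal_reduced[OF w(1)] w(2) by metis
  have o: "x \<in> objects" using w src_tgt_objects by blast
  note up = reduced_props[OF u(1) o]
  have degu: "deg u = k" using heq_deg[OF u(2)] w0 by simp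
  have cost: "cost t = 2 * k" using up(5) degu by simp
  obtain \<beta> c where c: "typed x c" "map (row \<beta>) c = init x" using init_config .
  define \<phi> :: "config \<Rightarrow> laurent" where "\<phi> d = (if map (row \<beta>) d = t then 1 else 0)" for d
  have unreached: "act v \<phi> c = 0" if "v \<in> webs x y" "\<not> reach v (init x) t" for v
    using that c by (intro act_zero[where \<beta> = \<beta>]) (auto simp: webs_def \<phi>_def)
  have lower: "act v \<phi> c = 0" if "v \<in> webs x y" "deg v < k" for v
  proof (rule unreached[OF that(1)])
    show "\<not> reach v (init x) t"
      using reach_props[of v "init x" t] that cost by (auto simp: webs_def)
  qed
  have uw: "u \<in> webs x y" using heq_wf_src_tgt[OF u(2)] w by (simp add: webs_def)
  have "nonneg 1" using nonneg_qpow[of 1 0] unfolding nonneg_def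
    by (intro exI[of _ "{#0#}"]) (simp add: qpow_0)
  then have \<tau>: "act u \<phi> c \<noteq> 0"
    using c uw reduced_reach[OF u(1)] nonneg_0
    by (intro act_nonzero[where \<beta> = \<beta> and t = t]) (auto simp: webs_def \<phi>_def)
  have same: "act v \<phi> c = act u \<phi> c" if "heq v u" for v
  proof -
    have "low k x y (of_web v - of_web u)"
      using heq_gr_eq[OF that] degu uw heq_deg[OF that] by (auto simp: gr_eq_def webs_def)
    then obtain r where r: "r \<in> free_lt k x y" "inf_ideal x y (of_web v - of_web u - r)"
      unfolding low_def by blast
    have "lin_act r \<phi> c = 0"
      unfolding lin_act_expand using r(1) lower by (intro sum.neutral) (auto simp: free_lt_def)
    then show ?thesis using inf_ideal_act[OF r(2) c(1), of \<phi>] by simp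
  qed
  have val: "act v \<phi> c = (if sc_class v = sc_class w0 then act u \<phi> c else 0)" if "v \<in> Poly_Mapping.keys p" for v
  proof -
    have v: "v \<in> webs x y" "well_formed v" "src v = x" "deg v \<le> k" using p(1) that by (auto simp: free_lt_def webs_def)
    have geo: "heq v u" if "reach v (init x) t"
    proof -
      have "cost t \<le> 2 * deg v" using reach_props[OF that v(2)] by simp
      then have "cost t = 2 * deg v" using cost v by simp
      then show ?thesis using geodesic_heq[of v t u] v that u(1) by simp
    qed
    show ?thesis
    proof (cases "sc_class v = sc_class w0")
      case True
      then have "sc_eq w0 v" using sc_class_eq_iff[OF wf0] by metis
      then have "sc_eq v ?w" using s(1) sc_eq.sym sc_eq.trans by blast
      then have "sc_eq v u" using heq_sc_eq[OF u(2)] sc_eq.trans by blast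
      then have "reach v (init x) t" using reduced_reach[OF u(1)] sc_eq_reach by simp
      then show ?thesis using True same geo by simp
    next
      case False
      have "\<not> reach v (init x) t"
      proof
        assume "reach v (init x) t"
        then have "sc_eq v u" using geo heq_sc_eq by blast
        then have "sc_eq v w0" using heq_sc_eq[OF u(2)] s(1) sc_eq.sym sc_eq.trans by blast
        then show False using False sc_class_eq_iff[OF v(2)] by simp
      qed
      then show ?thesis using unreached v(1) False by simp
    qed
  qed
  have "0 = (\<Sum>v\<in>Poly_Mapping.keys p. Poly_Mapping.lookup p v * act v \<phi> c)"
    using inf_ideal_act[OF p(2) c(1), of \<phi>] by (simp add: lin_act_expand)
  also have "\<dots> = (\<Sum>v\<in>Poly_Mapping.keys p. if sc_class v = sc_class w0 then Poly_Mapping.lookup p v * act u \<phi> c else 0)"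
    by (intro sum.cong HOL.refl) (simp add: val)
  also have "\<dots> = Poly_Mapping.lookup (sc_proj p) (sc_class w0) * act u \<phi> c"
    by (auto simp: lookup_sc_proj sum.inter_filter sum_distrib_right intro!: sum.cong)
  finally show ?thesis using \<tau> by simp
qed

text \<open>Every class that occurs in the image of \<open>p\<close> contains a web of degree
  less than \<open>k\<close>, and \<open>p\<close> may be replaced by the corresponding
  combination of shortest webs.\<close>

theorem inf_kernel_low:
  assumes "p \<in> free_lt (Suc k) x y" "inf_ideal x y p"
  shows "\<exists>r\<in>free_lt k x y. sc_proj p = sc_proj r"
proof -
  let ?r = "lin_ext (\<lambda>X. of_web (shortest X)) (sc_proj p)"
  have key: "\<exists>w. X = sc_class w \<and> w \<in> webs x y \<and> deg (shortest X) < k" if X: "X \<in> Poly_Mapping.keys (sc_proj p)" for X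
  proof -
    obtain w where w: "X = sc_class w" "w \<in> Poly_Mapping.keys p" using keys_sc_proj X by blast
    then have w': "w \<in> webs x y" "deg w \<le> k" using assms(1) by (auto simp: free_lt_def)
    then have "deg (shortest X) \<le> k" using shortest(2)[of w w] w sc_eq.refl by (fastforce simp: webs_def)
    moreover have "deg (shortest X) \<noteq> k"
      using leading_coefficient_zero[OF assms w'(1)] X w(1) by (auto simp: in_keys_iff)
    ultimately show ?thesis using w w' by auto
  qed
  have "?r \<in> free_lt k x y"
    unfolding lin_ext_def
  proof (intro free_lt_sum free_lt_closed free_lt_of_web)
    fix X assume "X \<in> Poly_Mapping.keys (sc_proj p)"
    then show "shortest X \<in> webs x y" "deg (shortest X) < k" using key shortest_webs by blast+
  qed
  moreover have "sc_proj ?r = lin_ext (\<lambda>X. Poly_Mapping.single (sc_class (shortest X)) 1) (sc_proj p)"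
    unfolding sc_proj_def lin_ext_lin_ext by (simp add: of_web_def)
  then have "sc_proj ?r = lin_ext (\<lambda>X. Poly_Mapping.single X 1) (sc_proj p)"
  proof (rule HOL.trans[OF _ lin_ext_cong])
    fix X assume "X \<in> Poly_Mapping.keys (sc_proj p)"
    then obtain w where "X = sc_class w" "w \<in> webs x y" using key by blast
    then have "X = sc_class w" "well_formed w" by (auto simp: webs_def)
    then have "sc_class (shortest X) = X" using shortest(3) by simp
    then show "Poly_Mapping.single (sc_class (shortest X)) 1 = (Poly_Mapping.single X 1 :: web set \<Rightarrow>\<^sub>0 laurent)" by simp
  qed
  then have "sc_proj p = sc_proj ?r" using poly_mapping_expand[of "sc_proj p"] by simp
  ultimately show ?thesis by blast
qed

section \<open>Categories presented by webs\<close>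

lemma finsum_image:
  fixes G :: "(laurent, 'm) module" and S :: "'a::comm_monoid_add set"
  assumes carrier: "carrier G = h ` S" and S: "0 \<in> S" "\<And>p r. p \<in> S \<Longrightarrow> r \<in> S \<Longrightarrow> p + r \<in> S"
    and add: "\<And>p r. p \<in> S \<Longrightarrow> r \<in> S \<Longrightarrow> h p \<oplus>\<^bsub>G\<^esub> h r = h (p + r)"
    and zero: "\<zero>\<^bsub>G\<^esub> = h 0"
    and A: "finite A" "\<And>i. i \<in> A \<Longrightarrow> P i \<in> S \<and> Q i = h (P i)"
  shows "(\<Oplus>\<^bsub>G\<^esub>i\<in>A. Q i) = h (\<Sum>i\<in>A. P i)"
proof -
  have "abelian_monoid G"
    by (rule abelian_monoidI) (auto simp: carrier add zero S ac_simps)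
  then interpret abelian_monoid G .
  have "(\<Oplus>\<^bsub>G\<^esub>i\<in>A. Q i) = h (\<Sum>i\<in>A. P i) \<and> (\<Sum>i\<in>A. P i) \<in> S"
    using A
  proof (induction A rule: finite_induct)
    case (insert i A)
    have "(\<Oplus>\<^bsub>G\<^esub>i\<in>insert i A. Q i) = Q i \<oplus>\<^bsub>G\<^esub> (\<Oplus>\<^bsub>G\<^esub>i\<in>A. Q i)"
      using insert by (intro finsum_insert) (auto simp: carrier)
    then show ?case using insert add S by auto
  qed (simp add: zero S)
  then show ?thesis by blast
qed

lemma free_lt_span: "p \<in> free_lt k x y \<Longrightarrow> p \<in> free_span x y"
  by (auto simp: free_lt_def free_span_def)

text \<open>A linear monoidal category on the same objects whose morphisms are represented by
  linear combinations of webs, compatibly with all operations.\<close>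

locale presentation =
  fixes C :: "(nat list, 'm) lin_moncat" and pr :: "nat list \<Rightarrow> nat list \<Rightarrow> lin_web \<Rightarrow> 'm"
    and r :: "nat list \<Rightarrow> nat list \<Rightarrow> web \<Rightarrow> 'm"
  assumes Obj: "Obj C = objects" and unit_obj: "unit_obj C = []" and tens_obj: "tens_obj C = (@)"
    and carrier: "x \<in> objects \<Longrightarrow> y \<in> objects \<Longrightarrow> carrier (Hom C x y) = pr x y ` free_span x y"
    and add: "x \<in> objects \<Longrightarrow> y \<in> objects \<Longrightarrow> p \<in> free_span x y \<Longrightarrow> s \<in> free_span x y \<Longrightarrow>
      pr x y p \<oplus>\<^bsub>Hom C x y\<^esub> pr x y s = pr x y (p + s)"
    and zero: "x \<in> objects \<Longrightarrow> y \<in> objects \<Longrightarrow> \<zero>\<^bsub>Hom C x y\<^esub> = pr x y 0"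
    and smult: "x \<in> objects \<Longrightarrow> y \<in> objects \<Longrightarrow> p \<in> free_span x y \<Longrightarrow>
      c \<odot>\<^bsub>Hom C x y\<^esub> pr x y p = pr x y (smul c p)"
    and ident: "x \<in> objects \<Longrightarrow> ident C x = pr x x (of_web (Id x))"
    and comp: "x \<in> objects \<Longrightarrow> y \<in> objects \<Longrightarrow> z \<in> objects \<Longrightarrow> p \<in> free_span y z \<Longrightarrow> s \<in> free_span x y \<Longrightarrow>
      moncat.comp C x y z (pr y z p) (pr x y s) = pr x z (lin_comp p s)"
    and tens: "x \<in> objects \<Longrightarrow> y \<in> objects \<Longrightarrow> x' \<in> objects \<Longrightarrow> y' \<in> objects \<Longrightarrow>
      p \<in> free_span x y \<Longrightarrow> s \<in> free_span x' y' \<Longrightarrow>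
      moncat.tens C x y x' y' (pr x y p) (pr x' y' s) = pr (x @ x') (y @ y') (lin_tens p s)"
    and web: "x \<in> objects \<Longrightarrow> y \<in> objects \<Longrightarrow> r x y w = pr x y (of_web w)"
begin

abbreviation "Fil \<equiv> web_filtration C r"

lemma filtration:
  assumes "x \<in> objects" "y \<in> objects"
  shows "Fil k x y = pr x y ` free_lt (Suc k) x y"
proof -
  let ?W = "{w \<in> webs x y. deg w \<le> k}"
  have fs: "(\<Oplus>\<^bsub>Hom C x y\<^esub>w\<in>A. c w \<odot>\<^bsub>Hom C x y\<^esub> r x y w) = pr x y (\<Sum>w\<in>A. smul (c w) (of_web w))"
    if "finite A" "A \<subseteq> ?W" for A c
    using that assms
    by (intro finsum_image[where h = "pr x y" and S = "free_span x y"] carrier add zero)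
      (auto simp: web intro!: smult free_span_closed free_span_of_web)
  show ?thesis
  proof (intro equalityI subsetI)
    fix f assume "f \<in> Fil k x y"
    then obtain A c where A: "finite A" "A \<subseteq> ?W" "f = (\<Oplus>\<^bsub>Hom C x y\<^esub>w\<in>A. c w \<odot>\<^bsub>Hom C x y\<^esub> r x y w)"
      unfolding web_filtration_def by blast
    have "(\<Sum>w\<in>A. smul (c w) (of_web w)) \<in> free_lt (Suc k) x y"
      using A(2) by (intro free_lt_sum free_lt_closed free_lt_of_web) auto
    then show "f \<in> pr x y ` free_lt (Suc k) x y" unfolding A(3) fs[OF A(1,2)] by blast
  next
    fix f assume "f \<in> pr x y ` free_lt (Suc k) x y"
    then obtain p where p: "p \<in> free_lt (Suc k) x y" "f = pr x y p" by blast
    let ?A = "Poly_Mapping.keys p"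
    have A: "?A \<subseteq> ?W" using p(1) by (auto simp: free_lt_def)
    have "p = (\<Sum>w\<in>?A. smul (Poly_Mapping.lookup p w) (of_web w))"
      using poly_mapping_expand[of p] by (simp only: lin_ext_def of_web_def)
    then have "f = (\<Oplus>\<^bsub>Hom C x y\<^esub>w\<in>?A. Poly_Mapping.lookup p w \<odot>\<^bsub>Hom C x y\<^esub> r x y w)"
      using p(2) fs[OF _ A, of "Poly_Mapping.lookup p"] by simp
    then show "f \<in> Fil k x y" unfolding web_filtration_def using A
      by (intro CollectI exI[of _ ?A] exI[of _ "Poly_Mapping.lookup p"]) auto
  qed
qed

lemma filt_below:
  assumes "x \<in> objects" "y \<in> objects"
  shows "filt_below C Fil k x y = pr x y ` free_lt k x y"
proof (cases k)
  case 0
  have "free_lt 0 x y = {0}" by (auto simp: free_lt_def)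
  then show ?thesis using 0 zero assms by (simp add: filt_below_def)
qed (simp add: filt_below_def filtration assms)

text \<open>The class of a combination of webs of degree at most \<open>k\<close> in the graded
  piece of degree \<open>k\<close>.\<close>

definition leading :: "nat \<Rightarrow> nat list \<Rightarrow> nat list \<Rightarrow> lin_web \<Rightarrow> 'm set"
  where "leading k x y p = (\<lambda>s. pr x y (s + p)) ` free_lt k x y"

definition lowered :: "nat \<Rightarrow> nat list \<Rightarrow> nat list \<Rightarrow> lin_web \<Rightarrow> bool"
  where "lowered k x y p \<longleftrightarrow> (\<exists>s\<in>free_lt k x y. pr x y p = pr x y s)"

lemma pr_cong_add:
  assumes "x \<in> objects" "y \<in> objects" "p \<in> free_span x y" "p' \<in> free_span x y" "s \<in> free_span x y"
    "pr x y p = pr x y p'"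
  shows "pr x y (p + s) = pr x y (p' + s)"
  using add[OF assms(1,2,3,5)] add[OF assms(1,2,4,5)] assms(6) by simp

lemma leading_eq_iff:
  assumes "x \<in> objects" "y \<in> objects" "p \<in> free_span x y" "p' \<in> free_span x y"
  shows "leading k x y p = leading k x y p' \<longleftrightarrow> lowered k x y (p - p')"
proof
  assume "leading k x y p = leading k x y p'"
  moreover have "pr x y (0 + p) \<in> leading k x y p"
    unfolding leading_def using free_lt_closed(1) by (rule imageI)
  ultimately obtain s where s: "s \<in> free_lt k x y" "pr x y p = pr x y (s + p')"
    by (auto simp: leading_def)
  have "0 - p' \<in> free_span x y" by (intro free_span_diff free_span_closed(1) assms)
  then have "pr x y (p + (0 - p')) = pr x y (s + p' + (0 - p'))"
    using s free_lt_span assms by (intro pr_cong_add free_span_closed(2)) auto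
  then show "lowered k x y (p - p')" unfolding lowered_def using s(1) by auto
next
  assume "lowered k x y (p - p')"
  then obtain s where s: "s \<in> free_lt k x y" "pr x y (p - p') = pr x y s" unfolding lowered_def by blast
  have shift: "pr x y (t + p) = pr x y (t + s + p')" if "t \<in> free_lt k x y" for t
  proof -
    have "pr x y (p - p' + (t + p')) = pr x y (s + (t + p'))"
      using s free_lt_span assms that by (intro pr_cong_add) (auto intro: free_span_closed free_span_diff)
    then show ?thesis by (simp add: algebra_simps)
  qed
  show "leading k x y p = leading k x y p'"
    unfolding leading_def
  proof (intro equalityI subsetI)
    fix f assume "f \<in> (\<lambda>s. pr x y (s + p)) ` free_lt k x y"
    then obtain t where t: "t \<in> free_lt k x y" "f = pr x y (t + p)" by blast
    then have "f = pr x y ((t + s) + p')" "t + s \<in> free_lt k x y"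
      using shift free_lt_closed(2) s(1) by auto
    then show "f \<in> (\<lambda>s. pr x y (s + p')) ` free_lt k x y" by blast
  next
    fix f assume "f \<in> (\<lambda>s. pr x y (s + p')) ` free_lt k x y"
    then obtain t where t: "t \<in> free_lt k x y" "f = pr x y (t + p')" by blast
    then have "t - s \<in> free_lt k x y" using free_lt_diff s(1) by blast
    moreover from this have "f = pr x y ((t - s) + p)" using shift[of "t - s"] t(2) by simp
    ultimately show "f \<in> (\<lambda>s. pr x y (s + p)) ` free_lt k x y" by blast
  qed
qed

lemma lowered_free_lt: "p \<in> free_lt k x y \<Longrightarrow> lowered k x y p"
  unfolding lowered_def by blast

lemma coset:
  assumes "x \<in> objects" "y \<in> objects" "p \<in> free_span x y"
  shows "filt_below C Fil k x y +>\<^bsub>Hom C x y\<^esub> pr x y p = leading k x y p"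
proof -
  have "s \<in> free_lt k x y \<Longrightarrow> pr x y s \<oplus>\<^bsub>Hom C x y\<^esub> pr x y p = pr x y (s + p)" for s
    using assms free_lt_span by (intro add) auto
  then show ?thesis unfolding a_r_coset_def' leading_def filt_below[OF assms(1,2)] by auto
qed

lemma coset_update: "H +>\<^bsub>M\<lparr>carrier := A\<rparr>\<^esub> a = H +>\<^bsub>M\<^esub> a"
  by (simp add: a_r_coset_def')

lemma gr_carrier:
  assumes "x \<in> objects" "y \<in> objects"
  shows "carrier (gr_piece C Fil k x y) = leading k x y ` free_lt (Suc k) x y"
  using coset[OF assms] free_lt_span
  by (auto simp: gr_piece_def quotient_module_def A_RCOSETS_def' coset_update filtration assms)

lemma gr_zero:
  assumes "x \<in> objects" "y \<in> objects"
  shows "\<zero>\<^bsub>gr_piece C Fil k x y\<^esub> = leading k x y 0"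
  by (simp add: gr_piece_def quotient_module_def filt_below assms leading_def)

lemma gr_add:
  assumes "x \<in> objects" "y \<in> objects" "p \<in> free_lt (Suc k) x y" "s \<in> free_lt (Suc k) x y"
  shows "leading k x y p \<oplus>\<^bsub>gr_piece C Fil k x y\<^esub> leading k x y s = leading k x y (p + s)"
proof -
  have a: "pr x y (t + p) \<oplus>\<^bsub>Hom C x y\<^esub> pr x y (t' + s) = pr x y ((t + t') + (p + s))"
    if "t \<in> free_lt k x y" "t' \<in> free_lt k x y" for t t'
  proof -
    have "pr x y (t + p) \<oplus>\<^bsub>Hom C x y\<^esub> pr x y (t' + s) = pr x y ((t + p) + (t' + s))"
      using that assms free_lt_span by (intro add) (auto intro!: free_span_closed)
    then show ?thesis by (simp add: algebra_simps)
  qed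
  have "leading k x y p <+>\<^bsub>Hom C x y\<^esub> leading k x y s = leading k x y (p + s)"
    unfolding set_add_def'
  proof (intro equalityI subsetI)
    fix f assume "f \<in> (\<Union>h\<in>leading k x y p. \<Union>k\<in>leading k x y s. {h \<oplus>\<^bsub>Hom C x y\<^esub> k})"
    then obtain t t' where t: "t \<in> free_lt k x y" "t' \<in> free_lt k x y"
      "f = pr x y (t + p) \<oplus>\<^bsub>Hom C x y\<^esub> pr x y (t' + s)" by (auto simp: leading_def)
    then show "f \<in> leading k x y (p + s)" using a[OF t(1,2)] free_lt_closed(2)
      unfolding leading_def by blast
  next
    fix f assume "f \<in> leading k x y (p + s)"
    then obtain t where t: "t \<in> free_lt k x y" "f = pr x y (t + (p + s))" by (auto simp: leading_def)
    then have "f = pr x y (t + p) \<oplus>\<^bsub>Hom C x y\<^esub> pr x y (0 + s)"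
      using a[OF t(1) free_lt_closed(1)] by simp
    then show "f \<in> (\<Union>h\<in>leading k x y p. \<Union>k\<in>leading k x y s. {h \<oplus>\<^bsub>Hom C x y\<^esub> k})"
      unfolding leading_def using t(1) free_lt_closed(1)[of k x y] by blast
  qed
  then show ?thesis by (simp add: gr_piece_def quotient_module_def set_add_def')
qed

lemma gr_smult:
  assumes "x \<in> objects" "y \<in> objects" "p \<in> free_lt (Suc k) x y"
  shows "c \<odot>\<^bsub>gr_piece C Fil k x y\<^esub> leading k x y p = leading k x y (smul c p)"
proof -
  have "filt_below C Fil k x y +>\<^bsub>Hom C x y\<^esub> (c \<odot>\<^bsub>Hom C x y\<^esub> v) = leading k x y (smul c p)"
    if v: "v \<in> leading k x y p" for v
  proof -
    obtain t where t: "t \<in> free_lt k x y" "v = pr x y (t + p)" using v by (auto simp: leading_def)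
    have sp: "t + p \<in> free_span x y" "p \<in> free_span x y" using t assms free_lt_span by (auto intro: free_span_closed)
    have "filt_below C Fil k x y +>\<^bsub>Hom C x y\<^esub> (c \<odot>\<^bsub>Hom C x y\<^esub> v) = leading k x y (smul c (t + p))"
      unfolding t(2) smult[OF assms(1,2) sp(1)] by (intro coset free_span_closed(3) sp assms)
    also have "\<dots> = leading k x y (smul c p)"
      using assms sp t free_lt_span[OF t(1)] lowered_free_lt[OF free_lt_closed(3)[OF t(1)], of c]
      by (subst leading_eq_iff) (auto intro!: free_span_closed(2,3))
    finally show ?thesis .
  qed
  moreover have "leading k x y p \<noteq> {}" using free_lt_closed(1) by (auto simp: leading_def)
  ultimately show ?thesis
    by (simp add: gr_piece_def quotient_module_def coset_update)
qed

lemma gr_finsum: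
  assumes "x \<in> objects" "y \<in> objects" "finite A" "\<And>i. i \<in> A \<Longrightarrow> P i \<in> free_lt (Suc k) x y \<and> Q i = leading k x y (P i)"
  shows "(\<Oplus>\<^bsub>gr_piece C Fil k x y\<^esub>i\<in>A. Q i) = leading k x y (\<Sum>i\<in>A. P i)"
  using assms
  by (intro finsum_image[where h = "leading k x y" and S = "free_lt (Suc k) x y"] gr_carrier gr_add gr_zero free_lt_closed) auto

abbreviation "Gr \<equiv> assoc_graded C Fil"

lemma hom_gr_iff:
  assumes "x \<in> objects" "y \<in> objects"
  shows "\<phi> \<in> carrier (Hom Gr x y) \<longleftrightarrow>
    (\<exists>P. (\<forall>k. P k \<in> free_lt (Suc k) x y) \<and> \<phi> = (\<lambda>k. leading k x y (P k)) \<and> finite {k. \<not> lowered k x y (P k)})"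
proof -
  have low: "leading k x y p \<noteq> \<zero>\<^bsub>gr_piece C Fil k x y\<^esub> \<longleftrightarrow> \<not> lowered k x y p" if "p \<in> free_lt (Suc k) x y" for k p
    using leading_eq_iff[OF assms free_lt_span[OF that] free_span_closed(1)] by (simp add: gr_zero assms)
  have "\<phi> \<in> carrier (Hom Gr x y) \<longleftrightarrow> (\<forall>k. \<phi> k \<in> leading k x y ` free_lt (Suc k) x y) \<and>
    finite {k. \<phi> k \<noteq> \<zero>\<^bsub>gr_piece C Fil k x y\<^esub>}"
    by (simp add: assoc_graded_def direct_sum_def gr_carrier assms)
  also have "(\<forall>k. \<phi> k \<in> leading k x y ` free_lt (Suc k) x y) \<longleftrightarrow>
      (\<exists>P. (\<forall>k. P k \<in> free_lt (Suc k) x y \<and> \<phi> k = leading k x y (P k)))"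
    by (subst choice_iff[symmetric]) blast
  also have "(\<exists>P. (\<forall>k. P k \<in> free_lt (Suc k) x y \<and> \<phi> k = leading k x y (P k))) \<and> finite {k. \<phi> k \<noteq> \<zero>\<^bsub>gr_piece C Fil k x y\<^esub>} \<longleftrightarrow>
    (\<exists>P. (\<forall>k. P k \<in> free_lt (Suc k) x y) \<and> \<phi> = (\<lambda>k. leading k x y (P k)) \<and> finite {k. \<not> lowered k x y (P k)})"
    (is "?L \<longleftrightarrow> ?R")
  proof
    assume ?L
    then obtain P where P: "\<And>k. P k \<in> free_lt (Suc k) x y" "\<And>k. \<phi> k = leading k x y (P k)"
      "finite {k. \<phi> k \<noteq> \<zero>\<^bsub>gr_piece C Fil k x y\<^esub>}" by blast
    have "{k. \<phi> k \<noteq> \<zero>\<^bsub>gr_piece C Fil k x y\<^esub>} = {k. \<not> lowered k x y (P k)}"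
      unfolding P(2) using low[OF P(1)] by simp
    then show ?R using P by (intro exI[of _ P]) auto
  next
    assume ?R
    then obtain P where P: "\<And>k. P k \<in> free_lt (Suc k) x y" "\<phi> = (\<lambda>k. leading k x y (P k))"
      "finite {k. \<not> lowered k x y (P k)}" by blast
    have "{k. \<phi> k \<noteq> \<zero>\<^bsub>gr_piece C Fil k x y\<^esub>} = {k. \<not> lowered k x y (P k)}"
      unfolding P(2) using low[OF P(1)] by simp
    then show ?L using P by auto
  qed
  finally show ?thesis .
qed

lemma gr_hom_add:
  assumes "x \<in> objects" "y \<in> objects" "\<And>k. P k \<in> free_lt (Suc k) x y" "\<And>k. Q k \<in> free_lt (Suc k) x y"
  shows "(\<lambda>k. leading k x y (P k)) \<oplus>\<^bsub>Hom Gr x y\<^esub> (\<lambda>k. leading k x y (Q k)) = (\<lambda>k. leading k x y (P k + Q k))"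
  using assms by (simp add: assoc_graded_def direct_sum_def gr_add)

lemma gr_hom_smult:
  assumes "x \<in> objects" "y \<in> objects" "\<And>k. P k \<in> free_lt (Suc k) x y"
  shows "c \<odot>\<^bsub>Hom Gr x y\<^esub> (\<lambda>k. leading k x y (P k)) = (\<lambda>k. leading k x y (smul c (P k)))"
  using assms by (simp add: assoc_graded_def direct_sum_def gr_smult)

lemma gr_ident:
  assumes "x \<in> objects"
  shows "ident Gr x = (\<lambda>k. leading k x x (if k = 0 then of_web (Id x) else 0))"
  using assms coset[of x x "of_web (Id x)" 0]
  by (auto simp: assoc_graded_def ident gr_zero webs_def free_span_of_web fun_eq_iff)

lemma gr_grade:
  "grade Gr n x y = {\<phi> \<in> carrier (Hom Gr x y). \<forall>k. k \<noteq> n \<longrightarrow> \<phi> k = \<zero>\<^bsub>gr_piece C Fil k x y\<^esub>}"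
  by (simp add: assoc_graded_def)

text \<open>Changing the factors by lower terms changes the product by lower terms, so all the
  cosets in the union coincide.\<close>

lemma gr_product:
  assumes o: "x \<in> objects" "y \<in> objects" "x' \<in> objects" "y' \<in> objects" "X \<in> objects" "Y \<in> objects"
    and P: "\<And>k. P k \<in> free_lt (Suc k) x y" and Q: "\<And>k. Q k \<in> free_lt (Suc k) x' y'"
    and webs: "\<And>w v. w \<in> webs x y \<Longrightarrow> v \<in> webs x' y' \<Longrightarrow> h w v \<in> webs X Y \<and> deg (h w v) = deg w + deg v"
    and op: "\<And>p s. p \<in> free_span x y \<Longrightarrow> s \<in> free_span x' y' \<Longrightarrow>
      op (pr x y p) (pr x' y' s) = pr X Y (bilinear_ext h p s)"
  shows "(\<Oplus>\<^bsub>gr_piece C Fil n X Y\<^esub>k\<in>{..n}. \<Union>g\<in>leading k x y (P k). \<Union>f\<in>leading (n - k) x' y' (Q (n - k)).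
      filt_below C Fil n X Y +>\<^bsub>Hom C X Y\<^esub> op g f) = leading n X Y (\<Sum>k\<le>n. bilinear_ext h (P k) (Q (n - k)))"
proof (rule gr_finsum[OF o(5,6)])
  let ?m = "bilinear_ext h"
  have bil: "?m p s \<in> free_lt m X Y" if "p \<in> free_lt k x y" "s \<in> free_lt l x' y'" "k + l \<le> Suc m" for p s k l m
    using free_lt_bilinear[OF that(1,2) webs that(3)] .
  have sp: "?m p s \<in> free_span X Y" if "p \<in> free_span x y" "s \<in> free_span x' y'" for p s
    using free_span_bilinear[OF that] webs by blast
  fix k assume "k \<in> {..n}"
  then have k: "k \<le> n" by simp
  have "filt_below C Fil n X Y +>\<^bsub>Hom C X Y\<^esub> op g f = leading n X Y (?m (P k) (Q (n - k)))"
    if gf: "g \<in> leading k x y (P k)" "f \<in> leading (n - k) x' y' (Q (n - k))" for g f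
  proof -
    obtain s t where s: "s \<in> free_lt k x y" "g = pr x y (s + P k)"
      and t: "t \<in> free_lt (n - k) x' y'" "f = pr x' y' (t + Q (n - k))"
      using gf by (auto simp: leading_def)
    have sps: "s + P k \<in> free_span x y" "t + Q (n - k) \<in> free_span x' y'" "P k \<in> free_span x y" "Q (n - k) \<in> free_span x' y'"
      using s t P[of k] Q[of "n - k"] free_lt_span by (auto intro!: free_span_closed)
    have "filt_below C Fil n X Y +>\<^bsub>Hom C X Y\<^esub> op g f = leading n X Y (?m (s + P k) (t + Q (n - k)))"
      unfolding s(2) t(2) op[OF sps(1,2)] by (rule coset[OF o(5,6) sp[OF sps(1,2)]])
    also have "\<dots> = leading n X Y (?m (P k) (Q (n - k)))"
    proof -
      have "t + Q (n - k) \<in> free_lt (Suc (n - k)) x' y'"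
        using free_lt_mono[OF t(1)] Q by (intro free_lt_closed) auto
      then have "?m s (t + Q (n - k)) \<in> free_lt n X Y" using k by (intro bil[OF s(1)]) auto
      moreover have "?m (P k) t \<in> free_lt n X Y" using k by (intro bil[OF P t(1)]) auto
      moreover have "?m (s + P k) (t + Q (n - k)) - ?m (P k) (Q (n - k)) = ?m s (t + Q (n - k)) + ?m (P k) t"
        by (simp add: algebra_simps)
      ultimately have "?m (s + P k) (t + Q (n - k)) - ?m (P k) (Q (n - k)) \<in> free_lt n X Y"
        by (simp only: free_lt_closed(2))
      then show ?thesis
        using leading_eq_iff[OF o(5,6) sp[OF sps(1,2)] sp[OF sps(3,4)]] lowered_free_lt by blast
    qed
    finally show ?thesis .
  qed
  moreover have "leading k x y (P k) \<noteq> {}" "leading (n - k) x' y' (Q (n - k)) \<noteq> {}"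
    using free_lt_closed(1) by (auto simp: leading_def)
  moreover have "?m (P k) (Q (n - k)) \<in> free_lt (Suc n) X Y" using k by (intro bil[OF P Q]) auto
  ultimately show "?m (P k) (Q (n - k)) \<in> free_lt (Suc n) X Y \<and>
    (\<Union>g\<in>leading k x y (P k). \<Union>f\<in>leading (n - k) x' y' (Q (n - k)).
      filt_below C Fil n X Y +>\<^bsub>Hom C X Y\<^esub> op g f) = leading n X Y (?m (P k) (Q (n - k)))" by simp
qed simp

lemma gr_comp:
  assumes "x \<in> objects" "y \<in> objects" "z \<in> objects"
    "\<And>k. P k \<in> free_lt (Suc k) y z" "\<And>k. Q k \<in> free_lt (Suc k) x y"
  shows "moncat.comp Gr x y z (\<lambda>k. leading k y z (P k)) (\<lambda>k. leading k x y (Q k)) =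
    (\<lambda>n. leading n x z (\<Sum>k\<le>n. lin_comp (P k) (Q (n - k))))"
  using gr_product[OF assms(2,3,1,2,1,3,4,5), of Comp "moncat.comp C x y z"] assms webs_Comp comp
  by (simp add: assoc_graded_def)

lemma gr_tens:
  assumes "x \<in> objects" "y \<in> objects" "x' \<in> objects" "y' \<in> objects"
    "\<And>k. P k \<in> free_lt (Suc k) x y" "\<And>k. Q k \<in> free_lt (Suc k) x' y'"
  shows "moncat.tens Gr x y x' y' (\<lambda>k. leading k x y (P k)) (\<lambda>k. leading k x' y' (Q k)) =
    (\<lambda>n. leading n (x @ x') (y @ y') (\<Sum>k\<le>n. lin_tens (P k) (Q (n - k))))"
  using gr_product[OF assms(1-4) _ _ assms(5,6), of "x @ x'" "y @ y'" Tens "moncat.tens C x y x' y'"] assms webs_Tens tens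
  by (simp add: assoc_graded_def tens_obj)

end

text \<open>The isomorphism sends the class of a combination of webs to the class of the same
  combination. It is well defined and injective because the same combinations are lowered on
  both sides.\<close>

theorem graded_isomorphic_presentations:
  fixes C :: "(nat list, 'm) lin_moncat" and D :: "(nat list, 'n) lin_moncat"
  assumes C: "presentation C pc rc" and D: "presentation D pd rd"
    and same: "\<And>x y k p. x \<in> objects \<Longrightarrow> y \<in> objects \<Longrightarrow> p \<in> free_lt (Suc k) x y \<Longrightarrow>
      presentation.lowered pc k x y p \<longleftrightarrow> presentation.lowered pd k x y p"
  shows "graded_isomorphic (assoc_graded C (web_filtration C rc)) (assoc_graded D (web_filtration D rd))"
proof -
  interpret c: presentation C pc rc by (rule C)
  interpret d: presentation D pd rd by (rule D)
  define lift where "lift x y X k = (SOME p. p \<in> free_lt (Suc k) x y \<and> X = c.leading k x y p)" for x y X k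
  define f where "f x y \<phi> = (\<lambda>k. d.leading k x y (lift x y (\<phi> k) k))" for x y and \<phi> :: "nat \<Rightarrow> 'm set"
  have eq: "c.leading k x y p = c.leading k x y p' \<longleftrightarrow> d.leading k x y p = d.leading k x y p'"
    if "x \<in> objects" "y \<in> objects" "p \<in> free_lt (Suc k) x y" "p' \<in> free_lt (Suc k) x y" for k x y p p'
    using c.leading_eq_iff[of x y p p' k] d.leading_eq_iff[of x y p p' k] same[of x y "p - p'" k]
      free_lt_span free_lt_diff[OF that(3,4)] that by blast
  have f: "f x y (\<lambda>k. c.leading k x y (P k)) = (\<lambda>k. d.leading k x y (P k))"
    if "x \<in> objects" "y \<in> objects" "\<And>k. P k \<in> free_lt (Suc k) x y" for x y P
  proof
    fix k
    have "lift x y (c.leading k x y (P k)) k \<in> free_lt (Suc k) x y \<and>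
      c.leading k x y (P k) = c.leading k x y (lift x y (c.leading k x y (P k)) k)"
      unfolding lift_def by (rule someI[of _ "P k"]) (use that in simp)
    then show "f x y (\<lambda>k. c.leading k x y (P k)) k = d.leading k x y (P k)"
      using eq that unfolding f_def by metis
  qed
  have rep: "\<exists>P. (\<forall>k. P k \<in> free_lt (Suc k) x y) \<and> \<phi> = (\<lambda>k. c.leading k x y (P k)) \<and> finite {k. \<not> c.lowered k x y (P k)}"
    if "x \<in> objects" "y \<in> objects" "\<phi> \<in> carrier (Hom c.Gr x y)" for x y \<phi>
    using c.hom_gr_iff[OF that(1,2), of \<phi>] that(3) by blast
  have repd: "\<exists>P. (\<forall>k. P k \<in> free_lt (Suc k) x y) \<and> \<phi> = (\<lambda>k. d.leading k x y (P k)) \<and> finite {k. \<not> c.lowered k x y (P k)}"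
    if o: "x \<in> objects" "y \<in> objects" and \<phi>: "\<phi> \<in> carrier (Hom d.Gr x y)" for x y \<phi>
  proof -
    obtain P where P: "\<And>k. P k \<in> free_lt (Suc k) x y" "\<phi> = (\<lambda>k. d.leading k x y (P k))" "finite {k. \<not> d.lowered k x y (P k)}"
      using d.hom_gr_iff[OF o, of \<phi>] \<phi> by blast
    have "{k. \<not> c.lowered k x y (P k)} = {k. \<not> d.lowered k x y (P k)}" using same o P(1) by simp
    then show ?thesis using P by (intro exI[of _ P]) auto
  qed
  have fin: "finite {k. \<not> d.lowered k x y (P k)}" if "x \<in> objects" "y \<in> objects" "\<And>k. P k \<in> free_lt (Suc k) x y"
    "finite {k. \<not> c.lowered k x y (P k)}" for x y P
  proof -
    have "{k. \<not> d.lowered k x y (P k)} = {k. \<not> c.lowered k x y (P k)}" using same that by simp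
    then show ?thesis using that by simp
  qed
  have inC: "(\<lambda>k. c.leading k x y (P k)) \<in> carrier (Hom c.Gr x y)"
    and inD: "(\<lambda>k. d.leading k x y (P k)) \<in> carrier (Hom d.Gr x y)"
    if "x \<in> objects" "y \<in> objects" "\<And>k. P k \<in> free_lt (Suc k) x y" "finite {k. \<not> c.lowered k x y (P k)}" for x y P
    using c.hom_gr_iff[OF that(1,2)] d.hom_gr_iff[OF that(1,2)] that fin[OF that] by blast+
  have bij: "bij_betw (f x y) (carrier (Hom c.Gr x y)) (carrier (Hom d.Gr x y))"
    if o: "x \<in> objects" "y \<in> objects" for x y
  proof (rule bij_betw_imageI)
    show "inj_on (f x y) (carrier (Hom c.Gr x y))"
    proof (rule inj_onI)
      fix \<phi> \<psi> assume "\<phi> \<in> carrier (Hom c.Gr x y)" "\<psi> \<in> carrier (Hom c.Gr x y)" and e: "f x y \<phi> = f x y \<psi>"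
      then obtain P Q where P: "\<And>k. P k \<in> free_lt (Suc k) x y" "\<phi> = (\<lambda>k. c.leading k x y (P k))"
        and Q: "\<And>k. Q k \<in> free_lt (Suc k) x y" "\<psi> = (\<lambda>k. c.leading k x y (Q k))"
        using rep[OF o] by blast
      have "d.leading k x y (P k) = d.leading k x y (Q k)" for k
        using fun_cong[OF e, of k] unfolding P(2) Q(2) f[OF o P(1)] f[OF o Q(1)] .
      then show "\<phi> = \<psi>" unfolding P(2) Q(2) using eq[OF o P(1) Q(1)] by simp
    qed
    show "f x y ` carrier (Hom c.Gr x y) = carrier (Hom d.Gr x y)"
    proof (intro equalityI subsetI)
      fix \<psi> assume "\<psi> \<in> f x y ` carrier (Hom c.Gr x y)"
      then obtain \<phi> where \<phi>: "\<phi> \<in> carrier (Hom c.Gr x y)" "\<psi> = f x y \<phi>" by blast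
      then obtain P where P: "\<And>k. P k \<in> free_lt (Suc k) x y" "\<phi> = (\<lambda>k. c.leading k x y (P k))"
        "finite {k. \<not> c.lowered k x y (P k)}" using rep[OF o] by blast
      then show "\<psi> \<in> carrier (Hom d.Gr x y)" unfolding \<phi>(2) P(2) f[OF o P(1)] by (intro inD o)
    next
      fix \<psi> assume "\<psi> \<in> carrier (Hom d.Gr x y)"
      then obtain P where P: "\<And>k. P k \<in> free_lt (Suc k) x y" "\<psi> = (\<lambda>k. d.leading k x y (P k))"
        "finite {k. \<not> c.lowered k x y (P k)}" using repd[OF o] by blast
      then have "\<psi> = f x y (\<lambda>k. c.leading k x y (P k))" using f[OF o P(1)] by simp
      then show "\<psi> \<in> f x y ` carrier (Hom c.Gr x y)" using inC[OF o P(1,3)] by blast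
    qed
  qed
  have grade: "f x y ` grade c.Gr n x y = grade d.Gr n x y"
    if o: "x \<in> objects" "y \<in> objects" for x y n
  proof -
    have z: "f x y \<phi> k = \<zero>\<^bsub>gr_piece D d.Fil k x y\<^esub> \<longleftrightarrow> \<phi> k = \<zero>\<^bsub>gr_piece C c.Fil k x y\<^esub>"
      if \<phi>: "\<phi> \<in> carrier (Hom c.Gr x y)" for \<phi> k
    proof -
      obtain P where P: "\<And>k. P k \<in> free_lt (Suc k) x y" "\<phi> = (\<lambda>k. c.leading k x y (P k))"
        using rep[OF o \<phi>] by blast
      show ?thesis unfolding P(2) f[OF o P(1)] c.gr_zero[OF o] d.gr_zero[OF o]
        using eq[OF o P(1) free_lt_closed(1)] by simp
    qed
    have im: "f x y ` carrier (Hom c.Gr x y) = carrier (Hom d.Gr x y)" using bij[OF o] by (simp add: bij_betw_def)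
    show ?thesis unfolding c.gr_grade d.gr_grade im[symmetric] using z by auto
  qed
  have addf: "f x y (\<phi> \<oplus>\<^bsub>Hom c.Gr x y\<^esub> \<psi>) = f x y \<phi> \<oplus>\<^bsub>Hom d.Gr x y\<^esub> f x y \<psi>"
    if o: "x \<in> objects" "y \<in> objects" and \<phi>: "\<phi> \<in> carrier (Hom c.Gr x y)" "\<psi> \<in> carrier (Hom c.Gr x y)" for x y \<phi> \<psi>
  proof -
    obtain P Q where P: "\<And>k. P k \<in> free_lt (Suc k) x y" "\<phi> = (\<lambda>k. c.leading k x y (P k))"
      and Q: "\<And>k. Q k \<in> free_lt (Suc k) x y" "\<psi> = (\<lambda>k. c.leading k x y (Q k))"
      using rep[OF o] \<phi> by blast
    show ?thesis unfolding P(2) Q(2) c.gr_hom_add[OF o P(1) Q(1)] f[OF o P(1)] f[OF o Q(1)] d.gr_hom_add[OF o P(1) Q(1)]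
      by (rule f[OF o]) (intro free_lt_closed P Q)
  qed
  have smultf: "f x y (a \<odot>\<^bsub>Hom c.Gr x y\<^esub> \<phi>) = a \<odot>\<^bsub>Hom d.Gr x y\<^esub> f x y \<phi>"
    if o: "x \<in> objects" "y \<in> objects" and \<phi>: "\<phi> \<in> carrier (Hom c.Gr x y)" for x y \<phi> a
  proof -
    obtain P where P: "\<And>k. P k \<in> free_lt (Suc k) x y" "\<phi> = (\<lambda>k. c.leading k x y (P k))"
      using rep[OF o \<phi>] by blast
    show ?thesis unfolding P(2) c.gr_hom_smult[OF o P(1)] f[OF o P(1)] d.gr_hom_smult[OF o P(1)]
      by (rule f[OF o]) (intro free_lt_closed P)
  qed
  have identf: "f x x (ident c.Gr x) = ident d.Gr x" if o: "x \<in> objects" for x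
    unfolding c.gr_ident[OF o] d.gr_ident[OF o]
    by (rule f[OF o o]) (use o in \<open>auto simp: webs_def intro!: free_lt_of_web free_lt_closed\<close>)
  have compf: "f x z (moncat.comp c.Gr x y z \<psi> \<phi>) = moncat.comp d.Gr x y z (f y z \<psi>) (f x y \<phi>)"
    if o: "x \<in> objects" "y \<in> objects" "z \<in> objects"
      and \<phi>: "\<phi> \<in> carrier (Hom c.Gr x y)" "\<psi> \<in> carrier (Hom c.Gr y z)" for x y z \<phi> \<psi>
  proof -
    obtain P Q where P: "\<And>k. P k \<in> free_lt (Suc k) x y" "\<phi> = (\<lambda>k. c.leading k x y (P k))"
      and Q: "\<And>k. Q k \<in> free_lt (Suc k) y z" "\<psi> = (\<lambda>k. c.leading k y z (Q k))"
      using rep[OF o(1,2) \<phi>(1)] rep[OF o(2,3) \<phi>(2)] by blast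
    have "lin_comp (Q k) (P (n - k)) \<in> free_lt (Suc n) x z" if "k \<le> n" for k n
      by (rule free_lt_bilinear[OF Q(1) P(1)]) (use webs_Comp that in auto)
    then show ?thesis
      unfolding P(2) Q(2) c.gr_comp[OF o Q(1) P(1)] f[OF o(1,2) P(1)] f[OF o(2,3) Q(1)] d.gr_comp[OF o Q(1) P(1)]
      by (intro f o free_lt_sum) auto
  qed
  have tensf: "f (x @ x') (y @ y') (moncat.tens c.Gr x y x' y' \<phi> \<psi>) = moncat.tens d.Gr x y x' y' (f x y \<phi>) (f x' y' \<psi>)"
    if o: "x \<in> objects" "y \<in> objects" "x' \<in> objects" "y' \<in> objects"
      and \<phi>: "\<phi> \<in> carrier (Hom c.Gr x y)" "\<psi> \<in> carrier (Hom c.Gr x' y')" for x y x' y' \<phi> \<psi>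
  proof -
    obtain P Q where P: "\<And>k. P k \<in> free_lt (Suc k) x y" "\<phi> = (\<lambda>k. c.leading k x y (P k))"
      and Q: "\<And>k. Q k \<in> free_lt (Suc k) x' y'" "\<psi> = (\<lambda>k. c.leading k x' y' (Q k))"
      using rep[OF o(1,2) \<phi>(1)] rep[OF o(3,4) \<phi>(2)] by blast
    have "lin_tens (P k) (Q (n - k)) \<in> free_lt (Suc n) (x @ x') (y @ y')" if "k \<le> n" for k n
      by (rule free_lt_bilinear[OF P(1) Q(1)]) (use webs_Tens that in auto)
    then show ?thesis
      unfolding P(2) Q(2) c.gr_tens[OF o P(1) Q(1)] f[OF o(1,2) P(1)] f[OF o(3,4) Q(1)] d.gr_tens[OF o P(1) Q(1)]
      by (intro f free_lt_sum) (use o in auto)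
  qed
  have simps: "Obj c.Gr = objects" "Obj d.Gr = objects" "unit_obj c.Gr = []" "unit_obj d.Gr = []"
    "tens_obj c.Gr = (@)" "tens_obj d.Gr = (@)"
    by (simp_all add: assoc_graded_def c.Obj d.Obj c.unit_obj d.unit_obj c.tens_obj d.tens_obj)
  have "bij_betw (\<lambda>x. x) objects objects" by (simp add: bij_betw_def inj_on_def)
  then show ?thesis
    unfolding graded_isomorphic_def simps
    by (intro exI[of _ "\<lambda>x. x"] exI[of _ f]) (simp add: bij grade addf smultf identf compf tensf)
qed

lemma sc_class_operation:
  assumes "well_formed w" "well_formed v" "\<And>g f. sc_eq w g \<Longrightarrow> sc_eq v f \<Longrightarrow> sc_eq (h w v) (h g f)"
  shows "(\<Union>g\<in>sc_class w. \<Union>f\<in>sc_class v. sc_class (h g f)) = sc_class (h w v)"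
proof -
  have "sc_class (h g f) = sc_class (h w v)" if "g \<in> sc_class w" "f \<in> sc_class v" for g f
  proof -
    have e: "sc_eq (h w v) (h g f)" using that by (intro assms(3)) (simp_all add: sc_class_def)
    show ?thesis using e sc_class_eq_iff[of "h w v" "h g f"] sc_eq_parallel[OF e] by simp
  qed
  moreover have "w \<in> sc_class w" "v \<in> sc_class v" using assms by (auto simp: sc_class_def intro: sc_eq.refl)
  ultimately show ?thesis by blast
qed

lemma sc_proj_bilinear:
  assumes "p \<in> free_span x y" "s \<in> free_span x' y'"
    "\<And>w v. w \<in> webs x y \<Longrightarrow> v \<in> webs x' y' \<Longrightarrow> H (sc_class w) (sc_class v) = sc_class (h w v)"
  shows "bilinear_ext H (sc_proj p) (sc_proj s) = sc_proj (bilinear_ext h p s)"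
  using assms(1)[unfolded free_span_def, simplified]
proof (induction rule: poly_mapping_span_induct)
  case (single w a)
  show ?case
    using assms(2)[unfolded free_span_def, simplified]
    by (induction rule: poly_mapping_span_induct) (simp_all add: assms(3) single)
qed simp_all

lemma presentation_SC:
  "presentation Lin_SC_Webs (\<lambda>x y. sc_proj) (\<lambda>x y w. Poly_Mapping.single (sc_class w) 1)"
proof
  fix x y assume "x \<in> objects" "y \<in> objects"
  show "carrier (Hom Lin_SC_Webs x y) = sc_proj ` free_span x y"
  proof (intro equalityI subsetI)
    fix q assume "q \<in> carrier (Hom Lin_SC_Webs x y)"
    then have q: "Poly_Mapping.keys q \<subseteq> sc_class ` webs x y"
      by (simp add: Lin_SC_Webs_def linearization_def SC_Webs_def free_module_def)
    \<comment> \<open>Any choice of representatives of the classes serves as a preimage.\<close>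
    let ?p = "lin_ext (\<lambda>X. of_web (shortest X)) q"
    have "?p \<in> free_span x y"
      unfolding lin_ext_def using q shortest_webs
      by (intro free_span_sum free_span_closed free_span_of_web) blast
    moreover have "sc_proj ?p = lin_ext (\<lambda>X. Poly_Mapping.single (sc_class (shortest X)) 1) q"
      unfolding sc_proj_def lin_ext_lin_ext by (simp add: of_web_def)
    then have "sc_proj ?p = lin_ext (\<lambda>X. Poly_Mapping.single X 1) q"
    proof (rule HOL.trans[OF _ lin_ext_cong])
      fix X assume "X \<in> Poly_Mapping.keys q"
      then obtain w where "X = sc_class w" "w \<in> webs x y" using q by blast
      then have "sc_class (shortest X) = X" using shortest(3) by (simp add: webs_def)
      then show "Poly_Mapping.single (sc_class (shortest X)) 1 = (Poly_Mapping.single X 1 :: web set \<Rightarrow>\<^sub>0 laurent)" by simp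
    qed
    then have "q = sc_proj ?p" using poly_mapping_expand[of q] by simp
    ultimately show "q \<in> sc_proj ` free_span x y" by blast
  next
    fix q assume "q \<in> sc_proj ` free_span x y"
    then obtain p where "Poly_Mapping.keys p \<subseteq> webs x y" "q = sc_proj p" by (auto simp: free_span_def)
    then have "Poly_Mapping.keys q \<subseteq> sc_class ` webs x y" using keys_sc_proj[of p] by blast
    then show "q \<in> carrier (Hom Lin_SC_Webs x y)"
      by (simp add: Lin_SC_Webs_def linearization_def SC_Webs_def free_module_def)
  qed
next
  fix x y z p s assume ps: "p \<in> free_span y z" "s \<in> free_span x y"
  show "moncat.comp Lin_SC_Webs x y z (sc_proj p) (sc_proj s) = sc_proj (lin_comp p s)"
    unfolding Lin_SC_Webs_def linearization_def SC_Webs_def moncat.simps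
    by (rule sc_proj_bilinear[OF ps], rule sc_class_operation) (auto simp: webs_def intro!: sc_eq.comp)
next
  fix x y x' y' p s assume ps: "p \<in> free_span x y" "s \<in> free_span x' y'"
  show "moncat.tens Lin_SC_Webs x y x' y' (sc_proj p) (sc_proj s) = sc_proj (lin_tens p s)"
    unfolding Lin_SC_Webs_def linearization_def SC_Webs_def moncat.simps
    by (rule sc_proj_bilinear[OF ps], rule sc_class_operation) (auto simp: webs_def intro!: sc_eq.tens)
qed (auto simp: Lin_SC_Webs_def linearization_def SC_Webs_def free_module_def smul_def[symmetric])

lemma ideal_bilinear_left:
  assumes "inf_ideal x y p" "s \<in> free_span x' y'"
    "\<And>w. w \<in> webs x' y' \<Longrightarrow> inf_ideal x'' y'' (bilinear_ext h p (of_web w))"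
  shows "inf_ideal x'' y'' (bilinear_ext h p s)"
  using assms(2)[unfolded free_span_def, simplified]
proof (induction rule: poly_mapping_span_induct)
  case (single w a)
  have "bilinear_ext h p (Poly_Mapping.single w a) = smul a (bilinear_ext h p (of_web w))"
    by (simp add: of_web_def flip: bilinear_ext_simps(6))
  then show ?case using assms(3) single inf_ideal_smul by simp
qed (auto intro: inf_ideal.zero inf_ideal.add)

lemma ideal_bilinear_right:
  assumes "inf_ideal x y p" "s \<in> free_span x' y'"
    "\<And>w. w \<in> webs x' y' \<Longrightarrow> inf_ideal x'' y'' (bilinear_ext h (of_web w) p)"
  shows "inf_ideal x'' y'' (bilinear_ext h s p)"
  using assms(2)[unfolded free_span_def, simplified]
proof (induction rule: poly_mapping_span_induct)
  case (single w a)
  have "bilinear_ext h (Poly_Mapping.single w a) p = smul a (bilinear_ext h (of_web w) p)"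
    by (simp add: of_web_def flip: bilinear_ext_simps(5))
  then show ?case using assms(3) single inf_ideal_smul by simp
qed (auto intro: inf_ideal.zero inf_ideal.add)

lemma inf_class_iff: "s \<in> inf_class x y p \<longleftrightarrow> inf_ideal x y (s - p)"
proof -
  have "s \<in> inf_class x y p \<longleftrightarrow> (\<exists>i. inf_ideal x y i \<and> s = i + p)"
    by (auto simp: inf_class_def a_r_coset_def' free_module_def)
  also have "\<dots> \<longleftrightarrow> inf_ideal x y (s - p)"
    by (metis add_diff_cancel_right' diff_add_cancel)
  finally show ?thesis .
qed

lemma inf_class_eq_iff: "inf_class x y p = inf_class x y s \<longleftrightarrow> inf_ideal x y (p - s)"
proof
  assume "inf_class x y p = inf_class x y s"
  moreover have "p \<in> inf_class x y p" by (simp add: inf_class_iff inf_ideal.zero)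
  ultimately show "inf_ideal x y (p - s)" by (simp add: inf_class_iff)
next
  assume i: "inf_ideal x y (p - s)"
  have "inf_ideal x y (t - p) \<longleftrightarrow> inf_ideal x y (t - s)" for t
    using inf_ideal.add[OF _ i, of "t - p"] inf_ideal_diff[OF _ i, of "t - s"] by auto
  then show "inf_class x y p = inf_class x y s" by (auto simp: inf_class_iff)
qed

lemma inf_class_operation:
  assumes p: "p \<in> free_span x y" and s: "s \<in> free_span x' y'"
    and left: "\<And>i w. inf_ideal x y i \<Longrightarrow> w \<in> webs x' y' \<Longrightarrow> inf_ideal x'' y'' (bilinear_ext h i (of_web w))"
    and right: "\<And>i w. inf_ideal x' y' i \<Longrightarrow> w \<in> webs x y \<Longrightarrow> inf_ideal x'' y'' (bilinear_ext h (of_web w) i)"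
  shows "(\<Union>g\<in>inf_class x y p. \<Union>f\<in>inf_class x' y' s. inf_class x'' y'' (bilinear_ext h g f)) =
    inf_class x'' y'' (bilinear_ext h p s)"
proof -
  have "inf_class x'' y'' (bilinear_ext h g f) = inf_class x'' y'' (bilinear_ext h p s)"
    if "g \<in> inf_class x y p" "f \<in> inf_class x' y' s" for g f
  proof -
    have i: "inf_ideal x y (g - p)" "inf_ideal x' y' (f - s)" using that by (simp_all add: inf_class_iff)
    have "(f - s) + s \<in> free_span x' y'" by (intro free_span_closed(2) inf_ideal_free_span i s)
    then have f: "f \<in> free_span x' y'" by simp
    have "bilinear_ext h g f - bilinear_ext h p s = bilinear_ext h (g - p) f + bilinear_ext h p (f - s)"
      by simp
    moreover have "inf_ideal x'' y'' (bilinear_ext h (g - p) f)"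
      by (rule ideal_bilinear_left[OF i(1) f left[OF i(1)]])
    moreover have "inf_ideal x'' y'' (bilinear_ext h p (f - s))"
      by (rule ideal_bilinear_right[OF i(2) p right[OF i(2)]])
    ultimately show ?thesis unfolding inf_class_eq_iff by (simp only: inf_ideal.add)
  qed
  moreover have "p \<in> inf_class x y p" "s \<in> inf_class x' y' s" by (simp_all add: inf_class_iff inf_ideal.zero)
  ultimately show ?thesis by blast
qed

lemma presentation_inf: "presentation Webs_inf inf_class (\<lambda>x y w. inf_class x y (of_web w))"
proof
  fix x y assume "x \<in> objects" "y \<in> objects"
  show "carrier (Hom Webs_inf x y) = inf_class x y ` free_span x y"
    by (auto simp: Webs_inf_def quotient_module_def A_RCOSETS_def' inf_class_def free_module_def free_span_def)
  show "\<zero>\<^bsub>Hom Webs_inf x y\<^esub> = inf_class x y 0"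
    by (auto simp: Webs_inf_def quotient_module_def inf_class_iff)
next
  fix x y p s
  have "inf_class x y p <+>\<^bsub>free_module (webs x y)\<^esub> inf_class x y s = inf_class x y (p + s)"
  proof (intro equalityI subsetI)
    fix f assume "f \<in> inf_class x y p <+>\<^bsub>free_module (webs x y)\<^esub> inf_class x y s"
    then obtain g h where "f = g + h" "inf_ideal x y (g - p)" "inf_ideal x y (h - s)"
      by (auto simp: set_add_def' inf_class_iff free_module_def)
    then show "f \<in> inf_class x y (p + s)"
      using inf_ideal.add[of x y "g - p" "h - s"] by (simp add: inf_class_iff algebra_simps)
  next
    fix f assume "f \<in> inf_class x y (p + s)"
    then have *: "f = (f - s) + s" "f - s \<in> inf_class x y p" "s \<in> inf_class x y s"
      by (simp_all add: inf_class_iff inf_ideal.zero diff_diff_eq add.commute)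
    from *(2,3) have "(f - s) \<oplus>\<^bsub>free_module (webs x y)\<^esub> s \<in> inf_class x y p <+>\<^bsub>free_module (webs x y)\<^esub> inf_class x y s"
      unfolding set_add_def' by blast
    then show "f \<in> inf_class x y p <+>\<^bsub>free_module (webs x y)\<^esub> inf_class x y s"
      by (simp add: free_module_def)
  qed
  then show "inf_class x y p \<oplus>\<^bsub>Hom Webs_inf x y\<^esub> inf_class x y s = inf_class x y (p + s)"
    by (simp add: Webs_inf_def quotient_module_def)
next
  fix x y p c
  have "inf_class x y (smul c v) = inf_class x y (smul c p)" if "v \<in> inf_class x y p" for v
    using that inf_ideal_smul[of x y "v - p" c] by (simp add: inf_class_eq_iff inf_class_iff)
  moreover have "p \<in> inf_class x y p" by (simp add: inf_class_iff inf_ideal.zero)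
  ultimately have "(\<Union>v\<in>inf_class x y p. inf_class x y (smul c v)) = inf_class x y (smul c p)" by blast
  then show "c \<odot>\<^bsub>Hom Webs_inf x y\<^esub> inf_class x y p = inf_class x y (smul c p)"
    by (simp add: Webs_inf_def quotient_module_def inf_class_def free_module_def smul_def)
next
  fix x y z p s assume ps: "p \<in> free_span y z" "s \<in> free_span x y"
  show "moncat.comp Webs_inf x y z (inf_class y z p) (inf_class x y s) = inf_class x z (lin_comp p s)"
    unfolding Webs_inf_def moncat.simps
    by (rule inf_class_operation[OF ps]) (rule inf_ideal.comp_right inf_ideal.comp_left; assumption)+
next
  fix x y x' y' p s assume ps: "p \<in> free_span x y" "s \<in> free_span x' y'"
  show "moncat.tens Webs_inf x y x' y' (inf_class x y p) (inf_class x' y' s) = inf_class (x @ x') (y @ y') (lin_tens p s)"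
    unfolding Webs_inf_def moncat.simps
    by (rule inf_class_operation[OF ps]) (rule inf_ideal.tens_right inf_ideal.tens_left; assumption)+
qed (simp_all add: Webs_inf_def)

lemma lowered_SC:
  "presentation.lowered (\<lambda>x y. sc_proj) k x y p \<longleftrightarrow> (\<exists>s\<in>free_lt k x y. sc_proj p = sc_proj s)"
  using presentation.lowered_def[OF presentation_SC] by blast

lemma lowered_inf: "presentation.lowered inf_class k x y p \<longleftrightarrow> low k x y p"
  using presentation.lowered_def[OF presentation_inf] by (auto simp: low_def inf_class_eq_iff)

theorem theorem7p11:
  shows "graded_isomorphic
    (assoc_graded Lin_SC_Webs Lin_SC_filtration)
    (assoc_graded Webs_inf Webs_inf_filtration)"
  unfolding Lin_SC_filtration_def Webs_inf_filtration_def
proof (rule graded_isomorphic_presentations[OF presentation_SC presentation_inf])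
  fix x y k p assume p: "p \<in> free_lt (Suc k) x y"
  show "presentation.lowered (\<lambda>x y. sc_proj) k x y p \<longleftrightarrow> presentation.lowered inf_class k x y p"
    unfolding lowered_SC lowered_inf
  proof
    assume "\<exists>s\<in>free_lt k x y. sc_proj p = sc_proj s"
    then obtain s where s: "s \<in> free_lt k x y" "sc_proj (p - s) = 0" by auto
    have "p - s \<in> free_lt (Suc k) x y" using p free_lt_mono[OF s(1)] by (intro free_lt_diff) auto
    then have "low k x y (p - s)" by (rule sc_kernel_low[OF _ s(2)])
    from low_add[OF this low_free[OF s(1)]] show "low k x y p" by simp
  next
    assume "low k x y p"
    then obtain s where s: "s \<in> free_lt k x y" "inf_ideal x y (p - s)" unfolding low_def by blast
    have "p - s \<in> free_lt (Suc k) x y" using p free_lt_mono[OF s(1)] by (intro free_lt_diff) auto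
    then obtain t where t: "t \<in> free_lt k x y" "sc_proj (p - s) = sc_proj t" using inf_kernel_low s(2) by blast
    then have "sc_proj p = sc_proj (t + s)" by (simp add: algebra_simps)
    then show "\<exists>s\<in>free_lt k x y. sc_proj p = sc_proj s" using t(1) s(1) free_lt_closed(2) by blast
  qed
qed

end
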